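(* Let $\alpha\in\mathbb R$, $s\in\mathbb R$, $\lambda>0$ and $y_1\ge y_0>0$. Let $g:(0,\infty)\to\mathbb R$ be of class $\mathcal C^2$. (1) If $|g'|\ge\lambda$ and $g''$ has a finite number of zeros on $(0,y_0]$, there exists $C>0$ such that for any $t\in\mathbb R\setminus\{0\}$, any $\delta>0$ and any $k\in\mathbb Z$ with $2^k\le\frac12y_0$, $$\sup_{x\in\mathbb R^2}|I^{s}_{t,x,k}|\le C\,\frac{2^{(s+\frac32)k}\delta^{-(s+\frac32)}}{\sqrt{|t|}}.$$ (2) If $|g'|+|g''|\ge\lambda$ and $g''$ has a finite number of zeros on $[\frac12y_0,2y_1]$, there exists $C>0$ such that for any $t\in\mathbb R\setminus\{0\}$, any $\delta>0$ and any $k\in\mathbb Z$ with $y_0\le2^k\le y_1$, $$\sup_{x\in\mathbb R^2}|I^{s}_{t,x,k}|\le C\,\frac{\delta^{-(s+\frac32)}}{\sqrt{|t|}},\qquad \sup_{x\in\mathbb R^2}\Big|\int_{\mathbb R^2}e^{ix\cdot\xi}e^{i\frac t\delta g(\delta|\xi|)}\sum_{y_0\le2^k\le y_1}Q_k(\delta|\xi|)|\xi|^{s}d\xi\Big|\le C\,\frac{\delta^{-(s+\frac32)}}{\sqrt{|t|}}.$$ (3) If $|g'(y)|\ge\lambda y^{\alpha+1}$ and $|g''(y)|\ge\lambda y^{\alpha}$ for any $y\ge y_1$, with $\alpha\ne-2$, there exists $C>0$ such that for any $t\in\mathbb R\setminus\{0\}$ and any $\delta>0$, $$\sum_{2^k\ge2y_1}\sup_{x\in\mathbb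 R^2}\big|I^{\frac\alpha2-1}_{t,x,k}\big|\le C\,\frac{\delta^{-\frac{\alpha+1}2}}{\sqrt{|t|}},\qquad \sup_{x\in\mathbb R^2}\Big|\int_{\mathbb R^2}e^{ix\cdot\xi}e^{i\frac t\delta g(\delta|\xi|)}\sum_{2^k\ge2y_1}Q_k(\delta|\xi|)|\xi|^{\frac\alpha2-1}d\xi\Big|\le C\,\frac{\delta^{-\frac{\alpha+1}2}}{\sqrt{|t|}}.$$ (4) If $|g'(y)|\ge\lambda$ and $|g''(y)|\ge\lambda y^{\alpha}$ for any $y\ge y_1$, with $\alpha<-1$ and $\alpha\ne-3$, there exists $C>0$ such that for any $t\in\mathbb R\setminus\{0\}$ and any $\delta>0$, $$\sum_{2^k\ge2y_1}\sup_{x\in\mathbb R^2}\big|I^{\frac{\alpha-5}4}_{t,x,k}\big|\le C\,\frac{\delta^{-\frac{\alpha+1}4}}{\sqrt{|t|}},\qquad \sup_{x\in\mathbb R^2}\Big|\int_{\mathbb R^2}e^{ix\cdot\xi}e^{i\frac t\delta g(\delta|\xi|)}\sum_{2^k\ge2y_1}Q_k(\delta|\xi|)|\xi|^{\frac{\alpha-5}4}d\xi\Big|\le C\,\frac{\delta^{-\frac{\alpha+1}4}}{\sqrt{|t|}}.$$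
   Context: Dimension $n=2$. All sums are over $k\in\mathbb Z$ satisfying the indicated condition. $P$ is a fixed smooth even function on $\mathbb R$ supported in $[-2,-\tfrac12]\cup[\tfrac12,2]$, and for $t\in\mathbb R$, $x\in\mathbb R^2$, $s\in\mathbb R$, $k\in\mathbb Z$, $\delta>0$, $$I^{s}_{t,x,k}:=\int_{\mathbb R^2}e^{ix\cdot\xi}e^{i\frac t\delta g(\delta|\xi|)}P\big(\tfrac{\delta|\xi|}{2^k}\big)|\xi|^{s}\,d\xi.$$ Littlewood-Paley functions: $\varphi_0$ is a fixed smooth nonnegative even function supported in $[-\tfrac45,\tfrac45]$, equal to $1$ on $[-\tfrac35,\tfrac35]$ and nonincreasing on $[0,\infty)$; $Q_j(y):=\varphi_0(2^{-j-1}y)-\varphi_0(2^{-j}y)$. When an integral containing $\sum_kQ_k$ is not absolutely convergent it is understood as the sum over $k$ of the integrals with $Q_k$. Constants $C$ do not depend on $t,\delta,k,x$. *)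

theory Defs
  imports "HOL-Analysis.Analysis"
begin

definition smooth_real :: "(real \<Rightarrow> real) \<Rightarrow> bool" where
  "smooth_real f \<longleftrightarrow> (\<forall>n x. (deriv ^^ n) f differentiable at x)"

text \<open>
  Class \<open>C\<^sup>2\<close> on the half-line \<open>(0,\<infinity>)\<close>. That set is open, so \<open>deriv g\<close> and
  \<open>deriv (deriv g)\<close> at a point \<open>y > 0\<close> do not depend on the values of \<open>g\<close> outside it.
\<close>

definition C2_on_pos :: "(real \<Rightarrow> real) \<Rightarrow> bool" where
  "C2_on_pos g \<longleftrightarrow>
     g differentiable_on {0<..} \<and> deriv g differentiable_on {0<..} \<and>
     continuous_on {0<..} (deriv (deriv g))"

definition annular_cutoff :: "(real \<Rightarrow> real) \<Rightarrow> bool" where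
  "annular_cutoff P \<longleftrightarrow>
     smooth_real P \<and> (\<forall>y. P (- y) = P y) \<and>
     {y. P y \<noteq> 0} \<subseteq> {-2..-1/2} \<union> {1/2..2}"

definition LP_cutoff :: "(real \<Rightarrow> real) \<Rightarrow> bool" where
  "LP_cutoff \<phi> \<longleftrightarrow>
     smooth_real \<phi> \<and> (\<forall>y. 0 \<le> \<phi> y) \<and> (\<forall>y. \<phi> (- y) = \<phi> y) \<and>
     {y. \<phi> y \<noteq> 0} \<subseteq> {-4/5..4/5} \<and> (\<forall>y\<in>{-3/5..3/5}. \<phi> y = 1) \<and>
     antimono_on {0..} \<phi>"

definition LP_Q :: "(real \<Rightarrow> real) \<Rightarrow> int \<Rightarrow> real \<Rightarrow> real" where
  "LP_Q \<phi> j y = \<phi> (2 powi (- j - 1) * y) - \<phi> (2 powi (- j) * y)"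

text \<open>
  The integrand with a general radial frequency multiplier \<open>m(\<delta>|\<xi>|)\<close>. Every multiplier used
  below vanishes at \<open>0\<close>, so the values of \<open>g\<close> and of \<open>|\<xi>|\<^sup>s\<close> at \<open>\<xi> = 0\<close> play no role.
\<close>

definition osc_integrand ::
  "(real \<Rightarrow> real) \<Rightarrow> real \<Rightarrow> real \<Rightarrow> real \<Rightarrow> (real \<Rightarrow> real) \<Rightarrow> real^2 \<Rightarrow> real^2 \<Rightarrow> complex" where
  "osc_integrand g s t \<delta> m x \<xi> =
     exp (\<i> * of_real (x \<bullet> \<xi>)) * exp (\<i> * of_real (t / \<delta> * g (\<delta> * norm \<xi>))) *
     of_real (m (\<delta> * norm \<xi>)) * of_real (norm \<xi> powr s)"

definition osc_integral ::
  "(real \<Rightarrow> real) \<Rightarrow> real \<Rightarrow> real \<Rightarrow> real \<Rightarrow> (real \<Rightarrow> real) \<Rightarrow> real^2 \<Rightarrow> complex" where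
  "osc_integral g s t \<delta> m x = (LINT \<xi>|lborel. osc_integrand g s t \<delta> m x \<xi>)"

definition osc_I ::
  "(real \<Rightarrow> real) \<Rightarrow> (real \<Rightarrow> real) \<Rightarrow> real \<Rightarrow> real \<Rightarrow> real \<Rightarrow> real^2 \<Rightarrow> int \<Rightarrow> complex" where
  "osc_I g P s t \<delta> x k = osc_integral g s t \<delta> (\<lambda>y. P (y / 2 powi k)) x"

text \<open>
  The integral containing \<open>\<Sum>\<^sub>k Q\<^sub>k\<close>, with \<open>k\<close> ranging over \<open>K\<close>. If it is not absolutely
  convergent, it is read as the sum over \<open>k\<close> of the integrals with \<open>Q\<^sub>k\<close>. Since \<open>infsum\<close>
  returns \<open>0\<close> for a family that is not summable, \<open>LP_converges\<close> states separately that
  \<open>LP_integral\<close> is meaningful. The inner sum \<open>\<Sum>\<^sub>k Q\<^sub>k(y)\<close> has finitely many nonzero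
  terms for each \<open>y\<close>.
\<close>

definition LP_sum :: "(real \<Rightarrow> real) \<Rightarrow> int set \<Rightarrow> real \<Rightarrow> real" where
  "LP_sum \<phi> K y = (\<Sum>\<^sub>\<infinity>k\<in>K. LP_Q \<phi> k y)"

definition LP_integral ::
  "(real \<Rightarrow> real) \<Rightarrow> (real \<Rightarrow> real) \<Rightarrow> real \<Rightarrow> real \<Rightarrow> real \<Rightarrow> int set \<Rightarrow> real^2 \<Rightarrow> complex" where
  "LP_integral g \<phi> s t \<delta> K x =
     (if integrable lborel (osc_integrand g s t \<delta> (LP_sum \<phi> K) x)
      then osc_integral g s t \<delta> (LP_sum \<phi> K) x
      else (\<Sum>\<^sub>\<infinity>k\<in>K. osc_integral g s t \<delta> (LP_Q \<phi> k) x))"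

definition LP_converges ::
  "(real \<Rightarrow> real) \<Rightarrow> (real \<Rightarrow> real) \<Rightarrow> real \<Rightarrow> real \<Rightarrow> real \<Rightarrow> int set \<Rightarrow> real^2 \<Rightarrow> bool" where
  "LP_converges g \<phi> s t \<delta> K x \<longleftrightarrow>
     integrable lborel (osc_integrand g s t \<delta> (LP_sum \<phi> K) x) \<or>
     (\<lambda>k. osc_integral g s t \<delta> (LP_Q \<phi> k) x) summable_on K"

text \<open>
  Suprema over \<open>x\<close> are taken in \<open>[0,\<infinity>]\<close>, so that they are \<open>\<infinity>\<close> when unbounded; the same
  holds for sums over \<open>k\<close> of such suprema.
\<close>

definition sup_cmod :: "(real^2 \<Rightarrow> complex) \<Rightarrow> ennreal" where
  "sup_cmod F = (SUP x. ennreal (cmod (F x)))"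

end

theory Submission
  imports Defs
begin

text \<open>
  In polar coordinates each integral becomes a one-dimensional integral in \<open>r \<approx> R = 2\<^sup>k/\<delta>\<close> with
  phase \<open>(t/\<delta>) g(\<delta>r)\<close>, tested against \<open>F(r) = 2\<pi> J\<^sub>0(r|x|)\<close>. If \<open>|x|\<close> is small compared with
  the lower bound \<open>B\<close> for the derivative of the phase, van der Corput's first-derivative test at
  each fixed angle gives a gain \<open>1/B\<close>. If \<open>|x|\<close> is larger, the decay \<open>|F(r)| \<lesssim> (r|x|)\<^sup>-\<^sup>1\<^sup>/\<^sup>2\<close>
  takes over and, written as \<open>F = e\<^sup>i\<^sup>r\<^sup>|\<^sup>x\<^sup>| \<alpha> + e\<^sup>-\<^sup>i\<^sup>r\<^sup>|\<^sup>x\<^sup>| \<beta>\<close> with slowly varying amplitudes, it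
  can be combined with the second-derivative test. At high frequency this combination improves on
  each test alone, so that the dyadic bounds form a two-sided geometric series.
\<close>

section \<open>Van der Corput's lemma\<close>

text \<open>At a fixed angle the plane wave adds to the phase a term linear in r, which leaves the
  second derivative alone. So for every x the zeros of g'' are the only places where monotonicity of
  the derivative of the phase can change, and their number enters as a factor independent of t,
  \<delta>, k and x.

  Obstacle at high frequency: in (3) the second-derivative test alone bounds every piece by a
  multiple of \<delta>^(-(\<alpha>+1)/2) / sqrt |t| with no power of 2^k left, and this cannot be
  summed. Two bounds that are not of order |t|^(-1/2) replace it: one free of t, one of order 1/|t|.
  The target is their geometric mean. With \<beta> = \<alpha> + 2 in (3) and \<beta> = (\<alpha> +
  3)/2 in (4), the exponent is s = \<beta>/2 - 2 in both cases, and the excluded values of \<alpha>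
  are those with \<beta> = 0, where the ratio of the progressions would be 1.

  The amplitudes of the Bessel function need a bound for their derivative as well as for their size,
  since they are integrated by parts together with the cutoff. Both bounds are read off from the
  differential equation.\<close>

lemma norm_integral_split_finite:
  fixes f :: "real \<Rightarrow> 'a::banach"
  assumes "finite Z" "f integrable_on {a..b}" "a \<le> b"
    and "\<And>p q. \<lbrakk>a \<le> p; p \<le> q; q \<le> b; Z \<inter> {p<..<q} = {}\<rbrakk> \<Longrightarrow> norm (integral {p..q} f) \<le> M"
  shows "norm (integral {a..b} f) \<le> 2 ^ card Z * M"
  using assms
proof (induction Z arbitrary: a b rule: finite_induct)
  case empty
  then show ?case by simp
next
  case (insert z Z)
  show ?case
  proof (cases "z \<in> {a<..<b}")
    case False
    have "norm (integral {a..b} f) \<le> 2 ^ card Z * M"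
      by (rule insert.IH) (use insert.prems False in auto)
    moreover have "0 \<le> 2 ^ card Z * M"
      using calculation norm_ge_zero order_trans by blast
    ultimately show ?thesis using insert.hyps by simp
  next
    case True
    have int: "f integrable_on {a..z}" "f integrable_on {z..b}"
      using insert.prems(1) True by (auto intro: integrable_on_subinterval)
    \<comment> \<open>The bound \<open>M\<close> is assumed for all subintervals avoiding the cut
      points, so it passes to both halves, and each cut point costs at most a factor 2.\<close>
    have "norm (integral {a..z} f) \<le> 2 ^ card Z * M"
      by (rule insert.IH) (use insert.prems True int in auto)
    moreover have "norm (integral {z..b} f) \<le> 2 ^ card Z * M"
      by (rule insert.IH) (use insert.prems True int in auto)
    moreover have "integral {a..b} f = integral {a..z} f + integral {z..b} f"
      using True insert.prems by (intro Henstock_Kurzweil_Integration.integral_combine [symmetric]) auto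
    ultimately show ?thesis using insert.hyps
      by (simp add: norm_triangle_le)
  qed
qed

lemma has_vector_derivative_cis [derivative_intros]:
  assumes "(f has_real_derivative f') (at x within S)"
  shows "((\<lambda>x. cis (f x)) has_vector_derivative (\<i> * of_real f' * cis (f x))) (at x within S)"
proof -
  have "((\<lambda>x. \<i> * of_real (f x)) has_vector_derivative (\<i> * of_real f')) (at x within S)"
    by (intro has_vector_derivative_mult_right has_vector_derivative_of_real assms)
  from field_vector_diff_chain_within[OF this has_field_derivative_at_within[OF DERIV_exp]]
  show ?thesis by (simp add: cis_conv_exp o_def)
qed

text \<open>Integration by parts: cis \<psi> is the derivative of \<open>E\<close> = cis \<psi> / (i
  \<psi>') plus cis \<psi> * \<open>h\<close> / i, where \<open>h\<close> = \<psi>''/\<psi>'^2 is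
  minus the derivative of 1/\<psi>'. As \<open>h\<close> has one sign, the integral of its absolute
  value telescopes. Boundary terms and remainder contribute 2/B each, whatever the length of the
  interval.\<close>

lemma van_der_corput_first:
  fixes \<psi> \<psi>' \<psi>'' :: "real \<Rightarrow> real"
  assumes "a \<le> b" "B > 0"
    and d1: "\<And>r. r \<in> {a..b} \<Longrightarrow> (\<psi> has_real_derivative \<psi>' r) (at r)"
    and d2: "\<And>r. r \<in> {a..b} \<Longrightarrow> (\<psi>' has_real_derivative \<psi>'' r) (at r)"
    and cont: "continuous_on {a..b} \<psi>''"
    and sgn: "(\<forall>r\<in>{a..b}. \<psi>'' r \<ge> 0) \<or> (\<forall>r\<in>{a..b}. \<psi>'' r \<le> 0)"
    and B: "\<And>r. r \<in> {a..b} \<Longrightarrow> \<bar>\<psi>' r\<bar> \<ge> B"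
  shows "norm (integral {a..b} (\<lambda>r. cis (\<psi> r))) \<le> 4 / B"
proof -
  have nz: "\<psi>' r \<noteq> 0" if "r \<in> {a..b}" for r using B[OF that] \<open>B > 0\<close> by auto
  define E where "E r = cis (\<psi> r) * of_real (1 / \<psi>' r) / \<i>" for r
  define h where "h r = \<psi>'' r / (\<psi>' r)^2" for r
  have c1: "continuous_on {a..b} \<psi>" "continuous_on {a..b} \<psi>'"
    using d1 d2 by (meson DERIV_isCont continuous_at_imp_continuous_on)+
  have ch: "continuous_on {a..b} h"
    unfolding h_def by (intro continuous_intros cont c1) (use nz in auto)
  have inv: "((\<lambda>r. 1 / \<psi>' r) has_real_derivative - h r) (at r)" if "r \<in> {a..b}" for r
    using d2[OF that] nz[OF that] unfolding h_def
    by (auto intro!: derivative_eq_intros simp: power2_eq_square)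
  have dE: "(E has_vector_derivative (cis (\<psi> r) - cis (\<psi> r) * of_real (h r) / \<i>)) (at r within {a..b})"
    if r: "r \<in> {a..b}" for r
  proof -
    have "((\<lambda>r. cis (\<psi> r) * of_real (1 / \<psi>' r) / \<i>) has_vector_derivative
        (cis (\<psi> r) * of_real (- h r) + \<i> * of_real (\<psi>' r) * cis (\<psi> r) * of_real (1 / \<psi>' r)) / \<i>) (at r within {a..b})"
      using inv[OF r] d1[OF r]
      by (intro has_vector_derivative_divide has_vector_derivative_mult has_vector_derivative_of_real
            has_vector_derivative_cis)
         (auto simp: has_real_derivative_iff_has_vector_derivative intro: has_vector_derivative_at_within)
    moreover have "(cis (\<psi> r) * of_real (- h r) + \<i> * of_real (\<psi>' r) * cis (\<psi> r) * of_real (1 / \<psi>' r)) / \<i>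
       = cis (\<psi> r) - cis (\<psi> r) * of_real (h r) / \<i>"
      using nz[OF r] by (simp add: field_simps)
    ultimately show ?thesis unfolding E_def by simp
  qed
  have "((\<lambda>r. cis (\<psi> r) - cis (\<psi> r) * of_real (h r) / \<i>) has_integral (E b - E a)) {a..b}"
    by (rule fundamental_theorem_of_calculus[OF \<open>a \<le> b\<close> dE])
  moreover have int2: "(\<lambda>r. cis (\<psi> r) * of_real (h r) / \<i>) integrable_on {a..b}"
    by (intro integrable_continuous_interval continuous_intros c1 ch) auto
  ultimately have "((\<lambda>r. cis (\<psi> r)) has_integral (E b - E a + integral {a..b} (\<lambda>r. cis (\<psi> r) * of_real (h r) / \<i>))) {a..b}"
    using has_integral_add[OF _ integrable_integral[OF int2]] by fastforce
  then have eq: "integral {a..b} (\<lambda>r. cis (\<psi> r)) = E b - E a + integral {a..b} (\<lambda>r. cis (\<psi> r) * of_real (h r) / \<i>)"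
    by (rule integral_unique)
  have inth: "(h has_integral (1 / \<psi>' a - 1 / \<psi>' b)) {a..b}"
  proof -
    have "((\<lambda>r. - h r) has_integral (1 / \<psi>' b - 1 / \<psi>' a)) {a..b}"
      using inv by (intro fundamental_theorem_of_calculus[OF \<open>a \<le> b\<close>])
        (auto simp: has_real_derivative_iff_has_vector_derivative intro: has_vector_derivative_at_within)
    from has_integral_neg[OF this] show ?thesis by simp
  qed
  have eb: "\<bar>1 / \<psi>' r\<bar> \<le> 1 / B" if "r \<in> {a..b}" for r
    using B[OF that] \<open>B > 0\<close> by (simp add: frac_le)
  have En: "norm (E r) \<le> 1 / B" if "r \<in> {a..b}" for r
    using eb[OF that] unfolding E_def by (simp add: norm_mult norm_divide)
  \<comment> \<open>\<open>\<sigma>\<close> is the constant sign of \<psi>''; it replaces the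
    absolute value of \<open>h\<close> by a multiple of \<open>h\<close>, which has an explicit
    primitive.\<close>
  obtain \<sigma> :: real where s: "\<bar>\<sigma>\<bar> = 1" "\<forall>r\<in>{a..b}. \<bar>h r\<bar> \<le> \<sigma> * h r"
  proof (cases "\<forall>r\<in>{a..b}. \<psi>'' r \<ge> 0")
    case True then show ?thesis by (intro that[of 1]) (auto simp: h_def)
  next
    case False then show ?thesis using sgn by (intro that[of "-1"]) (auto simp: h_def divide_le_0_iff)
  qed
  have "norm (integral {a..b} (\<lambda>r. cis (\<psi> r) * of_real (h r) / \<i>)) \<le> integral {a..b} (\<lambda>r. \<sigma> * h r)"
    using s(2) by (intro integral_norm_bound_integral int2)
      (auto simp: norm_mult norm_divide intro!: integrable_continuous_interval continuous_intros ch)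
  also have "\<dots> = \<sigma> * (1 / \<psi>' a - 1 / \<psi>' b)"
    using inth by (simp add: integral_unique)
  also have "\<dots> \<le> \<bar>\<sigma>\<bar> * \<bar>1 / \<psi>' a - 1 / \<psi>' b\<bar>"
    by (metis abs_ge_self abs_mult)
  also have "\<dots> \<le> 2 / B"
    using eb[of a] eb[of b] \<open>a \<le> b\<close> abs_triangle_ineq4[of "1 / \<psi>' a" "1 / \<psi>' b"]
    unfolding s(1) by simp
  finally have "norm (integral {a..b} (\<lambda>r. cis (\<psi> r) * of_real (h r) / \<i>)) \<le> 2 / B" .
  moreover have "norm (E b - E a) \<le> 2 / B"
    using norm_triangle_ineq4[of "E b" "E a"] En[of a] En[of b] \<open>a \<le> b\<close> by simp
  ultimately show ?thesis unfolding eq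
    using norm_triangle_ineq[of "E b - E a" "integral {a..b} (\<lambda>r. cis (\<psi> r) * of_real (h r) / \<i>)"] by simp
qed

text \<open>Slope at least \<open>A\<close> forces growth away from a zero of \<open>f\<close>. If
  \<open>f\<close> has no zero, \<open>c\<close> is the endpoint at which |f| is smallest.\<close>

lemma expanding_lower_bound:
  fixes f f' :: "real \<Rightarrow> real"
  assumes "a \<le> b"
    and d: "\<And>r. r \<in> {a..b} \<Longrightarrow> (f has_real_derivative f' r) (at r)"
    and A: "\<And>r. r \<in> {a..b} \<Longrightarrow> f' r \<ge> A" and "A > 0"
  obtains c where "c \<in> {a..b}" "\<And>r. r \<in> {a..b} \<Longrightarrow> \<bar>f r\<bar> \<ge> A * \<bar>r - c\<bar>"
proof -
  have inc: "f v - f u \<ge> A * (v - u)" if uv: "a \<le> u" "u \<le> v" "v \<le> b" for u v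
  proof -
    have "(\<lambda>r. f r - A * r) u \<le> (\<lambda>r. f r - A * r) v"
    proof (rule DERIV_nonneg_imp_nondecreasing[OF \<open>u \<le> v\<close>])
      fix r assume r: "u \<le> r" "r \<le> v"
      then have r': "r \<in> {a..b}" using uv by auto
      show "\<exists>y. ((\<lambda>r. f r - A * r) has_real_derivative y) (at r) \<and> 0 \<le> y"
        using d[OF r'] A[OF r'] by (intro exI[of _ "f' r - A"]) (auto intro!: derivative_eq_intros)
    qed
    then show ?thesis by (simp add: algebra_simps)
  qed
  consider "f a \<ge> 0" | "f b \<le> 0" | "f a \<le> 0" "f b \<ge> 0" by linarith
  then show ?thesis
  proof cases
    case 1
    show ?thesis
    proof (rule that[of a])
      fix r assume "r \<in> {a..b}" then show "\<bar>f r\<bar> \<ge> A * \<bar>r - a\<bar>" using inc[of a r] 1 by auto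
    qed (use \<open>a \<le> b\<close> in auto)
  next
    case 2
    show ?thesis
    proof (rule that[of b])
      fix r assume "r \<in> {a..b}" then show "\<bar>f r\<bar> \<ge> A * \<bar>r - b\<bar>" using inc[of r b] 2
        by (auto simp: abs_minus_commute)
    qed (use \<open>a \<le> b\<close> in auto)
  next
    case 3
    obtain c where c: "a \<le> c" "c \<le> b" "f c = 0"
      using IVT[of f a 0 b] 3 \<open>a \<le> b\<close> d DERIV_isCont by (metis atLeastAtMost_iff)
    show ?thesis
    proof (rule that[of c])
      fix r assume "r \<in> {a..b}" then show "\<bar>f r\<bar> \<ge> A * \<bar>r - c\<bar>"
        using inc[of c r] inc[of r c] c by (cases "r \<le> c") auto
    qed (use c in auto)
  qed
qed

text \<open>Zeros are excluded only in the open interval because the intervals of the proof are cut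
  at the zeros of the second derivative, which then become endpoints. Every value is compared with
  the one at the midpoint \<open>m\<close>: opposite signs would give a zero strictly
  inside.\<close>

lemma continuous_constant_sign:
  fixes f :: "real \<Rightarrow> real"
  assumes "continuous_on {a..b} f" "\<And>r. r \<in> {a<..<b} \<Longrightarrow> f r \<noteq> 0"
  shows "(\<forall>r\<in>{a..b}. f r \<ge> 0) \<or> (\<forall>r\<in>{a..b}. f r \<le> 0)"
proof (rule ccontr)
  assume "\<not> ?thesis"
  then obtain u v where uv: "u \<in> {a..b}" "v \<in> {a..b}" "f u < 0" "f v > 0" by force
  define m where "m = (a + b) / 2"
  have ab: "a < b" using uv by (cases "a = b") auto
  have mm: "m \<in> {a<..<b}" using ab by (auto simp: m_def)
  have key: False if w: "w \<in> {a..b}" and h: "f w * f m < 0" for w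
  proof -
    have "connected (f ` {min w m..max w m})"
      using w mm by (intro connected_continuous_image continuous_on_subset[OF assms(1)]) auto
    moreover have "f w \<in> f ` {min w m..max w m}" "f m \<in> f ` {min w m..max w m}" by auto
    moreover have "(f w \<le> 0 \<and> 0 \<le> f m) \<or> (f m \<le> 0 \<and> 0 \<le> f w)"
      using h by (auto simp: mult_less_0_iff)
    ultimately have "0 \<in> f ` {min w m..max w m}"
      unfolding connected_iff_interval by blast
    then obtain c where c: "c \<in> {min w m..max w m}" "f c = 0" by auto
    then have "c \<noteq> w" "c \<noteq> m" using h by auto
    then have "c \<in> {a<..<b}" using c w mm by (auto simp: min_def max_def split: if_splits)
    then show False using assms(2) c by auto
  qed
  have "f m \<noteq> 0" using assms(2) mm by auto
  then show False using key[of u] key[of v] uv by (cases "f m > 0") (auto simp: mult_less_0_iff)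
qed

text \<open>The derivative \<psi>' grows at rate at least \<open>A\<close> away from some point c.
  Within distance \<sigma> = 1/sqrt A of c the trivial bound is 2 \<sigma>; farther out |\<psi>'| is
  at least A \<sigma> = sqrt A and the first-derivative test gives 4/sqrt A. This \<sigma> balances
  the two, and the two cut points c - \<sigma>, c + \<sigma> cost the factor 2^2.\<close>

lemma van_der_corput_second:
  fixes \<psi> \<psi>' \<psi>'' :: "real \<Rightarrow> real"
  assumes "a \<le> b" "A > 0"
    and d1: "\<And>r. r \<in> {a..b} \<Longrightarrow> (\<psi> has_real_derivative \<psi>' r) (at r)"
    and d2: "\<And>r. r \<in> {a..b} \<Longrightarrow> (\<psi>' has_real_derivative \<psi>'' r) (at r)"
    and cont: "continuous_on {a..b} \<psi>''"
    and A: "\<And>r. r \<in> {a..b} \<Longrightarrow> \<bar>\<psi>'' r\<bar> \<ge> A"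
  shows "norm (integral {a..b} (\<lambda>r. cis (\<psi> r))) \<le> 16 / sqrt A"
proof -
  have "\<psi>'' r \<noteq> 0" if "r \<in> {a..b}" for r using A[OF that] \<open>A > 0\<close> by auto
  then have sgn: "(\<forall>r\<in>{a..b}. \<psi>'' r \<ge> 0) \<or> (\<forall>r\<in>{a..b}. \<psi>'' r \<le> 0)"
    using continuous_constant_sign[OF cont] by auto
  obtain c where c: "c \<in> {a..b}" "\<And>r. r \<in> {a..b} \<Longrightarrow> \<bar>\<psi>' r\<bar> \<ge> A * \<bar>r - c\<bar>"
  proof (cases "\<forall>r\<in>{a..b}. \<psi>'' r \<ge> 0")
    case True
    then have "\<psi>'' r \<ge> A" if "r \<in> {a..b}" for r using A[OF that] that by force
    from expanding_lower_bound[OF \<open>a \<le> b\<close> d2 this \<open>A > 0\<close>] show ?thesis using that by metis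
  next
    case False
    then have "- \<psi>'' r \<ge> A" if "r \<in> {a..b}" for r using A[OF that] that sgn by force
    from expanding_lower_bound[OF \<open>a \<le> b\<close> DERIV_minus[OF d2] this \<open>A > 0\<close>]
    show ?thesis using that by (metis abs_minus_cancel)
  qed
  define \<sigma> where "\<sigma> = 1 / sqrt A"
  have s: "\<sigma> > 0" "A * \<sigma> = sqrt A"
    using \<open>A > 0\<close> by (auto simp: \<sigma>_def real_div_sqrt)
  have c1: "continuous_on {a..b} \<psi>" "continuous_on {a..b} \<psi>'"
    using d1 d2 by (meson DERIV_isCont continuous_at_imp_continuous_on)+
  have "norm (integral {a..b} (\<lambda>r. cis (\<psi> r))) \<le> 2 ^ card {c - \<sigma>, c + \<sigma>} * (4 / sqrt A)"
  proof (rule norm_integral_split_finite)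
    show "(\<lambda>r. cis (\<psi> r)) integrable_on {a..b}"
      by (intro integrable_continuous_interval continuous_intros c1)
    fix p q assume pq: "a \<le> p" "p \<le> q" "q \<le> b" "{c - \<sigma>, c + \<sigma>} \<inter> {p<..<q} = {}"
    show "norm (integral {p..q} (\<lambda>r. cis (\<psi> r))) \<le> 4 / sqrt A"
    proof (cases "p \<ge> c - \<sigma> \<and> q \<le> c + \<sigma>")
      case True
      have "norm (integral {p..q} (\<lambda>r. cis (\<psi> r))) \<le> 1 * (q - p)"
        using pq by (intro integral_bound continuous_intros continuous_on_subset[OF c1(1)]) auto
      also have "\<dots> \<le> 2 * \<sigma>" using True by simp
      finally show ?thesis using s by (simp add: \<sigma>_def field_simps)
    next
      case False
      then have far: "\<bar>r - c\<bar> \<ge> \<sigma>" if "r \<in> {p..q}" for r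
        using pq that s by (auto simp: abs_if split: if_splits)
      show ?thesis
      proof (cases "p = q")
        case False
      show ?thesis
      proof (rule van_der_corput_first[where \<psi>' = \<psi>' and \<psi>'' = \<psi>''])
        fix r assume r: "r \<in> {p..q}"
        then have r': "r \<in> {a..b}" using pq by auto
        have "sqrt A \<le> A * \<bar>r - c\<bar>"
          using mult_left_mono[OF far[OF r], of A] \<open>A > 0\<close> s by simp
        then show "sqrt A \<le> \<bar>\<psi>' r\<bar>" using c(2)[OF r'] by linarith
      qed (use pq \<open>A > 0\<close> d1 d2 sgn in \<open>auto intro: continuous_on_subset[OF cont]\<close>)
      qed (use \<open>A > 0\<close> in simp)
    qed
  qed (use \<open>a \<le> b\<close> in auto)
  also have "card {c - \<sigma>, c + \<sigma>} = 2" using s by auto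
  finally show ?thesis by simp
qed

text \<open>Integration by parts against the primitive \<open>\<Phi>\<close> of \<open>f\<close>,
  which is why all partial integrals have to be bounded. The van der Corput bounds do not see the
  length of the interval, so they provide one \<open>M\<close> for all of them.\<close>

lemma norm_integral_amplitude_le:
  fixes f h h' :: "real \<Rightarrow> complex"
  assumes "a \<le> b" and f: "continuous_on {a..b} f"
    and dh: "\<And>r. r \<in> {a..b} \<Longrightarrow> (h has_vector_derivative h' r) (at r within {a..b})"
    and ch: "continuous_on {a..b} h'"
    and H: "\<And>r. r \<in> {a..b} \<Longrightarrow> norm (h r) \<le> H"
    and H': "\<And>r. r \<in> {a..b} \<Longrightarrow> norm (h' r) \<le> H'"
    and M: "\<And>r. r \<in> {a..b} \<Longrightarrow> norm (integral {a..r} f) \<le> M"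
  shows "norm (integral {a..b} (\<lambda>r. h r * f r)) \<le> M * (H + H' * (b - a))"
proof -
  define \<Phi> where "\<Phi> r = integral {a..r} f" for r
  have d\<Phi>: "(\<Phi> has_vector_derivative f r) (at r within {a..b})" if "r \<in> {a..b}" for r
    unfolding \<Phi>_def by (rule integral_has_vector_derivative[OF f that])
  have c\<Phi>: "continuous_on {a..b} \<Phi>" "continuous_on {a..b} h"
    using d\<Phi> dh by (meson continuous_on_eq_continuous_within has_vector_derivative_continuous)+
  have "((\<lambda>r. h r * f r) has_integral (h b * \<Phi> b - h a * \<Phi> a - integral {a..b} (\<lambda>r. h' r * \<Phi> r))) {a..b}"
  proof -
    have "((\<lambda>r. h r * f r + h' r * \<Phi> r) has_integral (h b * \<Phi> b - h a * \<Phi> a)) {a..b}"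
      by (intro fundamental_theorem_of_calculus[OF \<open>a \<le> b\<close>] has_vector_derivative_mult dh d\<Phi>)
    moreover have "(\<lambda>r. h' r * \<Phi> r) integrable_on {a..b}"
      by (intro integrable_continuous_interval continuous_intros ch c\<Phi>)
    ultimately show ?thesis
      using has_integral_diff[of "\<lambda>r. h r * f r + h' r * \<Phi> r" _ _ "\<lambda>r. h' r * \<Phi> r"]
      by (fastforce dest: integrable_integral)
  qed
  moreover have "\<Phi> a = 0" by (simp add: \<Phi>_def)
  ultimately have eq: "integral {a..b} (\<lambda>r. h r * f r) = h b * \<Phi> b - integral {a..b} (\<lambda>r. h' r * \<Phi> r)"
    by (simp add: integral_unique)
  have M0: "M \<ge> 0" using M[of a] \<open>a \<le> b\<close> by simp
  have H0: "H' \<ge> 0"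
    using H'[of a] norm_ge_zero[of "h' a"] \<open>a \<le> b\<close> by (meson atLeastAtMost_iff order_refl order_trans)
  have "norm (integral {a..b} (\<lambda>r. h' r * \<Phi> r)) \<le> (H' * M) * (b - a)"
    using M H' M0 H0 by (intro integral_bound \<open>a \<le> b\<close> continuous_intros ch c\<Phi>)
      (auto simp: norm_mult \<Phi>_def intro!: mult_mono)
  moreover have "norm (h b * \<Phi> b) \<le> H * M"
    using mult_mono[OF H[of b] M[of b]] order_trans[OF norm_ge_zero H[of b]] \<open>a \<le> b\<close>
    by (simp add: norm_mult \<Phi>_def)
  ultimately show ?thesis unfolding eq
    using norm_triangle_ineq4[of "h b * \<Phi> b" "integral {a..b} (\<lambda>r. h' r * \<Phi> r)"] by (simp add: algebra_simps)
qed

section \<open>The Bessel function of order zero\<close>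

text \<open>The inner product of x with the unit vector at angle \<theta>, that is, the r-derivative
  of the phase of the plane wave along this ray.\<close>

definition circle_freq :: "real^2 \<Rightarrow> real \<Rightarrow> real" where
  "circle_freq x \<theta> = x $ 1 * cos \<theta> + x $ 2 * sin \<theta>"

text \<open>The zeroth moment is \<open>2\<pi> J\<^sub>0(r|x|)\<close>.\<close>

definition circle_moment :: "real^2 \<Rightarrow> nat \<Rightarrow> real \<Rightarrow> complex" where
  "circle_moment x n r =
     integral {0..2*pi} (\<lambda>\<theta>. (\<i> * of_real (circle_freq x \<theta>)) ^ n * cis (r * circle_freq x \<theta>))"

lemma norm_vec2: "norm x ^ 2 = (x $ 1)^2 + (x $ 2)^2" for x :: "real^2"
  by (simp add: norm_vec_def L2_set_def sum_2)

lemma continuous_on_circle_freq [continuous_intros]: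
  fixes f :: "'a::t2_space \<Rightarrow> real"
  shows "continuous_on S f \<Longrightarrow> continuous_on S (\<lambda>s. circle_freq x (f s))"
  unfolding circle_freq_def by (intro continuous_intros continuous_on_cos continuous_on_sin)

text \<open>The second square is that of the \<theta>-derivative of \<open>circle_freq\<close>. In
  this form the identity trades |x|^2 for the two squares that occur in Bessel's equation.\<close>

lemma circle_freq_Pythagoras:
  "circle_freq x \<theta> ^ 2 + (x $ 2 * cos \<theta> - x $ 1 * sin \<theta>) ^ 2 = norm x ^ 2"
proof -
  have "circle_freq x \<theta> ^ 2 + (x $ 2 * cos \<theta> - x $ 1 * sin \<theta>) ^ 2
     = ((x $ 1)^2 + (x $ 2)^2) * ((sin \<theta>)^2 + (cos \<theta>)^2)"
    unfolding circle_freq_def by algebra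
  then show ?thesis by (simp add: norm_vec2)
qed

lemma abs_circle_freq_le: "\<bar>circle_freq x \<theta>\<bar> \<le> norm x"
proof -
  have "circle_freq x \<theta> ^ 2 \<le> norm x ^ 2"
    unfolding circle_freq_Pythagoras[symmetric, of x \<theta>] by simp
  then show ?thesis using abs_le_square_iff[of "circle_freq x \<theta>" "norm x"] by simp
qed

text \<open>Differentiation under the integral brings down one more factor i *
  \<open>circle_freq\<close>, so the index n counts r-derivatives of the zeroth moment.\<close>

lemma circle_moment_derivative:
  "(circle_moment x n has_vector_derivative circle_moment x (Suc n) r) (at r)"
proof -
  have "((\<lambda>r. integral (cbox 0 (2*pi)) (\<lambda>\<theta>. (\<i> * of_real (circle_freq x \<theta>)) ^ n * cis (r * circle_freq x \<theta>)))
      has_vector_derivative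
     integral (cbox 0 (2*pi)) (\<lambda>\<theta>. (\<i> * of_real (circle_freq x \<theta>)) ^ Suc n * cis (r * circle_freq x \<theta>)))
      (at r within UNIV)"
  proof (rule leibniz_rule_vector_derivative)
    show "((\<lambda>r. (\<i> * of_real (circle_freq x \<theta>)) ^ n * cis (r * circle_freq x \<theta>)) has_vector_derivative
        (\<i> * of_real (circle_freq x \<theta>)) ^ Suc n * cis (r * circle_freq x \<theta>)) (at r within UNIV)" for r \<theta>
    proof -
      have "((\<lambda>r. cis (r * circle_freq x \<theta>)) has_vector_derivative
         \<i> * of_real (circle_freq x \<theta>) * cis (r * circle_freq x \<theta>)) (at r)"
        by (rule has_vector_derivative_cis) (auto intro!: derivative_eq_intros)
      from has_vector_derivative_mult_right[OF this, of "(\<i> * of_real (circle_freq x \<theta>)) ^ n"]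
      show ?thesis by (simp add: mult_ac)
    qed
    show "(\<lambda>\<theta>. (\<i> * of_real (circle_freq x \<theta>)) ^ n * cis (r * circle_freq x \<theta>)) integrable_on cbox 0 (2*pi)" for r
      by (intro integrable_continuous continuous_intros)
    show "continuous_on (UNIV \<times> cbox 0 (2*pi))
      (\<lambda>(r, \<theta>). (\<i> * of_real (circle_freq x \<theta>)) ^ Suc n * cis (r * circle_freq x \<theta>))"
      unfolding split_beta by (intro continuous_intros)
  qed auto
  then show ?thesis unfolding circle_moment_def by simp
qed

lemma norm_circle_moment_le: "norm (circle_moment x n r) \<le> 2 * pi * norm x ^ n"
proof -
  have "norm (circle_moment x n r) \<le> norm x ^ n * (2 * pi - 0)"
    unfolding circle_moment_def
    by (rule integral_bound)
      (auto intro!: continuous_intros power_mono simp: norm_mult norm_power abs_circle_freq_le)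
  then show ?thesis by (simp add: mult_ac)
qed

text \<open>Bessel's equation r F'' + F' + r |x|^2 F = 0 for the zeroth moment. Under the integral
  sign the left-hand side is -i times the \<theta>-derivative of c' e^(i r c), with c =
  \<open>circle_freq x\<close>; this function is 2 pi-periodic, so the integral over a period
  vanishes.\<close>

lemma circle_moment_Bessel:
  "of_real r * circle_moment x 2 r + circle_moment x 1 r + of_real (r * norm x ^ 2) * circle_moment x 0 r = 0"
proof -
  define c where "c = circle_freq x"
  define c' where "c' \<theta> = x $ 2 * cos \<theta> - x $ 1 * sin \<theta>" for \<theta>
  have cc: "continuous_on S c" "continuous_on S c'" for S
    unfolding c_def c'_def by (intro continuous_intros continuous_on_cos continuous_on_sin)+
  have dc: "(c has_real_derivative c' \<theta>) (at \<theta> within S)" for \<theta> S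
    unfolding c_def c'_def circle_freq_def by (auto intro!: derivative_eq_intros)
  have dc': "(c' has_real_derivative - c \<theta>) (at \<theta> within S)" for \<theta> S
    unfolding c_def c'_def circle_freq_def by (auto intro!: derivative_eq_intros)
  define e where "e \<theta> = cis (r * c \<theta>)" for \<theta>
  have ce: "continuous_on S e" for S unfolding e_def by (intro continuous_intros cc)
  have "((\<lambda>\<theta>. of_real (c' \<theta>) * e \<theta>) has_vector_derivative
        of_real (c' \<theta>) * (\<i> * of_real (r * c' \<theta>) * e \<theta>) + of_real (- c \<theta>) * e \<theta>) (at \<theta> within {0..2*pi})" for \<theta>
    unfolding e_def
    by (intro has_vector_derivative_mult has_vector_derivative_of_real dc' has_vector_derivative_cis DERIV_cmult dc)
  then have "((\<lambda>\<theta>. of_real (c' \<theta>) * (\<i> * of_real (r * c' \<theta>) * e \<theta>) + of_real (- c \<theta>) * e \<theta>) has_integral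
      (of_real (c' (2*pi)) * e (2*pi) - of_real (c' 0) * e 0)) {0..2*pi}"
    by (intro fundamental_theorem_of_calculus) auto
  moreover have "of_real (c' (2*pi)) * e (2*pi) - of_real (c' 0) * e 0 = 0"
    by (simp add: e_def c'_def c_def circle_freq_def)
  ultimately have I0: "((\<lambda>\<theta>. of_real (c' \<theta>) * (\<i> * of_real (r * c' \<theta>) * e \<theta>) + of_real (- c \<theta>) * e \<theta>) has_integral 0) {0..2*pi}"
    by simp
  have "((\<lambda>\<theta>. of_real r * ((\<i> * of_real (c \<theta>))^2 * e \<theta>) + ((\<i> * of_real (c \<theta>))^1 * e \<theta>) +
      of_real (r * norm x ^ 2) * ((\<i> * of_real (c \<theta>))^0 * e \<theta>)) has_integral
     (of_real r * circle_moment x 2 r + circle_moment x 1 r + of_real (r * norm x ^ 2) * circle_moment x 0 r)) {0..2*pi}"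
    unfolding circle_moment_def c_def[symmetric] e_def[symmetric]
    by (intro has_integral_add has_integral_mult_right integrable_integral integrable_continuous_interval
        continuous_intros cc ce)
  moreover have "of_real r * ((\<i> * of_real (c \<theta>))^2 * e \<theta>) + ((\<i> * of_real (c \<theta>))^1 * e \<theta>) +
      of_real (r * norm x ^ 2) * ((\<i> * of_real (c \<theta>))^0 * e \<theta>)
     = (- \<i>) * (of_real (c' \<theta>) * (\<i> * of_real (r * c' \<theta>) * e \<theta>) + of_real (- c \<theta>) * e \<theta>)" for \<theta>
  proof -
    have "norm x ^ 2 = c \<theta> ^ 2 + c' \<theta> ^ 2"
      unfolding c_def c'_def by (rule circle_freq_Pythagoras[symmetric])
    then have nx: "of_real (r * norm x ^ 2) = complex_of_real r * (of_real (c \<theta>) ^ 2 + of_real (c' \<theta>) ^ 2)"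
      by (simp only: of_real_mult of_real_add of_real_power)
    show ?thesis
      unfolding nx unfolding of_real_mult of_real_minus using i_squared by algebra
  qed
  ultimately have "((\<lambda>\<theta>. (- \<i>) * (of_real (c' \<theta>) * (\<i> * of_real (r * c' \<theta>) * e \<theta>) + of_real (- c \<theta>) * e \<theta>)) has_integral
     (of_real r * circle_moment x 2 r + circle_moment x 1 r + of_real (r * norm x ^ 2) * circle_moment x 0 r)) {0..2*pi}"
    by (simp only:)
  from has_integral_unique[OF this has_integral_mult_right[OF I0]] show ?thesis by simp
qed

text \<open>
  With \<open>u(r) = \<surd>r F(r)\<close> Bessel's equation becomes \<open>u'' = -(N\<^sup>2 + 1/(4r\<^sup>2)) u\<close>, whose energy
  \<open>|u'|\<^sup>2 + (N\<^sup>2 + 1/(4r\<^sup>2)) |u|\<^sup>2\<close> is nonincreasing, and variation of constants against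
  \<open>e\<^sup>i\<^sup>N\<^sup>r\<close>, \<open>e\<^sup>-\<^sup>i\<^sup>N\<^sup>r\<close> gives slowly varying amplitudes.
\<close>

lemma Bessel_amplitudes:
  fixes F F1 F2 :: "real \<Rightarrow> complex"
  assumes "N > 0" "K \<ge> 0"
    and dF: "\<And>r. (F has_vector_derivative F1 r) (at r)"
    and dF1: "\<And>r. (F1 has_vector_derivative F2 r) (at r)"
    and ode: "\<And>r. of_real r * F2 r + F1 r + of_real (r * N^2) * F r = 0"
    and bF: "\<And>r. norm (F r) \<le> K" and bF1: "\<And>r. norm (F1 r) \<le> K * N"
  obtains \<alpha> \<alpha>' \<beta> \<beta>' :: "real \<Rightarrow> complex"
  where "\<And>r. r \<ge> 1 / N \<Longrightarrow> F r = cis (N * r) * \<alpha> r + cis (- N * r) * \<beta> r"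
    and "\<And>r. r \<ge> 1 / N \<Longrightarrow> (\<alpha> has_vector_derivative \<alpha>' r) (at r)"
    and "\<And>r. r \<ge> 1 / N \<Longrightarrow> (\<beta> has_vector_derivative \<beta>' r) (at r)"
    and "continuous_on {1/N..} \<alpha>'" and "continuous_on {1/N..} \<beta>'"
    and "\<And>r. r \<ge> 1 / N \<Longrightarrow> norm (\<alpha> r) \<le> 2 * K / sqrt (N * r)"
    and "\<And>r. r \<ge> 1 / N \<Longrightarrow> norm (\<beta> r) \<le> 2 * K / sqrt (N * r)"
    and "\<And>r. r \<ge> 1 / N \<Longrightarrow> norm (\<alpha>' r) \<le> 2 * K / (r * sqrt (N * r))"
    and "\<And>r. r \<ge> 1 / N \<Longrightarrow> norm (\<beta>' r) \<le> 2 * K / (r * sqrt (N * r))"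
proof -
  define u where "u r = of_real (sqrt r) * F r" for r
  define v where "v r = of_real (1 / (2 * sqrt r)) * F r + of_real (sqrt r) * F1 r" for r
  define w where "w r = N^2 + 1 / (4 * r^2)" for r :: real
  have du: "(u has_vector_derivative v r) (at r)" if "r > 0" for r
  proof -
    have "((\<lambda>r. of_real (sqrt r) * F r) has_vector_derivative
       (of_real (sqrt r) * F1 r + of_real (1 / (2 * sqrt r)) * F r)) (at r)"
      using that by (intro has_vector_derivative_mult has_vector_derivative_of_real dF)
        (auto intro!: derivative_eq_intros simp: field_simps)
    then show ?thesis by (simp add: u_def[abs_def] v_def add.commute)
  qed
  have dv: "(v has_vector_derivative - of_real (w r) * u r) (at r)" if "r > 0" for r
  proof -
    have sq: "sqrt r * sqrt r = r" using that by simp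
    have "((\<lambda>r. of_real (1 / (2 * sqrt r)) * F r + of_real (sqrt r) * F1 r) has_vector_derivative
       ((of_real (1 / (2 * sqrt r)) * F1 r + of_real (- 1 / (4 * r * sqrt r)) * F r) +
        (of_real (sqrt r) * F2 r + of_real (1 / (2 * sqrt r)) * F1 r))) (at r)"
      using that by (intro has_vector_derivative_add has_vector_derivative_mult has_vector_derivative_of_real dF dF1)
        (auto intro!: derivative_eq_intros simp: field_simps)
    moreover have "(of_real (1 / (2 * sqrt r)) * F1 r + of_real (- 1 / (4 * r * sqrt r)) * F r) +
        (of_real (sqrt r) * F2 r + of_real (1 / (2 * sqrt r)) * F1 r) = - of_real (w r) * u r"
    proof -
      define q where "q = complex_of_real (sqrt r)"
      have q: "q \<noteq> 0" "of_real r = q * q" using that sq unfolding q_def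
        by (auto simp flip: of_real_mult)
      have o: "q * q * F2 r + F1 r + q * q * (of_real N)^2 * F r = 0"
        using ode[of r] by (simp add: q(2) mult_ac)
      have "F1 r = - (q * q * F2 r) - q * q * (of_real N)^2 * F r"
        using o by (simp add: algebra_simps eq_neg_iff_add_eq_0)
      then show ?thesis using q(1)
        unfolding u_def w_def
        by (simp add: q_def[symmetric] q(2)) (simp add: field_simps power2_eq_square)
    qed
    ultimately show ?thesis by (simp add: v_def[abs_def])
  qed
  define E where "E r = v r \<bullet> v r + w r * (u r \<bullet> u r)" for r
  \<comment> \<open>Since u' = v and v' = -w u, the cross terms 2 w (u . v) cancel. Only the
    derivative of \<open>w\<close> survives, and it is negative.\<close>
  have dE: "(E has_real_derivative - (1 / (2 * r^3)) * (u r \<bullet> u r)) (at r)" if "r > 0" for r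
  proof -
    have dw: "(w has_real_derivative - (1 / (2 * r^3))) (at r)"
      unfolding w_def[abs_def] using that
      by (auto intro!: derivative_eq_intros simp: field_simps power2_eq_square power3_eq_cube)
    have "((\<lambda>r. v r \<bullet> v r) has_real_derivative (v r \<bullet> (- of_real (w r) * u r) + (- of_real (w r) * u r) \<bullet> v r)) (at r)"
      unfolding has_real_derivative_iff_has_vector_derivative
      by (rule bounded_bilinear.has_vector_derivative[OF bounded_bilinear_inner dv dv]) (rule that)+
    moreover have "((\<lambda>r. u r \<bullet> u r) has_real_derivative (u r \<bullet> v r + v r \<bullet> u r)) (at r)"
      unfolding has_real_derivative_iff_has_vector_derivative
      by (rule bounded_bilinear.has_vector_derivative[OF bounded_bilinear_inner du du]) (rule that)+
    ultimately have "(E has_real_derivative ((v r \<bullet> (- of_real (w r) * u r) + (- of_real (w r) * u r) \<bullet> v r)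
       + (- (1 / (2 * r^3)) * (u r \<bullet> u r) + (u r \<bullet> v r + v r \<bullet> u r) * w r))) (at r)"
      unfolding E_def[abs_def] by (intro DERIV_add DERIV_mult dw)
    moreover have "(- of_real (w r) * u r) = (- w r) *\<^sub>R u r" by (simp add: scaleR_conv_of_real)
    ultimately show ?thesis by (simp add: inner_commute algebra_simps)
  qed
  have sN: "sqrt N > 0" "sqrt N * sqrt N = N" using \<open>N > 0\<close> by auto
  \<comment> \<open>The parts from \<open>v\<close> and \<open>u\<close> are 9/4 and 5/4 times K^2
    N. Their sum 7/2 is rounded up to 4, whose root is the 2 in the bounds for \<open>u\<close> and
    \<open>v\<close>.\<close>
  have E1: "E (1/N) \<le> 4 * K^2 * N"
  proof -
    have s1: "sqrt (1/N) = 1 / sqrt N" by (simp add: real_sqrt_divide)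
    have "norm (v (1/N)) \<le> sqrt N / 2 * K + (1 / sqrt N) * (K * N)"
      unfolding v_def s1 using sN bF bF1
      by (intro order_trans[OF norm_triangle_ineq] add_mono)
        (auto simp: norm_mult norm_divide intro!: mult_mono divide_right_mono)
    also have "\<dots> = 3/2 * K * sqrt N"
    proof -
      have "(1 / sqrt N) * (K * N) = K * (N / sqrt N)" by simp
      also have "N / sqrt N = sqrt N" using \<open>N > 0\<close> by (intro real_div_sqrt) auto
      finally show ?thesis by simp
    qed
    finally have "norm (v (1/N)) ^ 2 \<le> (3/2 * K * sqrt N)^2" by (intro power_mono) auto
    then have v2: "v (1/N) \<bullet> v (1/N) \<le> 9/4 * K^2 * N"
      using \<open>N > 0\<close> by (simp add: power2_norm_eq_inner power_mult_distrib power_divide)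
    have "norm (u (1/N)) \<le> 1 / sqrt N * K"
      unfolding u_def s1 using sN bF by (auto simp: norm_mult norm_divide intro!: divide_right_mono)
    then have "norm (u (1/N)) ^ 2 \<le> (1 / sqrt N * K)^2" by (intro power_mono) auto
    then have "u (1/N) \<bullet> u (1/N) \<le> K^2 / N"
      using \<open>N > 0\<close> by (simp add: power2_norm_eq_inner power_mult_distrib power_divide)
    then have "w (1/N) * (u (1/N) \<bullet> u (1/N)) \<le> w (1/N) * (K^2 / N)"
      by (intro mult_left_mono) (auto simp: w_def)
    also have "\<dots> = 5/4 * K^2 * N" using \<open>N > 0\<close> unfolding w_def by (simp add: field_simps power2_eq_square)
    finally have "E (1/N) \<le> 7/2 * (K^2 * N)" unfolding E_def using v2 by simp
    also have "\<dots> \<le> 4 * (K^2 * N)" using \<open>N > 0\<close> by (intro mult_right_mono) auto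
    finally show ?thesis by simp
  qed
  have Er: "E r \<le> 4 * K^2 * N" if "r \<ge> 1 / N" for r
  proof -
    have "E r \<le> E (1/N)"
    proof (rule DERIV_nonpos_imp_nonincreasing[OF that])
      fix s assume "1 / N \<le> s"
      then have "s > 0" using \<open>N > 0\<close> by (smt (verit) divide_pos_pos)
      then show "\<exists>y. (E has_real_derivative y) (at s) \<and> y \<le> 0"
        using dE[of s] by (intro exI[of _ "- (1 / (2 * s^3)) * (u s \<bullet> u s)"]) auto
    qed
    then show ?thesis using E1 by simp
  qed
  have bu: "norm (u r) \<le> 2 * K / sqrt N" and bv: "norm (v r) \<le> 2 * K * sqrt N" if "r \<ge> 1 / N" for r
  proof -
    have "norm (v r) ^ 2 + w r * norm (u r)^2 \<le> 4 * K^2 * N"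
      using Er[OF that] unfolding E_def power2_norm_eq_inner .
    moreover have "N^2 * norm (u r)^2 \<le> w r * norm (u r)^2"
      by (intro mult_right_mono) (auto simp: w_def)
    ultimately have *: "N^2 * norm (u r)^2 + norm (v r)^2 \<le> 4 * K^2 * N" by linarith
    have eq: "(2 * K * sqrt N)^2 = 4 * K^2 * N" using \<open>N > 0\<close> by (simp add: power_mult_distrib)
    have nn: "0 \<le> N^2 * norm (u r)^2" "0 \<le> norm (v r)^2" "0 \<le> 2 * K * sqrt N"
      using \<open>N > 0\<close> \<open>K \<ge> 0\<close> by simp_all
    have "norm (v r)^2 \<le> (2 * K * sqrt N)^2" using * nn(1) unfolding eq by linarith
    then show "norm (v r) \<le> 2 * K * sqrt N" using nn(3) by (rule power2_le_imp_le)
    have "(N * norm (u r))^2 \<le> (2 * K * sqrt N)^2"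
      using * nn(2) unfolding eq power_mult_distrib[of N] by linarith
    then have "N * norm (u r) \<le> 2 * K * sqrt N" using nn(3) by (rule power2_le_imp_le)
    then have "sqrt N * (sqrt N * norm (u r)) \<le> sqrt N * (2 * K)"
      unfolding mult.assoc[symmetric] sN(2) by (simp only: mult.commute mult.left_commute mult.assoc)
    then have "sqrt N * norm (u r) \<le> 2 * K" using sN(1) by simp
    then show "norm (u r) \<le> 2 * K / sqrt N" using sN(1) by (simp add: field_simps)
  qed
  \<comment> \<open>\<open>\<sigma> = 1\<close> gives \<open>\<alpha>\<close> and \<open>\<sigma> = -1\<close> gives \<open>\<beta>\<close>.\<close>
  define a where "a \<sigma> r = cis (- \<sigma> * N * r) * (u r - \<i> * of_real (\<sigma> / N) * v r) / 2" for \<sigma> r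
  define a' where "a' \<sigma> r = cis (- \<sigma> * N * r) * (\<i> * of_real (\<sigma> / (8 * N * r^2)) * u r)" for \<sigma> r
  \<comment> \<open>Division by sqrt r undoes the substitution u = sqrt r F.\<close>
  define A where "A \<sigma> r = of_real (1 / sqrt r) * a \<sigma> r" for \<sigma> r
  define A' where "A' \<sigma> r = of_real (1 / sqrt r) * a' \<sigma> r + of_real (- 1 / (2 * r * sqrt r)) * a \<sigma> r" for \<sigma> r
  have rpos: "r > 0" if "r \<ge> 1 / N" for r
    using that \<open>N > 0\<close> by (smt (verit) divide_pos_pos)
  have da: "(a \<sigma> has_vector_derivative a' \<sigma> r) (at r)" if "r > 0" "\<sigma> = 1 \<or> \<sigma> = -1" for \<sigma> r
  proof -
    have "((\<lambda>r. cis (- \<sigma> * N * r) * (u r - \<i> * of_real (\<sigma> / N) * v r) / 2) has_vector_derivative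
      (cis (- \<sigma> * N * r) * (v r - \<i> * of_real (\<sigma> / N) * (- of_real (w r) * u r)) +
       (\<i> * of_real (- \<sigma> * N) * cis (- \<sigma> * N * r)) * (u r - \<i> * of_real (\<sigma> / N) * v r)) / 2) (at r)"
      by (intro has_vector_derivative_divide has_vector_derivative_mult has_vector_derivative_diff
         has_vector_derivative_mult_right du dv that has_vector_derivative_cis)
        (auto intro!: derivative_eq_intros)
    moreover have "(cis (- \<sigma> * N * r) * (v r - \<i> * of_real (\<sigma> / N) * (- of_real (w r) * u r)) +
       (\<i> * of_real (- \<sigma> * N) * cis (- \<sigma> * N * r)) * (u r - \<i> * of_real (\<sigma> / N) * v r)) / 2 = a' \<sigma> r"
    proof -
      \<comment> \<open>As \<sigma>^2 = 1, both the terms in \<open>v\<close> and the part N^2 of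
        \<open>w\<close> cancel. What remains is the small part 1/(4 r^2) of \<open>w\<close>; hence
        the amplitude varies slowly.\<close>
      have "(v r - \<i> * of_real (\<sigma> / N) * (- of_real (w r) * u r)) +
       (\<i> * of_real (- \<sigma> * N)) * (u r - \<i> * of_real (\<sigma> / N) * v r) = \<i> * of_real (\<sigma> / (4 * N * r^2)) * u r"
        using that \<open>N > 0\<close> unfolding w_def by (auto simp: field_simps power2_eq_square)
      then have "cis (- \<sigma> * N * r) * ((v r - \<i> * of_real (\<sigma> / N) * (- of_real (w r) * u r)) +
       (\<i> * of_real (- \<sigma> * N)) * (u r - \<i> * of_real (\<sigma> / N) * v r)) / 2 =
         cis (- \<sigma> * N * r) * (\<i> * of_real (\<sigma> / (4 * N * r^2)) * u r) / 2" by simp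
      then show ?thesis unfolding a'_def by (simp add: algebra_simps)
    qed
    ultimately show ?thesis unfolding a_def[abs_def] by simp
  qed
  have dA: "(A \<sigma> has_vector_derivative A' \<sigma> r) (at r)" if "r \<ge> 1 / N" "\<sigma> = 1 \<or> \<sigma> = -1" for \<sigma> r
    unfolding A_def[abs_def] A'_def using rpos[OF that(1)] that(2)
    by (intro has_vector_derivative_mult has_vector_derivative_of_real da)
      (auto intro!: derivative_eq_intros simp: field_simps)
  have cA: "continuous_on {1/N..} (A' \<sigma>)" if "\<sigma> = 1 \<or> \<sigma> = -1" for \<sigma>
  proof -
    have cu: "continuous_on {1/N..} u" "continuous_on {1/N..} v"
      using du dv rpos by (meson atLeast_iff continuous_at_imp_continuous_on has_vector_derivative_continuous)+
    have "r \<noteq> 0" "r \<ge> 0" if "r \<in> {1/N..}" for r using rpos[of r] that by auto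
    then show ?thesis unfolding A'_def a'_def a_def using \<open>N > 0\<close>
      by (intro continuous_intros cu) auto
  qed
  have ba: "norm (a \<sigma> r) \<le> 2 * K / sqrt N" if "r \<ge> 1 / N" "\<sigma> = 1 \<or> \<sigma> = -1" for \<sigma> r
  proof -
    have "norm (\<i> * of_real (\<sigma> / N) * v r) \<le> (1 / N) * (2 * K * sqrt N)"
      using bv[OF that(1)] that(2) \<open>N > 0\<close> by (auto simp: norm_mult norm_divide intro!: divide_right_mono)
    also have "\<dots> = 2 * K * (sqrt N / N)" by simp
    also have "\<dots> = 2 * K / sqrt N"
      unfolding sqrt_divide_self_eq[OF less_imp_le[OF \<open>N > 0\<close>]] by (simp add: divide_inverse)
    finally have "norm (u r - \<i> * of_real (\<sigma> / N) * v r) \<le> 2 * K / sqrt N + 2 * K / sqrt N"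
      using bu[OF that(1)] by (intro order_trans[OF norm_triangle_ineq4] add_mono)
    then show ?thesis unfolding a_def by (simp add: norm_mult norm_divide)
  qed
  have ba': "norm (a' \<sigma> r) \<le> K / (sqrt N * r)" if "r \<ge> 1 / N" "\<sigma> = 1 \<or> \<sigma> = -1" for \<sigma> r
  proof -
    have r: "r > 0" "N * r \<ge> 1" using rpos[OF that(1)] that(1) \<open>N > 0\<close> by (auto simp: field_simps)
    have "norm (a' \<sigma> r) = 1 / (8 * N * r^2) * norm (u r)"
      using that(2) \<open>N > 0\<close> unfolding a'_def by (auto simp: norm_mult norm_divide norm_power)
    also have "\<dots> \<le> 1 / (8 * N * r^2) * (2 * K / sqrt N)"
      using bu[OF that(1)] \<open>N > 0\<close> by (intro mult_left_mono) auto
    also have "\<dots> = (1 / (4 * (N * r))) * (K / (sqrt N * r))"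
    proof -
      have "1 / (8 * N * r^2) * (2 * K / q) = (1 / (4 * (N * r))) * (K / (q * r))" if "q \<noteq> 0" for q
        using that r \<open>N > 0\<close> by (simp add: field_simps power2_eq_square)
      then show ?thesis using sN(1) by (metis less_irrefl)
    qed
    \<comment> \<open>Here r >= 1/N enters: N r >= 1 turns the factor 1/(N r^2) into 1/r.\<close>
    also have "\<dots> \<le> 1 * (K / (sqrt N * r))"
      using r \<open>K \<ge> 0\<close> sN by (intro mult_right_mono) auto
    finally show ?thesis by simp
  qed
  have bA: "norm (A \<sigma> r) \<le> 2 * K / sqrt (N * r)" if "r \<ge> 1 / N" "\<sigma> = 1 \<or> \<sigma> = -1" for \<sigma> r
  proof -
    have "norm (A \<sigma> r) = norm (a \<sigma> r) / sqrt r"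
      using rpos[OF that(1)] by (simp add: A_def norm_mult norm_divide)
    also have "\<dots> \<le> (2 * K / sqrt N) / sqrt r"
      using rpos[OF that(1)] by (intro divide_right_mono ba that) auto
    finally show ?thesis by (simp add: real_sqrt_mult)
  qed
  have bA': "norm (A' \<sigma> r) \<le> 2 * K / (r * sqrt (N * r))" if "r \<ge> 1 / N" "\<sigma> = 1 \<or> \<sigma> = -1" for \<sigma> r
  proof -
    have r: "r > 0" by (rule rpos[OF that(1)])
    have "norm (A' \<sigma> r) \<le> 1 / sqrt r * norm (a' \<sigma> r) + 1 / (2 * r * sqrt r) * norm (a \<sigma> r)"
      unfolding A'_def using r
      by (intro order_trans[OF norm_triangle_ineq]) (simp add: norm_mult norm_divide)
    also have "\<dots> \<le> 1 / sqrt r * (K / (sqrt N * r)) + 1 / (2 * r * sqrt r) * (2 * K / sqrt N)"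
      using r by (intro add_mono mult_left_mono ba ba' that) auto
    also have "\<dots> = 2 * K / (r * sqrt (N * r))"
    proof -
      have "1 / p * (K / (q * r)) + 1 / (2 * r * p) * (2 * K / q) = 2 * K / (r * (q * p))"
        if "p \<noteq> 0" "q \<noteq> 0" for p q
        using that r by (simp add: field_simps)
      from this[of "sqrt r" "sqrt N"] show ?thesis using r \<open>N > 0\<close>
        by (simp only: real_sqrt_mult) simp
    qed
    finally show ?thesis .
  qed
  show ?thesis
  proof (rule that[of "A 1" "A (-1)" "A' 1" "A' (-1)"])
    fix r assume "r \<ge> 1 / N"
    then have r: "r > 0" by (rule rpos)
    have "cis (N * r) * A 1 r + cis (- N * r) * A (-1) r
      = of_real (1 / sqrt r) * ((cis (N * r) * cis (- N * r)) * ((u r - \<i> * of_real (1 / N) * v r) / 2)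
       + (cis (- N * r) * cis (N * r)) * ((u r - \<i> * of_real (- 1 / N) * v r) / 2))"
      unfolding A_def a_def by (simp add: algebra_simps)
    also have "\<dots> = of_real (1 / sqrt r) * u r"
      by (simp add: cis_mult field_simps)
    also have "\<dots> = F r" using r by (simp add: u_def)
    finally show "F r = cis (N * r) * A 1 r + cis (- N * r) * A (-1) r" by simp
  qed (rule dA cA bA bA'; simp)+
qed

section \<open>Polar coordinates in the plane\<close>

text \<open>Polar coordinates are a change of variables in real^2, while iterated integration is
  done over real \<times> real. The identification of the two planes maps boxes to boxes of equal
  area and so carries integrals across.\<close>

lemma has_integral_vec2:
  fixes f :: "real \<times> real \<Rightarrow> 'a::real_normed_vector"
  assumes "(f has_integral i) (cbox (a, c) (b, d))"
  shows "((\<lambda>v::real^2. f (v $ 1, v $ 2)) has_integral i) (cbox (vector [a, c]) (vector [b, d]))"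
proof -
  define g where "g v = (v $ 1, v $ 2)" for v :: "real^2"
  define h where "h p = (vector [fst p, snd p] :: real^2)" for p :: "real \<times> real"
  have hg: "h (g v) = v" for v by (simp add: h_def g_def vec_eq_iff forall_2)
  have gh: "g (h p) = p" for p by (simp add: h_def g_def)
  have mem_g: "g v \<in> cbox (g u) (g w) \<longleftrightarrow> v \<in> cbox u w" for u v w
    by (auto simp: g_def mem_box_cart forall_2 cbox_Pair_eq)
  have g_img: "g ` cbox u w = cbox (g u) (g w)" for u w
  proof (intro equalityI subsetI)
    fix p assume "p \<in> cbox (g u) (g w)"
    then have "h p \<in> cbox u w" using mem_g[of "h p"] gh by simp
    then show "p \<in> g ` cbox u w" using gh by (metis image_eqI)
  qed (use mem_g in auto)
  have h_img: "h ` cbox p q = cbox (h p) (h q)" for p q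
    using g_img[of "h p" "h q"] gh hg by (metis (no_types, lifting) image_cong image_ident image_image)
  have cont: "measure lborel (cbox (g u) (g w)) = measure lborel (cbox u w)" for u w
  proof (cases "cbox u w = {}")
    case True
    then have "cbox (g u) (g w) = {}" using g_img[of u w] by simp
    then show ?thesis using True by simp
  next
    case False
    then have "u $ 1 \<le> w $ 1" "u $ 2 \<le> w $ 2"
      by (auto simp: mem_box_cart forall_2 set_eq_iff)
    then show ?thesis using False
      by (simp add: content_cbox_cart g_def content_Pair UNIV_2)
  qed
  have "((\<lambda>v. f (g v)) has_integral (1 / 1) *\<^sub>R i) (h ` cbox (a, c) (b, d))"
  proof (rule has_integral_twiddle[OF _ hg gh])
    show "continuous (at v) g" for v unfolding g_def by (intro continuous_intros)
    show "\<exists>w z. g ` cbox u v = cbox w z" for u v using g_img by blast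
    show "\<exists>w z. h ` cbox u v = cbox w z" for u v using h_img by blast
    show "measure lborel (g ` cbox u v) = 1 * measure lborel (cbox u v)" for u v using g_img cont by simp
  qed (use assms in auto)
  then show ?thesis by (simp add: h_img) (simp add: h_def g_def)
qed

definition polar_map :: "real^2 \<Rightarrow> real^2" where
  "polar_map v = vector [v $ 1 * cos (v $ 2), v $ 1 * sin (v $ 2)]"

definition polar_deriv :: "real^2 \<Rightarrow> real^2 \<Rightarrow> real^2" where
  "polar_deriv v h = vector [h $ 1 * cos (v $ 2) - v $ 1 * sin (v $ 2) * h $ 2,
                             h $ 1 * sin (v $ 2) + v $ 1 * cos (v $ 2) * h $ 2]"

lemma has_derivative_polar_map: "(polar_map has_derivative polar_deriv v) (at v within S)"
proof -
  have n: "((\<lambda>v::real^2. v $ i) has_derivative (\<lambda>h. h $ i)) (at v within S)" for i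
    by (rule bounded_linear_imp_has_derivative[OF bounded_linear_vec_nth])
  have "((\<lambda>v. polar_map v $ i) has_derivative (\<lambda>h. polar_deriv v h $ i)) (at v within S)" for i
  proof -
    have "((\<lambda>v::real^2. v $ 1 * cos (v $ 2)) has_derivative
        (\<lambda>h. h $ 1 * cos (v $ 2) - v $ 1 * sin (v $ 2) * h $ 2)) (at v within S)"
      by (rule has_derivative_eq_rhs, (rule has_derivative_mult has_derivative_cos n)+)
        (simp add: algebra_simps)
    moreover have "((\<lambda>v::real^2. v $ 1 * sin (v $ 2)) has_derivative
        (\<lambda>h. h $ 1 * sin (v $ 2) + v $ 1 * cos (v $ 2) * h $ 2)) (at v within S)"
      by (rule has_derivative_eq_rhs, (rule has_derivative_mult has_derivative_sin n)+)
        (simp add: algebra_simps)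
    ultimately show ?thesis using exhaust_2[of i] by (auto simp: polar_map_def polar_deriv_def)
  qed
  then show ?thesis
    by (subst has_derivative_componentwise_within) (auto simp: Basis_vec_def inner_axis)
qed

lemma det_polar_deriv: "det (matrix (polar_deriv v)) = v $ 1"
proof -
  have "det (matrix (polar_deriv v)) = v $ 1 * ((sin (v $ 2))^2 + (cos (v $ 2))^2)"
    unfolding det_2 matrix_def polar_deriv_def axis_def vec_lambda_beta vector_2
    by (simp del: sin_cos_squared_add, algebra)
  then show ?thesis by simp
qed

lemma norm_polar_map: "v $ 1 \<ge> 0 \<Longrightarrow> norm (polar_map v) = v $ 1"
proof -
  assume "v $ 1 \<ge> 0"
  have "norm (polar_map v) ^ 2 = (v $ 1)^2 * ((sin (v $ 2))^2 + (cos (v $ 2))^2)"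
    unfolding norm_vec2 polar_map_def vector_2 by algebra
  then have "norm (polar_map v) ^ 2 = (v $ 1)^2" by simp
  then show ?thesis using \<open>v $ 1 \<ge> 0\<close> by (simp add: power2_eq_iff_nonneg)
qed

lemma inner_polar_map: "x \<bullet> polar_map v = v $ 1 * circle_freq x (v $ 2)"
  by (simp add: polar_map_def circle_freq_def inner_vec_def sum_2 algebra_simps)

lemma inj_on_polar_map: "inj_on polar_map {v. v $ 1 > 0 \<and> 0 \<le> v $ 2 \<and> v $ 2 < 2 * pi}"
proof (rule inj_onI)
  fix v w assume v: "v \<in> {v. v $ 1 > 0 \<and> 0 \<le> v $ 2 \<and> v $ 2 < 2 * pi}"
    and w: "w \<in> {v. v $ 1 > 0 \<and> 0 \<le> v $ 2 \<and> v $ 2 < 2 * pi}" and eq: "polar_map v = polar_map w"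
  have 1: "v $ 1 = w $ 1" using norm_polar_map[of v] norm_polar_map[of w] eq v w by simp
  have "polar_map v $ 1 = polar_map w $ 1" "polar_map v $ 2 = polar_map w $ 2" using eq by simp_all
  then have "cos (v $ 2) = cos (w $ 2)" "sin (v $ 2) = sin (w $ 2)"
    using 1 w by (simp_all add: polar_map_def)
  then obtain n :: int where n: "v $ 2 = w $ 2 + 2 * pi * n"
    using sin_cos_eq_iff by blast
  have "\<bar>2 * pi * n\<bar> < 2 * pi" using n v w by auto
  then have "\<bar>real_of_int n\<bar> < 1" by (simp add: abs_mult)
  then have "n = 0" by linarith
  then show "v = w" using n 1 by (simp add: vec_eq_iff forall_2)
qed

lemma polar_map_image:
  assumes "p > 0"
  shows "polar_map ` {v. p \<le> v $ 1 \<and> v $ 1 \<le> q \<and> 0 \<le> v $ 2 \<and> v $ 2 < 2 * pi}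
    = {\<xi>. p \<le> norm \<xi> \<and> norm \<xi> \<le> q}"
proof (intro equalityI subsetI)
  fix \<xi> :: "real^2" assume xi: "\<xi> \<in> {\<xi>. p \<le> norm \<xi> \<and> norm \<xi> \<le> q}"
  then have nz: "norm \<xi> > 0" using assms by auto
  have "(\<xi> $ 1 / norm \<xi>)^2 + (\<xi> $ 2 / norm \<xi>)^2 = ((\<xi> $ 1)^2 + (\<xi> $ 2)^2) / norm \<xi> ^ 2"
    by (simp add: power_divide add_divide_distrib)
  also have "\<dots> = 1" unfolding norm_vec2[symmetric] using nz by simp
  finally obtain t where t: "0 \<le> t" "t < 2*pi" "\<xi> $ 1 / norm \<xi> = cos t" "\<xi> $ 2 / norm \<xi> = sin t"
    using sincos_total_2pi by blast
  then have "\<xi> = polar_map (vector [norm \<xi>, t])"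
    using nz by (simp add: polar_map_def vec_eq_iff forall_2 flip: t(3,4))
  then show "\<xi> \<in> polar_map ` {v. p \<le> v $ 1 \<and> v $ 1 \<le> q \<and> 0 \<le> v $ 2 \<and> v $ 2 < 2 * pi}"
    using xi t by (intro image_eqI) auto
qed (use assms norm_polar_map in auto)

text \<open>As f vanishes at radii outside {p..q} and p > 0, everything takes place on a compact
  annulus, away from the singularity of polar coordinates at the origin. The angular integral of the
  plane wave is then the zeroth moment, and the factor r is the Jacobian.\<close>

lemma polar_integral:
  fixes f :: "real \<Rightarrow> complex" and x :: "real^2"
  assumes "0 < p" and f: "continuous_on {p..q} f" and f0: "\<And>r. r \<ge> 0 \<Longrightarrow> r \<notin> {p..q} \<Longrightarrow> f r = 0"
  shows "integrable lborel (\<lambda>\<xi>. cis (x \<bullet> \<xi>) * f (norm \<xi>))" (is ?int)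
    and "(LINT \<xi>|lborel. cis (x \<bullet> \<xi>) * f (norm \<xi>)) =
      integral {p..q} (\<lambda>r. of_real r * f r * circle_moment x 0 r)" (is ?eq)
proof -
  define A where "A = {\<xi>::real^2. p \<le> norm \<xi> \<and> norm \<xi> \<le> q}"
  \<comment> \<open>\<open>S\<close> is half-open in the angle so that \<open>polar_map\<close> is
    injective on it. It differs from the closed box \<open>Q\<close> by a subset of the null line of
    angle 2 pi.\<close>
  define S where "S = {v::real^2. p \<le> v $ 1 \<and> v $ 1 \<le> q \<and> 0 \<le> v $ 2 \<and> v $ 2 < 2 * pi}"
  define Q where "Q = cbox (vector [p, 0]) (vector [q, 2 * pi] :: real^2)"
  define G where "G \<xi> = cis (x \<bullet> \<xi>) * f (norm \<xi>)" for \<xi> :: "real^2"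
  \<comment> \<open>\<open>integral_change_of_variables\<close> concerns functions with values in
    real^n; complex values are sent there by \<open>L\<close> and recovered by
    \<open>L'\<close>.\<close>
  define L where "L z = (vector [Re z, Im z] :: real^2)" for z
  define L' where "L' v = Complex (v $ 1) (v $ 2)" for v :: "real^2"
  have L'L: "L' (L z) = z" for z by (simp add: L'_def L_def)
  have blL: "bounded_linear L"
    by (intro linear_conv_bounded_linear[THEN iffD1] linearI)
      (auto simp: L_def vec_eq_iff forall_2)
  have "compact A"
  proof -
    have "A = cball 0 q - ball 0 p" unfolding A_def by auto
    then show ?thesis by (simp add: compact_diff)
  qed
  have cG: "continuous_on A G"
    unfolding G_def A_def
    by (intro continuous_intros continuous_on_compose2[OF f]) auto
  have G0: "indicator A \<xi> *\<^sub>R G \<xi> = G \<xi>" for \<xi>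
    using f0[of "norm \<xi>"] by (auto simp: A_def G_def indicator_def)
  have intG: "integrable lborel G"
    using borel_integrable_compact[OF \<open>compact A\<close> cG] unfolding G0 .
  then show ?int unfolding G_def .
  have absG: "G absolutely_integrable_on A"
    unfolding set_integrable_def G0 using integrable_completion[of G lborel] intG by auto
  have LINT: "integral A G = (LINT \<xi>|lborel. G \<xi>)"
  proof -
    have "integral A G = integral UNIV (\<lambda>\<xi>. if \<xi> \<in> A then G \<xi> else 0)"
      by (rule integral_restrict_UNIV [symmetric])
    also have "(\<lambda>\<xi>. if \<xi> \<in> A then G \<xi> else 0) = G"
    proof
      show "(if \<xi> \<in> A then G \<xi> else 0) = G \<xi>" for \<xi>
        using G0[of \<xi>] by (cases "\<xi> \<in> A") auto
    qed
    finally show ?thesis using integral_lborel[OF intG] by simp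
  qed
  define h where "h z = of_real (fst z) * (cis (fst z * circle_freq x (snd z)) * f (fst z))" for z :: "real \<times> real"
  define hh where "hh v = h (v $ 1, v $ 2)" for v :: "real^2"
  have ch: "continuous_on (cbox (p, 0) (q, 2 * pi)) h"
    unfolding h_def by (intro continuous_intros continuous_on_compose2[OF f]) (auto simp: cbox_Pair_eq)
  have hh: "(hh has_integral integral (cbox (p, 0) (q, 2 * pi)) h) Q"
    unfolding hh_def Q_def by (intro has_integral_vec2 integrable_integral integrable_continuous ch)
  have SQ: "S = Q \<inter> {v. v $ 2 < 2 * pi}"
    unfolding S_def Q_def by (auto simp: mem_box_cart forall_2)
  have "open {v::real^2. v $ 2 < 2 * pi}"
    by (intro open_Collect_less continuous_intros)
  then have "S \<in> sets borel" unfolding SQ Q_def by (intro sets.Int borel_open borel_closed) auto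
  then have Sleb: "S \<in> sets lebesgue" by (simp add: sets_completionI_sets)
  have imS: "polar_map ` S = A" unfolding S_def A_def by (rule polar_map_image[OF \<open>p > 0\<close>])
  have "L (integral A G) = integral A (L \<circ> G)"
    using absG blL by (simp add: integral_linear absolutely_integrable_on_def)
  also have "\<dots> = integral (polar_map ` S) (L \<circ> G)" by (simp add: imS)
  also have "\<dots> = integral S (\<lambda>v. \<bar>det (matrix (polar_deriv v))\<bar> *\<^sub>R (L \<circ> G) (polar_map v))"
  proof (rule integral_change_of_variables[OF Sleb has_derivative_polar_map])
    show "inj_on polar_map S"
      by (rule inj_on_subset[OF inj_on_polar_map]) (use \<open>p > 0\<close> in \<open>auto simp: S_def\<close>)
    show "(L \<circ> G) absolutely_integrable_on polar_map ` S \<or>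
      (\<lambda>v. \<bar>det (matrix (polar_deriv v))\<bar> *\<^sub>R (L \<circ> G) (polar_map v)) absolutely_integrable_on S"
      unfolding imS using absolutely_integrable_linear[OF absG blL] by blast
  qed
  also have "\<dots> = integral S (L \<circ> hh)"
  proof (rule integral_cong)
    fix v assume "v \<in> S"
    then have v: "v $ 1 > 0" using \<open>p > 0\<close> by (auto simp: S_def)
    have "hh v = v $ 1 *\<^sub>R G (polar_map v)"
      using v by (simp add: hh_def h_def G_def norm_polar_map inner_polar_map scaleR_conv_of_real)
    then show "\<bar>det (matrix (polar_deriv v))\<bar> *\<^sub>R (L \<circ> G) (polar_map v) = (L \<circ> hh) v"
      using v linear_scale[OF bounded_linear.linear[OF blL]] by (simp add: det_polar_deriv)
  qed
  also have "\<dots> = integral Q (L \<circ> hh)"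
  proof (rule integral_spike_set)
    have "negligible {v::real^2. v $ 2 = 2 * pi}"
      using negligible_standard_hyperplane[of "axis 2 1 :: real^2" "2 * pi"]
      by (simp add: inner_axis Basis_vec_def) blast
    then show "negligible {v \<in> Q - S. (L \<circ> hh) v \<noteq> 0}"
      by (rule negligible_subset) (auto simp: SQ Q_def mem_box_cart forall_2)
    show "negligible {v \<in> S - Q. (L \<circ> hh) v \<noteq> 0}"
      using SQ by (intro empty_imp_negligible) auto
  qed
  also have "\<dots> = L (integral Q hh)"
    using hh blL by (intro integral_linear) (auto simp: has_integral_integrable)
  finally have "integral A G = integral Q hh" using L'L by metis
  also have "\<dots> = integral (cbox (p, 0) (q, 2 * pi)) h" by (rule integral_unique[OF hh])
  also have "\<dots> = integral (cbox p q) (\<lambda>r. integral (cbox 0 (2 * pi)) (\<lambda>\<theta>. h (r, \<theta>)))"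
    by (rule integral_prod_continuous[OF ch])
  also have "\<dots> = integral {p..q} (\<lambda>r. of_real r * f r * circle_moment x 0 r)"
    unfolding cbox_interval circle_moment_def
  proof (rule integral_cong)
    fix r
    have "integral {0..2*pi} (\<lambda>\<theta>. h (r, \<theta>)) = integral {0..2*pi} (\<lambda>\<theta>. (of_real r * f r) * cis (r * circle_freq x \<theta>))"
      by (rule integral_cong) (simp add: h_def)
    then show "integral {0..2*pi} (\<lambda>\<theta>. h (r, \<theta>)) =
      of_real r * f r * integral {0..2*pi} (\<lambda>\<theta>. (\<i> * of_real (circle_freq x \<theta>)) ^ 0 * cis (r * circle_freq x \<theta>))"
      by simp
  qed
  finally show ?eq unfolding LINT G_def .
qed

section \<open>Oscillatory integrals against the Bessel function\<close>

text \<open>One interval of radii at scale \<open>R\<close>, with phase \<open>G\<close> and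
  amplitude \<open>h\<close>. The bound H/R for h' says that the amplitude changes by at most a
  multiple of \<open>H\<close> over the interval. The endpoints are free inside {R/2..2R} because a
  dyadic shell is cut further, for instance at zeros of g''.\<close>

locale radial_piece =
  fixes p q R H :: real and G G1 G2 :: "real \<Rightarrow> real" and h h' :: "real \<Rightarrow> complex" and x :: "real^2"
  assumes R: "R > 0" "R / 2 \<le> p" "p \<le> q" "q \<le> 2 * R"
    and dG: "\<And>r. r \<in> {p..q} \<Longrightarrow> (G has_real_derivative G1 r) (at r)"
    and dG1: "\<And>r. r \<in> {p..q} \<Longrightarrow> (G1 has_real_derivative G2 r) (at r)"
    and cG2: "continuous_on {p..q} G2"
    and dh: "\<And>r. r \<in> {p..q} \<Longrightarrow> (h has_vector_derivative h' r) (at r)"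
    and ch': "continuous_on {p..q} h'"
    and bh: "\<And>r. r \<in> {p..q} \<Longrightarrow> norm (h r) \<le> H"
    and bh': "\<And>r. r \<in> {p..q} \<Longrightarrow> norm (h' r) \<le> H / R"
begin

abbreviation "J \<equiv> integral {p..q} (\<lambda>r. h r * cis (G r) * circle_moment x 0 r)"

lemma H_nonneg: "H \<ge> 0"
  using bh[of p] R norm_ge_zero[of "h p"] by (meson atLeastAtMost_iff order_refl order_trans)

lemma cont: "continuous_on {p..q} G" "continuous_on {p..q} h" "continuous_on {p..q} (circle_moment x n)"
proof -
  show "continuous_on {p..q} G"
    using dG by (meson DERIV_isCont continuous_at_imp_continuous_on)
  show "continuous_on {p..q} h"
    using dh by (meson continuous_at_imp_continuous_on has_vector_derivative_continuous)
  show "continuous_on {p..q} (circle_moment x n)"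
    using circle_moment_derivative
    by (meson continuous_at_imp_continuous_on has_vector_derivative_continuous)
qed

text \<open>The factor 5/2 is 1 + 3/2: the interval has length at most 3R/2, so the total variation
  of the amplitude is at most 3L/2.\<close>

lemma amplitude:
  fixes a a' :: "real \<Rightarrow> complex"
  assumes da: "\<And>r. r \<in> {p..q} \<Longrightarrow> (a has_vector_derivative a' r) (at r)"
    and ca: "continuous_on {p..q} a'"
    and ba: "\<And>r. r \<in> {p..q} \<Longrightarrow> norm (a r) \<le> L" and ba': "\<And>r. r \<in> {p..q} \<Longrightarrow> norm (a' r) \<le> L / R"
    and \<psi>: "continuous_on {p..q} \<psi>"
    and M: "\<And>r. r \<in> {p..q} \<Longrightarrow> norm (integral {p..r} (\<lambda>r. cis (\<psi> r))) \<le> M"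
  shows "norm (integral {p..q} (\<lambda>r. a r * cis (\<psi> r))) \<le> 5 / 2 * M * L"
proof -
  have M0: "M \<ge> 0" using M[of p] R by simp
  have L0: "L \<ge> 0"
    using ba[of p] R norm_ge_zero[of "a p"] by (meson atLeastAtMost_iff order_refl order_trans)
  have "norm (integral {p..q} (\<lambda>r. a r * cis (\<psi> r))) \<le> M * (L + L / R * (q - p))"
    by (rule norm_integral_amplitude_le[OF R(3) _ has_vector_derivative_at_within[OF da] ca ba ba' M])
      (intro continuous_intros \<psi>)
  also have "\<dots> \<le> M * (L + 3 / 2 * L)"
  proof (intro mult_left_mono add_mono order_refl M0)
    have "L / R * (q - p) \<le> L / R * (3 / 2 * R)"
      using R L0 by (intro mult_left_mono) auto
    then show "L / R * (q - p) \<le> 3 / 2 * L" using R by simp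
  qed
  also have "\<dots> = 5 / 2 * M * L" by (simp add: algebra_simps)
  finally show ?thesis .
qed

text \<open>By Fubini \<open>J\<close> is the integral over the angle of one-dimensional oscillatory
  integrals. A bound uniform in the angle costs only the length 2 pi of the circle.\<close>

lemma J_by_angle:
  assumes "\<And>\<theta>. norm (integral {p..q} (\<lambda>r. h r * cis (G r + r * circle_freq x \<theta>))) \<le> M"
  shows "norm J \<le> 2 * pi * M"
proof -
  define k where "k r \<theta> = h r * cis (G r + r * circle_freq x \<theta>)" for r \<theta>
  have ck: "continuous_on (cbox (p, 0) (q, 2 * pi)) (\<lambda>(r, \<theta>). k r \<theta>)"
    unfolding k_def split_beta cbox_Pair_eq cbox_interval
    by (intro continuous_intros continuous_on_compose2[OF cont(1)] continuous_on_compose2[OF cont(2)]) auto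
  have "J = integral (cbox p q) (\<lambda>r. integral (cbox 0 (2 * pi)) (k r))"
    unfolding cbox_interval circle_moment_def
  proof (rule integral_cong)
    fix r
    have "integral {0..2*pi} (k r) = integral {0..2*pi} (\<lambda>\<theta>. (h r * cis (G r)) * cis (r * circle_freq x \<theta>))"
      by (rule integral_cong) (simp add: k_def cis_mult[symmetric])
    then show "h r * cis (G r) * integral {0..2*pi} (\<lambda>\<theta>. (\<i> * of_real (circle_freq x \<theta>)) ^ 0 * cis (r * circle_freq x \<theta>))
       = integral {0..2*pi} (k r)"
      by simp
  qed
  also have "\<dots> = integral (cbox 0 (2 * pi)) (\<lambda>\<theta>. integral (cbox p q) (\<lambda>r. k r \<theta>))"
    by (rule integral_swap_continuous[OF ck])
  also have "norm \<dots> \<le> M * (2 * pi - 0)"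
    unfolding cbox_interval
  proof (rule integral_bound)
    have "continuous_on (cbox (0, p) (2 * pi, q)) (\<lambda>(\<theta>, r). k r \<theta>)"
      by (rule swap_continuous[OF ck])
    then have "continuous_on (cbox 0 (2 * pi) \<times> cbox p q) (\<lambda>(\<theta>, r). k r \<theta>)"
      by (simp add: cbox_Pair_eq)
    from integral_continuous_on_param[OF this]
    show "continuous_on {0..2 * pi} (\<lambda>\<theta>. integral {p..q} (\<lambda>r. k r \<theta>))"
      by (simp add: cbox_interval)
    show "norm (integral {p..q} (\<lambda>r. k r \<theta>)) \<le> M" for \<theta>
      unfolding k_def by (rule assms)
  qed auto
  finally show ?thesis by (simp add: mult_ac)
qed

lemma linear_phase:
  assumes "r \<in> {p..q}"
  shows "((\<lambda>r. G r + r * c) has_real_derivative G1 r + c) (at r)"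
    and "((\<lambda>r. G1 r + c) has_real_derivative G2 r) (at r)"
  using dG[OF assms] dG1[OF assms] by (auto intro!: derivative_eq_intros)

text \<open>The plane wave shifts the derivative of the phase by at most |x| <= B/2, so at least B/2
  of it is left at every angle; 40 pi is 2 pi * 5/2 * 8.\<close>

lemma J_first_derivative:
  assumes "B > 0" and B: "\<And>r. r \<in> {p..q} \<Longrightarrow> \<bar>G1 r\<bar> \<ge> B"
    and sgn: "(\<forall>r\<in>{p..q}. G2 r \<ge> 0) \<or> (\<forall>r\<in>{p..q}. G2 r \<le> 0)"
    and N: "norm x \<le> B / 2"
  shows "norm J \<le> 40 * pi * H / B"
proof -
  have "norm J \<le> 2 * pi * (5 / 2 * (4 / (B / 2)) * H)"
  proof (rule J_by_angle, rule amplitude[OF dh ch' bh bh'])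
    fix \<theta>
    show "continuous_on {p..q} (\<lambda>r. G r + r * circle_freq x \<theta>)"
      by (intro continuous_intros cont)
    fix r assume r: "r \<in> {p..q}"
    show "norm (integral {p..r} (\<lambda>r. cis (G r + r * circle_freq x \<theta>))) \<le> 4 / (B / 2)"
    proof (rule van_der_corput_first[where \<psi>' = "\<lambda>r. G1 r + circle_freq x \<theta>" and \<psi>'' = G2])
      fix u assume "u \<in> {p..r}"
      then have u: "u \<in> {p..q}" using r by auto
      show "B / 2 \<le> \<bar>G1 u + circle_freq x \<theta>\<bar>"
        using B[OF u] abs_circle_freq_le[of x \<theta>] N by linarith
      show "((\<lambda>r. G r + r * circle_freq x \<theta>) has_real_derivative G1 u + circle_freq x \<theta>) (at u)"
        "((\<lambda>r. G1 r + circle_freq x \<theta>) has_real_derivative G2 u) (at u)"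
        using linear_phase[OF u] by auto
    qed (use r \<open>B > 0\<close> sgn in \<open>auto intro: continuous_on_subset[OF cG2]\<close>)
  qed
  then show ?thesis by (simp add: mult_ac)
qed

text \<open>The linear term of the phase is invisible to \<open>G2\<close>, so the estimate holds
  for every x; 80 pi is 2 pi * 5/2 * 16.\<close>

lemma J_second_derivative:
  assumes "A > 0" and A: "\<And>r. r \<in> {p..q} \<Longrightarrow> \<bar>G2 r\<bar> \<ge> A"
  shows "norm J \<le> 80 * pi * H / sqrt A"
proof -
  have "norm J \<le> 2 * pi * (5 / 2 * (16 / sqrt A) * H)"
  proof (rule J_by_angle, rule amplitude[OF dh ch' bh bh'])
    fix \<theta>
    show "continuous_on {p..q} (\<lambda>r. G r + r * circle_freq x \<theta>)"
      by (intro continuous_intros cont)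
    fix r assume r: "r \<in> {p..q}"
    show "norm (integral {p..r} (\<lambda>r. cis (G r + r * circle_freq x \<theta>))) \<le> 16 / sqrt A"
      by (rule van_der_corput_second[where \<psi>' = "\<lambda>r. G1 r + circle_freq x \<theta>" and \<psi>'' = G2])
        (use r \<open>A > 0\<close> A linear_phase in \<open>auto intro: continuous_on_subset[OF cG2]\<close>)
  qed
  then show ?thesis by (simp add: mult_ac)
qed

lemma integrand_bound:
  assumes "\<And>r. r \<in> {p..q} \<Longrightarrow> norm (circle_moment x 0 r) \<le> K"
  shows "norm J \<le> 3 / 2 * R * H * K"
proof -
  have K0: "K \<ge> 0"
    using assms[of p] R norm_ge_zero[of "circle_moment x 0 p"] by (meson atLeastAtMost_iff order_refl order_trans)
  have "norm J \<le> (H * K) * (q - p)"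
  proof (rule integral_bound)
    show "continuous_on {p..q} (\<lambda>r. h r * cis (G r) * circle_moment x 0 r)"
      by (intro continuous_intros cont)
    fix r assume r: "r \<in> {p..q}"
    show "norm (h r * cis (G r) * circle_moment x 0 r) \<le> H * K"
      using mult_mono[OF bh[OF r] assms[OF r]] H_nonneg by (simp add: norm_mult)
  qed (use R in auto)
  also have "\<dots> \<le> (H * K) * (3 / 2 * R)"
    using R H_nonneg K0 by (intro mult_left_mono) auto
  finally show ?thesis by (simp add: mult_ac)
qed

lemma J_trivial: "norm J \<le> 3 * pi * R * H"
  using integrand_bound[of "2 * pi"] norm_circle_moment_le[of x 0] by (simp add: mult_ac)

end

text \<open>For r |x| >= 1 each of the two Bessel amplitudes contributes 4 pi / sqrt (r |x|). For
  smaller r |x| the root is below 1 and the trivial bound 2 pi is already good enough.\<close>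

lemma norm_circle_moment_decay:
  assumes "x \<noteq> 0" "r > 0"
  shows "norm (circle_moment x 0 r) \<le> 8 * pi / sqrt (norm x * r)"
proof (cases "r \<ge> 1 / norm x")
  case True
  have N: "norm x > 0" using assms by simp
  obtain \<alpha> \<alpha>' \<beta> \<beta>' :: "real \<Rightarrow> complex" where
    *: "\<And>r. r \<ge> 1 / norm x \<Longrightarrow> circle_moment x 0 r = cis (norm x * r) * \<alpha> r + cis (- norm x * r) * \<beta> r"
    "\<And>r. r \<ge> 1 / norm x \<Longrightarrow> norm (\<alpha> r) \<le> 2 * (2 * pi) / sqrt (norm x * r)"
    "\<And>r. r \<ge> 1 / norm x \<Longrightarrow> norm (\<beta> r) \<le> 2 * (2 * pi) / sqrt (norm x * r)"
    by (rule Bessel_amplitudes[OF N _ circle_moment_derivative circle_moment_derivative, of "2 * pi" x 0])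
       (use circle_moment_Bessel[of _ x] norm_circle_moment_le[of x 0] norm_circle_moment_le[of x 1] in
         \<open>auto simp: numeral_2_eq_2\<close>)
  show ?thesis unfolding *(1)[OF True]
    using *(2,3)[OF True] by (intro order_trans[OF norm_triangle_ineq]) (simp add: norm_mult)
next
  case False
  then have "norm x * r < 1" using assms by (simp add: field_simps)
  then have s: "sqrt (norm x * r) \<le> 1" "sqrt (norm x * r) > 0" using assms by auto
  have "norm (circle_moment x 0 r) \<le> 2 * pi" using norm_circle_moment_le[of x 0 r] by simp
  also have "\<dots> \<le> 8 * pi / 1" by simp
  also have "\<dots> \<le> 8 * pi / sqrt (norm x * r)" using s by (intro divide_left_mono) auto
  finally show ?thesis .
qed

context radial_piece begin

lemma J_decay:
  assumes "x \<noteq> 0"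
  shows "norm J \<le> 24 * pi * H * sqrt (R / norm x)"
proof -
  have N: "norm x > 0" using assms by simp
  have "norm J \<le> 3 / 2 * R * H * (16 * pi / sqrt (norm x * R))"
  proof (rule integrand_bound)
    fix r assume r: "r \<in> {p..q}"
    have r': "r \<ge> R / 2" "r > 0" using r R by auto
    \<comment> \<open>Comparing r >= R/2 with R/4 instead keeps the constants rational after taking
      the root.\<close>
    have "sqrt (norm x * R) = 2 * sqrt (norm x * (R / 4))"
      by (simp add: real_sqrt_mult real_sqrt_divide)
    also have "\<dots> \<le> 2 * sqrt (norm x * r)" using r' R N by simp
    finally have le: "sqrt (norm x * R) / 2 \<le> sqrt (norm x * r)" by simp
    have "norm (circle_moment x 0 r) \<le> 8 * pi / sqrt (norm x * r)"
      by (rule norm_circle_moment_decay[OF assms r'(2)])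
    also have "\<dots> \<le> 8 * pi / (sqrt (norm x * R) / 2)"
      using le R N r' by (intro divide_left_mono mult_pos_pos) auto
    finally show "norm (circle_moment x 0 r) \<le> 16 * pi / sqrt (norm x * R)" by simp
  qed
  also have "3 / 2 * R * H * (16 * pi / sqrt (norm x * R)) = 24 * pi * H * sqrt (R / norm x)"
  proof -
    have "3 / 2 * (u * u) * H * (16 * pi / (v * u)) = 24 * pi * H * (u / v)" if "u \<noteq> 0" "v \<noteq> 0" for u v :: real
      using that by (simp add: field_simps)
    from this[of "sqrt R" "sqrt (norm x)"] show ?thesis
      using R N by (simp add: real_sqrt_mult real_sqrt_divide)
  qed
  finally show ?thesis .
qed

text \<open>If |x| R >= 2, the whole interval lies in r >= 1/|x|, where the Bessel function is a sum
  of two waves with slowly varying amplitudes. The waves join the phase without changing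
  \<open>G2\<close>, the amplitudes join \<open>h\<close>; hence the decay (|x| R)^(-1/2) and the
  gain A^(-1/2) multiply.\<close>

lemma J_decay_second_derivative:
  assumes N: "norm x \<ge> 2 / R" and "A > 0" and A: "\<And>r. r \<in> {p..q} \<Longrightarrow> \<bar>G2 r\<bar> \<ge> A"
  shows "norm J \<le> 1920 * pi * H / sqrt (A * (norm x * R))"
proof -
  define n where "n = norm x"
  have n: "n > 0" using N R by (smt (verit) divide_pos_pos n_def)
  define D where "D = 8 * pi / sqrt (n * R)"
  have D0: "D \<ge> 0" using n R by (simp add: D_def)
  obtain \<alpha> \<alpha>' \<beta> \<beta>' :: "real \<Rightarrow> complex" where
    F: "\<And>r. r \<ge> 1 / n \<Longrightarrow> circle_moment x 0 r = cis (n * r) * \<alpha> r + cis (- n * r) * \<beta> r"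
    and d: "\<And>r. r \<ge> 1 / n \<Longrightarrow> (\<alpha> has_vector_derivative \<alpha>' r) (at r)"
      "\<And>r. r \<ge> 1 / n \<Longrightarrow> (\<beta> has_vector_derivative \<beta>' r) (at r)"
    and c: "continuous_on {1/n..} \<alpha>'" "continuous_on {1/n..} \<beta>'"
    and b: "\<And>r. r \<ge> 1 / n \<Longrightarrow> norm (\<alpha> r) \<le> 2 * (2 * pi) / sqrt (n * r)"
      "\<And>r. r \<ge> 1 / n \<Longrightarrow> norm (\<beta> r) \<le> 2 * (2 * pi) / sqrt (n * r)"
    and b': "\<And>r. r \<ge> 1 / n \<Longrightarrow> norm (\<alpha>' r) \<le> 2 * (2 * pi) / (r * sqrt (n * r))"
      "\<And>r. r \<ge> 1 / n \<Longrightarrow> norm (\<beta>' r) \<le> 2 * (2 * pi) / (r * sqrt (n * r))"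
    by (rule Bessel_amplitudes[OF n _ circle_moment_derivative circle_moment_derivative, of "2 * pi" x 0])
       (use circle_moment_Bessel[of _ x] norm_circle_moment_le[of x 0] norm_circle_moment_le[of x 1] in
         \<open>auto simp: numeral_2_eq_2 n_def\<close>)
  have r1: "r \<ge> 1 / n" if "r \<in> {p..q}" for r
  proof -
    have "1 / n \<le> R / 2" using N n R unfolding n_def[symmetric] by (simp add: field_simps)
    then show ?thesis using that R by auto
  qed
  have bD: "2 * (2 * pi) / sqrt (n * r) \<le> D" "2 * (2 * pi) / (r * sqrt (n * r)) \<le> 2 * D / R" if "r \<in> {p..q}" for r
  proof -
    have r': "r \<ge> R / 2" "r > 0" using that R by auto
    have "sqrt (n * R) = 2 * sqrt (n * (R / 4))" by (simp add: real_sqrt_mult real_sqrt_divide)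
    also have "\<dots> \<le> 2 * sqrt (n * r)" using r' R n by simp
    finally have le: "sqrt (n * R) / 2 \<le> sqrt (n * r)" by simp
    have "2 * (2 * pi) / sqrt (n * r) \<le> 4 * pi / (sqrt (n * R) / 2)"
      using le R n r' by (intro frac_le) auto
    then show 1: "2 * (2 * pi) / sqrt (n * r) \<le> D" by (simp add: D_def)
    have "2 * (2 * pi) / sqrt (n * r) / r \<le> D / (R / 2)"
      using 1 r' R D0 by (intro frac_le) auto
    then show "2 * (2 * pi) / (r * sqrt (n * r)) \<le> 2 * D / R" by (simp add: mult_ac)
  qed
  \<comment> \<open>\<open>D\<close> bounds an amplitude and 2 D / R its derivative, so 3 H D bounds
    the product with \<open>h\<close> as well as R times the derivative of that product. The two
    waves together give 2 * 40 * 3 * 8 pi = 1920 pi.\<close>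
  have piece: "norm (integral {p..q} (\<lambda>r. (h r * a r) * cis (G r + r * w))) \<le> 5 / 2 * (16 / sqrt A) * (3 * H * D)"
    if da: "\<And>r. r \<ge> 1 / n \<Longrightarrow> (a has_vector_derivative a' r) (at r)"
      and ca: "continuous_on {1/n..} a'"
      and ba: "\<And>r. r \<ge> 1 / n \<Longrightarrow> norm (a r) \<le> 2 * (2 * pi) / sqrt (n * r)"
      and ba': "\<And>r. r \<ge> 1 / n \<Longrightarrow> norm (a' r) \<le> 2 * (2 * pi) / (r * sqrt (n * r))" for a a' w
  proof (rule amplitude)
    have ca0: "continuous_on {p..q} a" "continuous_on {p..q} a'"
      using da r1 has_vector_derivative_continuous apply (meson continuous_at_imp_continuous_on)
      by (rule continuous_on_subset[OF ca]) (use r1 in auto)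
    show "continuous_on {p..q} (\<lambda>r. h r * a' r + h' r * a r)"
      by (intro continuous_intros cont ch' ca0)
    show "continuous_on {p..q} (\<lambda>r. G r + r * w)" by (intro continuous_intros cont)
    fix r assume r: "r \<in> {p..q}"
    show "((\<lambda>r. h r * a r) has_vector_derivative h r * a' r + h' r * a r) (at r)"
      by (intro has_vector_derivative_mult dh da r r1)
    have ar: "norm (a r) \<le> D" "norm (a' r) \<le> 2 * D / R"
      using ba[OF r1[OF r]] ba'[OF r1[OF r]] bD[OF r] by linarith+
    have "norm (h r * a r) \<le> H * D"
      unfolding norm_mult using bh[OF r] ar H_nonneg by (intro mult_mono) auto
    also have "\<dots> \<le> 3 * H * D" using H_nonneg D0 by simp
    finally show "norm (h r * a r) \<le> 3 * H * D" .
    have "norm (h r * a' r) \<le> H * (2 * D / R)" "norm (h' r * a r) \<le> H / R * D"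
      unfolding norm_mult
      by (intro mult_mono bh[OF r] bh'[OF r] ar H_nonneg norm_ge_zero divide_nonneg_pos R)+
    then have "norm (h r * a' r + h' r * a r) \<le> H * (2 * D / R) + H / R * D"
      by (intro order_trans[OF norm_triangle_ineq] add_mono)
    then show "norm (h r * a' r + h' r * a r) \<le> 3 * H * D / R" by (simp add: mult_ac add_divide_distrib[symmetric])
    show "norm (integral {p..r} (\<lambda>r. cis (G r + r * w))) \<le> 16 / sqrt A"
      by (rule van_der_corput_second[where \<psi>' = "\<lambda>r. G1 r + w" and \<psi>'' = G2])
        (use r \<open>A > 0\<close> A linear_phase in \<open>auto intro: continuous_on_subset[OF cG2]\<close>)
  qed
  have ca: "continuous_on {p..q} \<alpha>" "continuous_on {p..q} \<beta>"
    using d r1 has_vector_derivative_continuous by (meson continuous_at_imp_continuous_on)+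
  have "J = integral {p..q} (\<lambda>r. (h r * \<alpha> r) * cis (G r + r * n) + (h r * \<beta> r) * cis (G r + r * (- n)))"
  proof (rule integral_cong)
    fix r assume r: "r \<in> {p..q}"
    show "h r * cis (G r) * circle_moment x 0 r
      = (h r * \<alpha> r) * cis (G r + r * n) + (h r * \<beta> r) * cis (G r + r * (- n))"
      unfolding F[OF r1[OF r]] cis_mult[symmetric] by (simp add: algebra_simps)
  qed
  also have "\<dots> = integral {p..q} (\<lambda>r. (h r * \<alpha> r) * cis (G r + r * n))
      + integral {p..q} (\<lambda>r. (h r * \<beta> r) * cis (G r + r * (- n)))"
    by (intro Henstock_Kurzweil_Integration.integral_add integrable_continuous_interval continuous_intros cont ca)
  also have "norm \<dots> \<le> 5 / 2 * (16 / sqrt A) * (3 * H * D) + 5 / 2 * (16 / sqrt A) * (3 * H * D)"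
    by (intro order_trans[OF norm_triangle_ineq] add_mono piece[OF d(1) c(1) b(1) b'(1)] piece[OF d(2) c(2) b(2) b'(2)])
  also have "\<dots> = 1920 * pi * H / sqrt (A * (n * R))"
    unfolding D_def by (simp add: real_sqrt_mult mult_ac)
  finally show ?thesis unfolding n_def .
qed

text \<open>sqrt (R/B) is the geometric mean of the trivial size R and the gain 1/B, hence it
  dominates the smaller of them. This settles |x| <= B/2, and also all x when B R <= 1. For |x| >
  B/2 the decay sqrt (R/|x|) alone suffices.\<close>

lemma J_nonstationary:
  assumes "B > 0" and B: "\<And>r. r \<in> {p..q} \<Longrightarrow> \<bar>G1 r\<bar> \<ge> B"
    and sgn: "(\<forall>r\<in>{p..q}. G2 r \<ge> 0) \<or> (\<forall>r\<in>{p..q}. G2 r \<le> 0)"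
  shows "norm J \<le> 48 * pi * H * sqrt (R / B)"
proof -
  have pH: "pi * H \<ge> 0" using H_nonneg by simp
  consider "B * R \<le> 1" | "B * R \<ge> 1" "norm x \<le> B / 2" | "norm x > B / 2" by linarith
  then show ?thesis
  proof cases
    case 1
    have "R * R \<le> R / B" using 1 \<open>B > 0\<close> R by (simp add: field_simps)
    then have "R \<le> sqrt (R / B)" using R by (intro real_le_rsqrt) (simp add: power2_eq_square)
    then have "3 * (pi * H) * R \<le> 48 * (pi * H) * sqrt (R / B)" using pH R H_nonneg by (intro mult_mono) auto
    then show ?thesis using J_trivial by (simp add: mult_ac)
  next
    case 2
    have "1 / B * (1 / B) \<le> R / B" using 2 \<open>B > 0\<close> R by (simp add: field_simps)
    then have "1 / B \<le> sqrt (R / B)" by (intro real_le_rsqrt) (simp add: power2_eq_square)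
    then have "40 * (pi * H) * (1 / B) \<le> 48 * (pi * H) * sqrt (R / B)"
      using pH \<open>B > 0\<close> H_nonneg by (intro mult_mono) auto
    then show ?thesis using J_first_derivative[OF assms 2(2)] by (simp add: mult_ac)
  next
    case 3
    then have x: "x \<noteq> 0" "norm x > 0" using \<open>B > 0\<close> by auto
    have "R / norm x \<le> 4 * (R / B)" using 3 \<open>B > 0\<close> R x by (simp add: field_simps)
    then have "sqrt (R / norm x) \<le> sqrt (4 * (R / B))" by simp
    also have "\<dots> = 2 * sqrt (R / B)" by (simp only: real_sqrt_mult real_sqrt_four)
    finally have "24 * (pi * H) * sqrt (R / norm x) \<le> 24 * (pi * H) * (2 * sqrt (R / B))"
      using pH by (intro mult_left_mono) auto
    then show ?thesis using J_decay[OF x(1)] by (simp add: mult_ac)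
  qed
qed

text \<open>The term 1/B covers B R <= 4, by the trivial bound, and |x| <= B/2, by the
  first-derivative test. In the remaining case |x| > B/2 >= 2/R, which is where the threshold 4
  comes from; the combined estimate applies and |x| may be replaced by B at the cost of a factor
  2.\<close>

lemma J_nonstationary_curved:
  assumes "B > 0" and B: "\<And>r. r \<in> {p..q} \<Longrightarrow> \<bar>G1 r\<bar> \<ge> B"
    and "A > 0" and A: "\<And>r. r \<in> {p..q} \<Longrightarrow> \<bar>G2 r\<bar> \<ge> A"
  shows "norm J \<le> 3840 * pi * H * (1 / B + 1 / sqrt (A * B * R))"
proof -
  have pH: "pi * H \<ge> 0" using H_nonneg by simp
  have nn: "0 \<le> 1 / sqrt (A * B * R)" "0 \<le> 1 / B" using \<open>A > 0\<close> \<open>B > 0\<close> R by auto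
  consider "B * R \<le> 4" | "norm x \<le> B / 2" | "B * R \<ge> 4" "norm x > B / 2" by linarith
  then show ?thesis
  proof cases
    case 1
    then have "R \<le> 4 * (1 / B)" using \<open>B > 0\<close> by (simp add: field_simps)
    then have "3 * (pi * H) * R \<le> 3 * (pi * H) * (4 * (1 / B))" using pH by (intro mult_left_mono) auto
    also have "\<dots> = 12 * (pi * H) * (1 / B)" by simp
    also have "\<dots> \<le> 3840 * (pi * H) * (1 / B + 1 / sqrt (A * B * R))"
      using pH nn H_nonneg by (intro mult_mono) auto
    finally show ?thesis using J_trivial by (simp add: mult_ac)
  next
    case 2
    have "G2 r \<noteq> 0" if "r \<in> {p..q}" for r using A[OF that] \<open>A > 0\<close> by auto
    then have sgn: "(\<forall>r\<in>{p..q}. G2 r \<ge> 0) \<or> (\<forall>r\<in>{p..q}. G2 r \<le> 0)"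
      using continuous_constant_sign[OF cG2] by auto
    have "40 * (pi * H) * (1 / B) \<le> 3840 * (pi * H) * (1 / B + 1 / sqrt (A * B * R))"
      using pH nn H_nonneg by (intro mult_mono) auto
    then show ?thesis using J_first_derivative[OF assms(1,2) sgn 2] by (simp add: mult_ac)
  next
    case 3
    then have x: "norm x > 0" using \<open>B > 0\<close> by auto
    have "2 / R \<le> B / 2" using 3 R by (simp add: field_simps)
    then have N: "norm x \<ge> 2 / R" using 3 by linarith
    have "A * R * B \<le> A * R * (2 * norm x)"
      using 3 \<open>A > 0\<close> R by (intro mult_left_mono) auto
    also have "\<dots> \<le> 4 * (A * (norm x * R))" using \<open>A > 0\<close> R x by simp
    finally have "sqrt (A * B * R) \<le> sqrt (4 * (A * (norm x * R)))" by (simp add: mult_ac)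
    also have "\<dots> = 2 * sqrt (A * (norm x * R))" by (simp only: real_sqrt_mult real_sqrt_four)
    finally have le: "sqrt (A * B * R) / 2 \<le> sqrt (A * (norm x * R))" by simp
    have "1 / sqrt (A * (norm x * R)) \<le> 1 / (sqrt (A * B * R) / 2)"
      using le \<open>A > 0\<close> \<open>B > 0\<close> R by (intro frac_le) auto
    also have "\<dots> = 2 * (1 / sqrt (A * B * R))" by simp
    also have "\<dots> \<le> 2 * (1 / B + 1 / sqrt (A * B * R))" using nn by simp
    finally have "1920 * (pi * H) * (1 / sqrt (A * (norm x * R)))
       \<le> 1920 * (pi * H) * (2 * (1 / B + 1 / sqrt (A * B * R)))"
      using pH by (intro mult_left_mono) auto
    then show ?thesis using J_decay_second_derivative[OF N \<open>A > 0\<close> A] by (simp add: mult_ac)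
  qed
qed

end

section \<open>Dyadic pieces of the oscillatory integral\<close>

text \<open>What P and Q_0 have in common, so that the estimates of dyadic pieces can be proved once
  for both. The support condition concerns y >= 0 because the cutoffs are evaluated at multiples of
  |\<xi>|.\<close>

definition C1_cutoff :: "(real \<Rightarrow> real) \<Rightarrow> bool" where
  "C1_cutoff P \<longleftrightarrow> (\<forall>y. P differentiable at y) \<and> continuous_on UNIV (deriv P) \<and>
     (\<forall>y\<ge>0. y \<notin> {1/2..2} \<longrightarrow> P y = 0)"

lemma smooth_real_C1:
  assumes "smooth_real f"
  shows "f differentiable at y" "continuous_on UNIV (deriv f)"
proof -
  have "(deriv ^^ 0) f differentiable at y" "\<forall>y. (deriv ^^ 1) f differentiable at y"
    using assms unfolding smooth_real_def by blast+
  then show "f differentiable at y" "continuous_on UNIV (deriv f)"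
    by (auto intro!: continuous_at_imp_continuous_on differentiable_imp_continuous_within)
qed

lemma differentiable_DERIV: "f differentiable at (y::real) \<Longrightarrow> (f has_real_derivative deriv f y) (at y)"
  by (simp add: DERIV_deriv_iff_real_differentiable)

lemma annular_cutoff_C1:
  assumes "annular_cutoff P"
  shows "C1_cutoff P"
proof -
  have "P y = 0" if "y \<ge> 0" "y \<notin> {1/2..2}" for y
  proof (rule ccontr)
    assume "P y \<noteq> 0"
    then have "y \<in> {-2..-1/2} \<union> {1/2..2}" using assms unfolding annular_cutoff_def by blast
    then show False using that by auto
  qed
  then show ?thesis
    using assms smooth_real_C1 unfolding C1_cutoff_def annular_cutoff_def by blast
qed

lemma LP_Q_scale: "LP_Q \<phi> k y = LP_Q \<phi> 0 (y / 2 powi k)"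
proof -
  have *: "(2::real) powi (- k - 1) = inverse (2 * 2 powi k)"
  proof -
    have "- k - 1 = - (1 + k)" by simp
    moreover have "(2::real) powi (1 + k) = 2 * 2 powi k"
      by (subst power_int_add) (simp_all only: power_int_1_right numeral_neq_zero not_False_eq_True simp_thms)
    ultimately show ?thesis by (simp only: power_int_minus)
  qed
  have "LP_Q \<phi> k y = \<phi> (y / 2 powi k / 2) - \<phi> (y / 2 powi k)"
  proof -
    have "inverse (2 * a) * y = y / a / 2" "inverse a * y = y / a" for a :: real
      by (simp_all only: divide_inverse inverse_mult_distrib mult_ac)
    then show ?thesis unfolding LP_Q_def * power_int_minus by (simp only:)
  qed
  also have "\<dots> = LP_Q \<phi> 0 (y / 2 powi k)" by (simp add: LP_Q_def mult.commute)
  finally show ?thesis .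
qed

text \<open>With z = y / 2^k the value is \<phi>(z/2) - \<phi>(z), and \<phi> is nonincreasing.
  Positivity makes the partial sums over k increase, which supplies the dominating function in
  \<open>LP_integral_bound\<close>.\<close>

lemma LP_Q_nonneg:
  assumes "LP_cutoff \<phi>" "y \<ge> 0"
  shows "LP_Q \<phi> k y \<ge> 0"
proof -
  define z where "z = y / 2 powi k"
  have z: "z \<ge> 0" using assms by (simp add: z_def)
  have "antimono_on {0..} \<phi>" using assms(1) by (simp add: LP_cutoff_def)
  then have "\<phi> (z / 2) \<ge> \<phi> z" using z unfolding monotone_on_def by auto
  moreover have "LP_Q \<phi> k y = \<phi> (z / 2) - \<phi> z" unfolding LP_Q_scale[of \<phi> k] z_def by (simp add: LP_Q_def mult_ac)
  ultimately show ?thesis by simp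
qed

text \<open>Below 1/2 both y and y/2 lie where \<phi> = 1, and above 2 both lie beyond 4/5, so the
  difference vanishes outside {1/2..2}.\<close>

lemma LP_Q_C1_cutoff:
  assumes "LP_cutoff \<phi>"
  shows "C1_cutoff (LP_Q \<phi> 0)"
proof -
  have sm: "smooth_real \<phi>" using assms by (simp add: LP_cutoff_def)
  have eq: "LP_Q \<phi> 0 = (\<lambda>y. \<phi> (y / 2) - \<phi> y)" by (auto simp: LP_Q_def)
  have d: "((\<lambda>y. \<phi> (y / 2) - \<phi> y) has_real_derivative deriv \<phi> (y / 2) / 2 - deriv \<phi> y) (at y)" for y
  proof -
    note D = differentiable_DERIV[OF smooth_real_C1(1)[OF sm]]
    have "((\<lambda>y. \<phi> (y / 2)) has_real_derivative deriv \<phi> (y / 2) * (1 / 2)) (at y)"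
      by (rule DERIV_chain2[OF D]) (auto intro!: derivative_eq_intros)
    from DERIV_diff[OF this D] show ?thesis by simp
  qed
  have dd: "deriv (LP_Q \<phi> 0) = (\<lambda>y. deriv \<phi> (y / 2) / 2 - deriv \<phi> y)"
    unfolding eq using d by (intro ext DERIV_imp_deriv)
  have "continuous_on UNIV (deriv (LP_Q \<phi> 0))"
    unfolding dd
    by (intro continuous_intros continuous_on_compose2[OF smooth_real_C1(2)[OF sm]]) auto
  moreover have "LP_Q \<phi> 0 differentiable at y" for y
    unfolding eq using d real_differentiable_def by blast
  moreover have "LP_Q \<phi> 0 y = 0" if "y \<ge> 0" "y \<notin> {1/2..2}" for y
  proof -
    have "y < 1/2 \<or> y > 2" using that(2) by auto
    then show ?thesis
    proof
      assume "y < 1/2"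
      then have "y / 2 \<in> {-3/5..3/5}" "y \<in> {-3/5..3/5}" using that by auto
      then have "\<phi> (y / 2) = 1" "\<phi> y = 1" using assms unfolding LP_cutoff_def by blast+
      then show ?thesis by (simp add: eq)
    next
      assume "y > 2"
      then have "y / 2 \<notin> {-4/5..4/5}" "y \<notin> {-4/5..4/5}" by auto
      then have "\<phi> (y / 2) = 0" "\<phi> y = 0" using assms unfolding LP_cutoff_def by blast+
      then show ?thesis by (simp add: eq)
    qed
  qed
  ultimately show ?thesis unfolding C1_cutoff_def by blast
qed

section \<open>Radial amplitudes and their scaling\<close>

lemma powr_dyadic_bounds:
  fixes R r e :: real
  assumes "R > 0" "r \<in> {R / 2..2 * R}"
  shows "r powr e \<le> 2 powr \<bar>e\<bar> * R powr e" "r powr e \<ge> 2 powr (- \<bar>e\<bar>) * R powr e"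
proof -
  have r: "r > 0" using assms by auto
  have l: "\<bar>ln r - ln R\<bar> \<le> ln 2"
  proof -
    have "ln (R / 2) \<le> ln r" "ln r \<le> ln (2 * R)" using assms r by auto
    then show ?thesis using assms by (simp add: ln_mult ln_div abs_le_iff)
  qed
  have "\<bar>e * (ln r - ln R)\<bar> \<le> \<bar>e\<bar> * ln 2" using l by (simp add: abs_mult mult_left_mono)
  then have "e * ln r \<le> \<bar>e\<bar> * ln 2 + e * ln R" "e * ln r \<ge> - \<bar>e\<bar> * ln 2 + e * ln R"
    by (auto simp: abs_le_iff algebra_simps)
  then show "r powr e \<le> 2 powr \<bar>e\<bar> * R powr e" "r powr e \<ge> 2 powr (- \<bar>e\<bar>) * R powr e"
    using r assms by (auto simp: powr_def exp_add[symmetric])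
qed

text \<open>The exponent s + 1 collects |\<xi>|^s and the polar Jacobian r.\<close>

definition radial_amplitude :: "(real \<Rightarrow> real) \<Rightarrow> real \<Rightarrow> real \<Rightarrow> real \<Rightarrow> real" where
  "radial_amplitude P s R r = P (r / R) * r powr (s + 1)"

definition radial_amplitude' :: "(real \<Rightarrow> real) \<Rightarrow> real \<Rightarrow> real \<Rightarrow> real \<Rightarrow> real" where
  "radial_amplitude' P s R r = deriv P (r / R) / R * r powr (s + 1) + P (r / R) * ((s + 1) * r powr s)"

lemma radial_amplitude_derivative:
  assumes "C1_cutoff P" "R > 0" "r > 0"
  shows "(radial_amplitude P s R has_real_derivative radial_amplitude' P s R r) (at r)"
proof -
  have "(P has_real_derivative deriv P (r / R)) (at (r / R))"
    using assms by (intro differentiable_DERIV) (simp add: C1_cutoff_def)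
  then have "((\<lambda>r. P (r / R)) has_real_derivative deriv P (r / R) * (1 / R)) (at r)"
    by (rule DERIV_chain2) (use \<open>R > 0\<close> in \<open>auto intro!: derivative_eq_intros\<close>)
  moreover have "((\<lambda>r. r powr (s + 1)) has_real_derivative (s + 1) * r powr s) (at r)"
    using has_real_derivative_powr[OF assms(3), of "s + 1"] by simp
  ultimately have "((\<lambda>r. P (r / R) * r powr (s + 1)) has_real_derivative
      deriv P (r / R) * (1 / R) * r powr (s + 1) + (s + 1) * r powr s * P (r / R)) (at r)"
    by (rule DERIV_mult)
  then show ?thesis
    unfolding radial_amplitude_def[abs_def] radial_amplitude'_def by (simp add: mult_ac)
qed

text \<open>The cutoff depends on r/R only and r is comparable to R, so a derivative costs 1/R and
  \<open>K\<close> depends on P and s alone. This is one source of the uniformity in k and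
  \<delta>.\<close>

lemma radial_amplitude_bounds:
  assumes "C1_cutoff P"
  obtains K where "K > 0"
    and "\<And>R r. R > 0 \<Longrightarrow> r \<in> {R / 2..2 * R} \<Longrightarrow> \<bar>radial_amplitude P s R r\<bar> \<le> K * R powr (s + 1)"
    and "\<And>R r. R > 0 \<Longrightarrow> r \<in> {R / 2..2 * R} \<Longrightarrow> \<bar>radial_amplitude' P s R r\<bar> \<le> K * R powr (s + 1) / R"
proof -
  have bdd: "\<exists>M. \<forall>y\<in>{1/2..2}. \<bar>f y\<bar> \<le> M" if "continuous_on UNIV f" for f :: "real \<Rightarrow> real"
  proof -
    have "bounded (f ` {1/2..2})"
      by (intro compact_imp_bounded compact_continuous_image continuous_on_subset[OF that]) auto
    then show ?thesis by (auto simp: bounded_iff)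
  qed
  have "continuous_on UNIV P"
    using assms by (auto simp: C1_cutoff_def intro!: continuous_at_imp_continuous_on differentiable_imp_continuous_within)
  from bdd[OF this] obtain M0 where M0: "\<And>y. y \<in> {1/2..2} \<Longrightarrow> \<bar>P y\<bar> \<le> M0" by blast
  have "continuous_on UNIV (deriv P)" using assms by (simp add: C1_cutoff_def)
  from bdd[OF this] obtain M1 where M1: "\<And>y. y \<in> {1/2..2} \<Longrightarrow> \<bar>deriv P y\<bar> \<le> M1" by blast
  have M: "M0 \<ge> 0" "M1 \<ge> 0" using M0[of 1] M1[of 1] by auto
  define K0 where "K0 = M0 * 2 powr \<bar>s + 1\<bar>"
  define K1 where "K1 = M1 * 2 powr \<bar>s + 1\<bar> + M0 * (\<bar>s + 1\<bar> * 2 powr \<bar>s\<bar>)"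
  have K: "K0 \<ge> 0" "K1 \<ge> 0" using M by (auto simp: K0_def K1_def)
  show ?thesis
  proof (rule that[of "1 + K0 + K1"])
    show "0 < 1 + K0 + K1" using K by simp
    fix R r :: real assume R: "R > 0" and r: "r \<in> {R / 2..2 * R}"
    have rR: "r / R \<in> {1/2..2}" using R r by (auto simp: field_simps)
    have p: "r powr (s + 1) \<le> 2 powr \<bar>s + 1\<bar> * R powr (s + 1)" "r powr s \<le> 2 powr \<bar>s\<bar> * R powr s"
      using powr_dyadic_bounds[OF R r] by auto
    have Rs: "R powr s = R powr (s + 1) / R" using R by (simp add: powr_add)
    have "\<bar>radial_amplitude P s R r\<bar> \<le> M0 * (2 powr \<bar>s + 1\<bar> * R powr (s + 1))"
      unfolding radial_amplitude_def abs_mult using M0[OF rR] p M by (intro mult_mono) auto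
    also have "\<dots> = K0 * R powr (s + 1)" by (simp add: K0_def)
    also have "\<dots> \<le> (1 + K0 + K1) * R powr (s + 1)" using K by (intro mult_right_mono) auto
    finally show "\<bar>radial_amplitude P s R r\<bar> \<le> (1 + K0 + K1) * R powr (s + 1)" .
    have "\<bar>radial_amplitude' P s R r\<bar> \<le> \<bar>deriv P (r / R) / R * r powr (s + 1)\<bar> + \<bar>P (r / R) * ((s + 1) * r powr s)\<bar>"
      unfolding radial_amplitude'_def by (rule abs_triangle_ineq)
    also have "\<dots> \<le> M1 / R * (2 powr \<bar>s + 1\<bar> * R powr (s + 1)) + M0 * (\<bar>s + 1\<bar> * (2 powr \<bar>s\<bar> * R powr s))"
      unfolding abs_mult using M0[OF rR] M1[OF rR] p M R
      by (intro add_mono mult_mono) (auto simp: divide_right_mono)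
    also have "\<dots> = K1 * R powr (s + 1) / R"
      unfolding Rs K1_def using R by (simp add: field_simps)
    also have "\<dots> \<le> (1 + K0 + K1) * R powr (s + 1) / R"
      using K R by (intro divide_right_mono mult_right_mono) auto
    finally show "\<bar>radial_amplitude' P s R r\<bar> \<le> (1 + K0 + K1) * R powr (s + 1) / R" .
  qed
qed

section \<open>The phase and the passage to polar coordinates\<close>

lemma C2_on_pos_derivs:
  assumes "C2_on_pos g" "y > 0"
  shows "(g has_real_derivative deriv g y) (at y)"
    and "(deriv g has_real_derivative deriv (deriv g) y) (at y)"
proof -
  have "f differentiable at y" if "f differentiable_on {0<..}" for f :: "real \<Rightarrow> real"
    using that \<open>y > 0\<close> by (simp add: differentiable_on_eq_differentiable_at)
  then show "(g has_real_derivative deriv g y) (at y)"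
    "(deriv g has_real_derivative deriv (deriv g) y) (at y)"
    using assms unfolding C2_on_pos_def by (auto intro: differentiable_DERIV)
qed

lemma C2_on_pos_continuous:
  assumes "C2_on_pos g"
  shows "continuous_on {0<..} g" "continuous_on {0<..} (deriv g)" "continuous_on {0<..} (deriv (deriv g))"
  using assms unfolding C2_on_pos_def by (auto intro: differentiable_imp_continuous_on)

lemma osc_polar:
  assumes g: "C2_on_pos g" and P: "C1_cutoff P" and "\<delta> > 0" "S > 0"
  defines "R \<equiv> S / \<delta>"
  shows "integrable lborel (osc_integrand g s t \<delta> (\<lambda>y. P (y / S)) x)"
    and "osc_integral g s t \<delta> (\<lambda>y. P (y / S)) x =
      integral {R/2..2*R} (\<lambda>r. of_real (radial_amplitude P s R r) * cis (t / \<delta> * g (\<delta> * r)) * circle_moment x 0 r)"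
proof -
  have R: "R > 0" using assms by simp
  define f where "f r = cis (t / \<delta> * g (\<delta> * r)) * of_real (P (r / R)) * of_real (r powr s)" for r
  have cP: "continuous_on UNIV P"
    using P by (auto simp: C1_cutoff_def intro!: continuous_at_imp_continuous_on differentiable_imp_continuous_within)
  have cf: "continuous_on {R/2..2*R} f"
  proof -
    have "(\<lambda>r. \<delta> * r) ` {R/2..2*R} \<subseteq> {0<..}" "\<And>r. r \<in> {R/2..2*R} \<Longrightarrow> r \<noteq> 0"
      using R \<open>\<delta> > 0\<close> by (force intro!: mult_pos_pos)+
    then show ?thesis
      unfolding f_def using R
      by (intro continuous_intros continuous_on_compose2[OF C2_on_pos_continuous(1)[OF g]] continuous_on_compose2[OF cP]) auto
  qed
  have f0: "f r = 0" if "r \<ge> 0" "r \<notin> {R/2..2*R}" for r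
  proof -
    have "r / R \<ge> 0" "r / R \<notin> {1/2..2}" using that R by (auto simp: field_simps)
    then have "P (r / R) = 0" using P unfolding C1_cutoff_def by blast
    then show ?thesis by (simp add: f_def)
  qed
  have eq: "osc_integrand g s t \<delta> (\<lambda>y. P (y / S)) x = (\<lambda>\<xi>. cis (x \<bullet> \<xi>) * f (norm \<xi>))"
    using \<open>\<delta> > 0\<close> \<open>S > 0\<close>
    by (intro ext) (simp add: osc_integrand_def f_def cis_conv_exp R_def mult_ac)
  have R2: "0 < R / 2" using R by simp
  show "integrable lborel (osc_integrand g s t \<delta> (\<lambda>y. P (y / S)) x)"
    unfolding eq by (rule polar_integral[OF R2 cf f0])
  have "osc_integral g s t \<delta> (\<lambda>y. P (y / S)) x = integral {R/2..2*R} (\<lambda>r. of_real r * f r * circle_moment x 0 r)"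
    unfolding osc_integral_def eq by (rule polar_integral[OF R2 cf f0])
  also have "\<dots> = integral {R/2..2*R} (\<lambda>r. of_real (radial_amplitude P s R r) * cis (t / \<delta> * g (\<delta> * r)) * circle_moment x 0 r)"
  proof (rule integral_cong)
    fix r assume "r \<in> {R/2..2*R}"
    then have "r > 0" using R by auto
    then have "r * r powr s = r powr (s + 1)" by (simp add: powr_add)
    then have "complex_of_real (r powr (s + 1)) = of_real r * of_real (r powr s)" by (metis of_real_mult)
    then show "of_real r * f r * circle_moment x 0 r =
      of_real (radial_amplitude P s R r) * cis (t / \<delta> * g (\<delta> * r)) * circle_moment x 0 r"
      by (simp add: f_def radial_amplitude_def)
  qed
  finally show "osc_integral g s t \<delta> (\<lambda>y. P (y / S)) x =
      integral {R/2..2*R} (\<lambda>r. of_real (radial_amplitude P s R r) * cis (t / \<delta> * g (\<delta> * r)) * circle_moment x 0 r)" .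
qed

text \<open>Fixes the constant of \<open>radial_amplitude_bounds\<close>, so that the bounds proved
  inside are explicit in \<open>K\<close>. The locale is used with P and with Q_0 as cutoff.\<close>

locale oscillatory =
  fixes g P :: "real \<Rightarrow> real" and s K :: real
  assumes g: "C2_on_pos g" and P: "C1_cutoff P" and K: "K > 0"
    and K_amp: "\<And>R r. R > 0 \<Longrightarrow> r \<in> {R / 2..2 * R} \<Longrightarrow> \<bar>radial_amplitude P s R r\<bar> \<le> K * R powr (s + 1)"
    and K_amp': "\<And>R r. R > 0 \<Longrightarrow> r \<in> {R / 2..2 * R} \<Longrightarrow> \<bar>radial_amplitude' P s R r\<bar> \<le> K * R powr (s + 1) / R"
begin

lemma radial_piece:
  assumes "\<delta> > 0" "S > 0" "S / \<delta> / 2 \<le> p" "p \<le> q" "q \<le> 2 * (S / \<delta>)"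
  shows "radial_piece p q (S / \<delta>) (K * (S / \<delta>) powr (s + 1)) (\<lambda>r. t / \<delta> * g (\<delta> * r))
     (\<lambda>r. t * deriv g (\<delta> * r)) (\<lambda>r. t * \<delta> * deriv (deriv g) (\<delta> * r))
     (\<lambda>r. of_real (radial_amplitude P s (S / \<delta>) r)) (\<lambda>r. of_real (radial_amplitude' P s (S / \<delta>) r))"
proof
  define R where "R = S / \<delta>"
  have R: "R > 0" using assms by (simp add: R_def)
  show "S / \<delta> > 0" using assms by simp
  show "S / \<delta> / 2 \<le> p" "p \<le> q" "q \<le> 2 * (S / \<delta>)" by (fact assms)+
  have in0: "r \<in> {R / 2..2 * R}" "r > 0" "\<delta> * r > 0" if "r \<in> {p..q}" for r
    using that assms R by (auto simp: R_def[symmetric])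
  show "continuous_on {p..q} (\<lambda>r. t * \<delta> * deriv (deriv g) (\<delta> * r))"
    using in0 by (intro continuous_intros continuous_on_compose2[OF C2_on_pos_continuous(3)[OF g]]) auto
  have cP: "continuous_on UNIV P" "continuous_on UNIV (deriv P)"
    using P by (auto simp: C1_cutoff_def intro!: continuous_at_imp_continuous_on differentiable_imp_continuous_within)
  have "r \<noteq> 0" if "r \<in> {p..q}" for r using in0(2)[OF that] by simp
  then have "continuous_on {p..q} (radial_amplitude' P s R)"
    unfolding radial_amplitude'_def using R
    by (intro continuous_intros continuous_on_compose2[OF cP(1)] continuous_on_compose2[OF cP(2)]) auto
  then show "continuous_on {p..q} (\<lambda>r. complex_of_real (radial_amplitude' P s (S / \<delta>) r))"
    unfolding R_def[symmetric] by (intro continuous_intros)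
  fix r assume r: "r \<in> {p..q}"
  have m: "((\<lambda>r. \<delta> * r) has_real_derivative \<delta>) (at r)" by (auto intro!: derivative_eq_intros)
  show "((\<lambda>r. t / \<delta> * g (\<delta> * r)) has_real_derivative t * deriv g (\<delta> * r)) (at r)"
    using DERIV_cmult[OF DERIV_chain2[OF C2_on_pos_derivs(1)[OF g in0(3)[OF r]] m], of "t / \<delta>"] \<open>\<delta> > 0\<close>
    by (simp add: mult_ac)
  show "((\<lambda>r. t * deriv g (\<delta> * r)) has_real_derivative t * \<delta> * deriv (deriv g) (\<delta> * r)) (at r)"
    using DERIV_cmult[OF DERIV_chain2[OF C2_on_pos_derivs(2)[OF g in0(3)[OF r]] m], of t]
    by (simp add: mult_ac)
  show "((\<lambda>r. complex_of_real (radial_amplitude P s (S / \<delta>) r)) has_vector_derivative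
      of_real (radial_amplitude' P s (S / \<delta>) r)) (at r)"
    using radial_amplitude_derivative[OF P R in0(2)[OF r]] unfolding R_def[symmetric]
    by (rule has_vector_derivative_of_real)
  show "norm (complex_of_real (radial_amplitude P s (S / \<delta>) r)) \<le> K * (S / \<delta>) powr (s + 1)"
    "norm (complex_of_real (radial_amplitude' P s (S / \<delta>) r)) \<le> K * (S / \<delta>) powr (s + 1) / (S / \<delta>)"
    using K_amp[OF R in0(1)[OF r]] K_amp'[OF R in0(1)[OF r]] by (simp_all add: R_def)
qed

text \<open>
  The pieces are cut at the points of \<open>Z\<close> in the variable \<open>y = \<delta>r\<close>, so that their number does
  not depend on \<open>\<delta>\<close> and \<open>t\<close>.
\<close>

lemma osc_integral_split:
  assumes "\<delta> > 0" "S > 0" "finite Z"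
    and M: "\<And>p q. \<lbrakk>S / \<delta> / 2 \<le> p; p \<le> q; q \<le> 2 * (S / \<delta>); Z \<inter> {\<delta> * p<..<\<delta> * q} = {}\<rbrakk> \<Longrightarrow>
       norm (integral {p..q} (\<lambda>r. of_real (radial_amplitude P s (S / \<delta>) r) * cis (t / \<delta> * g (\<delta> * r)) * circle_moment x 0 r)) \<le> M"
  shows "norm (osc_integral g s t \<delta> (\<lambda>y. P (y / S)) x) \<le> 2 ^ card Z * M"
proof -
  have R: "S / \<delta> / 2 \<le> 2 * (S / \<delta>)" using assms by (simp add: field_simps)
  interpret radial_piece "S / \<delta> / 2" "2 * (S / \<delta>)" "S / \<delta>" "K * (S / \<delta>) powr (s + 1)" "\<lambda>r. t / \<delta> * g (\<delta> * r)"
     "\<lambda>r. t * deriv g (\<delta> * r)" "\<lambda>r. t * \<delta> * deriv (deriv g) (\<delta> * r)"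
     "\<lambda>r. of_real (radial_amplitude P s (S / \<delta>) r)" "\<lambda>r. of_real (radial_amplitude' P s (S / \<delta>) r)" x
    by (rule radial_piece[OF assms(1,2) order_refl R order_refl])
  have "norm J \<le> 2 ^ card ((\<lambda>z. z / \<delta>) ` Z) * M"
  proof (rule norm_integral_split_finite)
    show "(\<lambda>r. of_real (radial_amplitude P s (S / \<delta>) r) * cis (t / \<delta> * g (\<delta> * r)) * circle_moment x 0 r)
        integrable_on {S / \<delta> / 2..2 * (S / \<delta>)}"
      by (intro integrable_continuous_interval continuous_intros cont)
    fix p q assume *: "S / \<delta> / 2 \<le> p" "p \<le> q" "q \<le> 2 * (S / \<delta>)" "(\<lambda>z. z / \<delta>) ` Z \<inter> {p<..<q} = {}"
    have "Z \<inter> {\<delta> * p<..<\<delta> * q} = {}"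
    proof (rule ccontr)
      assume "\<not> ?thesis"
      then obtain z where "z \<in> Z" "\<delta> * p < z" "z < \<delta> * q" by auto
      then have "z / \<delta> \<in> {p<..<q}" using \<open>\<delta> > 0\<close> by (simp add: field_simps)
      then show False using * \<open>z \<in> Z\<close> by blast
    qed
    with * show "norm (integral {p..q} (\<lambda>r. of_real (radial_amplitude P s (S / \<delta>) r) * cis (t / \<delta> * g (\<delta> * r)) * circle_moment x 0 r)) \<le> M"
      by (intro M)
  qed (use assms R in auto)
  moreover have "card ((\<lambda>z. z / \<delta>) ` Z) = card Z"
    using \<open>\<delta> > 0\<close> by (intro card_image) (auto simp: inj_on_def)
  ultimately show ?thesis using osc_polar(2)[OF g P assms(1,2)] by simp
qed

lemma osc_trivial:
  assumes "\<delta> > 0" "S > 0"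
  shows "norm (osc_integral g s t \<delta> (\<lambda>y. P (y / S)) x) \<le> 3 * pi * K * (S / \<delta>) powr (s + 2)"
proof -
  have "norm (osc_integral g s t \<delta> (\<lambda>y. P (y / S)) x) \<le> 2 ^ card ({}::real set) * (3 * pi * (S / \<delta>) * (K * (S / \<delta>) powr (s + 1)))"
  proof (rule osc_integral_split[OF assms finite.emptyI])
    fix p q assume pq: "S / \<delta> / 2 \<le> p" "p \<le> q" "q \<le> 2 * (S / \<delta>)"
    show "norm (integral {p..q} (\<lambda>r. of_real (radial_amplitude P s (S / \<delta>) r) * cis (t / \<delta> * g (\<delta> * r)) * circle_moment x 0 r))
        \<le> 3 * pi * (S / \<delta>) * (K * (S / \<delta>) powr (s + 1))"
      by (rule radial_piece.J_trivial[OF radial_piece[OF assms pq]])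
  qed
  also have "\<dots> = 3 * pi * K * ((S / \<delta>) * (S / \<delta>) powr (s + 1))" by simp
  also have "(S / \<delta>) * (S / \<delta>) powr (s + 1) = (S / \<delta>) powr (s + 2)"
    using assms powr_add[of "S / \<delta>" "s + 1" 1] by (simp add: add.commute)
  finally show ?thesis .
qed

text \<open>The derivative of the phase in r is t g'(\<delta> r), so \<open>J_nonstationary\<close>
  applies with B = |t| b. Since g'' has no zero in the open interval, it keeps one sign up to the
  endpoints.\<close>

lemma piece_nonstationary:
  assumes "\<delta> > 0" "S > 0" "S / \<delta> / 2 \<le> p" "p \<le> q" "q \<le> 2 * (S / \<delta>)" "t \<noteq> 0" "b > 0"
    and b: "\<And>y. y \<in> {\<delta> * p..\<delta> * q} \<Longrightarrow> \<bar>deriv g y\<bar> \<ge> b"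
    and nz: "\<And>y. y \<in> {\<delta> * p<..<\<delta> * q} \<Longrightarrow> deriv (deriv g) y \<noteq> 0"
  shows "norm (integral {p..q} (\<lambda>r. of_real (radial_amplitude P s (S / \<delta>) r) * cis (t / \<delta> * g (\<delta> * r)) * circle_moment x 0 r))
    \<le> 48 * pi * (K * (S / \<delta>) powr (s + 1)) * sqrt (S / \<delta> / (\<bar>t\<bar> * b))"
proof -
  interpret radial_piece p q "S / \<delta>" "K * (S / \<delta>) powr (s + 1)" "\<lambda>r. t / \<delta> * g (\<delta> * r)"
     "\<lambda>r. t * deriv g (\<delta> * r)" "\<lambda>r. t * \<delta> * deriv (deriv g) (\<delta> * r)"
     "\<lambda>r. of_real (radial_amplitude P s (S / \<delta>) r)" "\<lambda>r. of_real (radial_amplitude' P s (S / \<delta>) r)" x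
    by (rule radial_piece[OF assms(1-5)])
  have im: "\<delta> * r \<in> {\<delta> * p..\<delta> * q}" if "r \<in> {p..q}" for r using that \<open>\<delta> > 0\<close> by auto
  show ?thesis
  proof (rule J_nonstationary)
    show "\<bar>t\<bar> * b > 0" using assms by simp
    show "\<bar>t\<bar> * b \<le> \<bar>t * deriv g (\<delta> * r)\<bar>" if "r \<in> {p..q}" for r
      unfolding abs_mult using b[OF im[OF that]] by (intro mult_left_mono) auto
    show "(\<forall>r\<in>{p..q}. 0 \<le> t * \<delta> * deriv (deriv g) (\<delta> * r)) \<or> (\<forall>r\<in>{p..q}. t * \<delta> * deriv (deriv g) (\<delta> * r) \<le> 0)"
      by (rule continuous_constant_sign[OF cG2]) (use nz assms in auto)
  qed
qed

lemma piece_curved: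
  assumes "\<delta> > 0" "S > 0" "S / \<delta> / 2 \<le> p" "p \<le> q" "q \<le> 2 * (S / \<delta>)" "t \<noteq> 0" "b > 0"
    and b: "\<And>y. y \<in> {\<delta> * p..\<delta> * q} \<Longrightarrow> \<bar>deriv (deriv g) y\<bar> \<ge> b"
  shows "norm (integral {p..q} (\<lambda>r. of_real (radial_amplitude P s (S / \<delta>) r) * cis (t / \<delta> * g (\<delta> * r)) * circle_moment x 0 r))
    \<le> 80 * pi * (K * (S / \<delta>) powr (s + 1)) / sqrt (\<bar>t\<bar> * \<delta> * b)"
proof -
  interpret radial_piece p q "S / \<delta>" "K * (S / \<delta>) powr (s + 1)" "\<lambda>r. t / \<delta> * g (\<delta> * r)"
     "\<lambda>r. t * deriv g (\<delta> * r)" "\<lambda>r. t * \<delta> * deriv (deriv g) (\<delta> * r)"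
     "\<lambda>r. of_real (radial_amplitude P s (S / \<delta>) r)" "\<lambda>r. of_real (radial_amplitude' P s (S / \<delta>) r)" x
    by (rule radial_piece[OF assms(1-5)])
  have im: "\<delta> * r \<in> {\<delta> * p..\<delta> * q}" if "r \<in> {p..q}" for r using that \<open>\<delta> > 0\<close> by auto
  show ?thesis
  proof (rule J_second_derivative)
    show "\<bar>t\<bar> * \<delta> * b > 0" using assms by simp
    show "\<bar>t\<bar> * \<delta> * b \<le> \<bar>t * \<delta> * deriv (deriv g) (\<delta> * r)\<bar>" if "r \<in> {p..q}" for r
      unfolding abs_mult using b[OF im[OF that]] \<open>\<delta> > 0\<close> by (simp add: mult_left_mono)
  qed
qed

text \<open>With B = |t| b1, A = |t| \<delta> b2 and R = S/\<delta> the product A B R is t^2 b1 b2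
  S: \<delta> cancels, and both terms of \<open>J_nonstationary_curved\<close> gain a full power
  1/|t|.\<close>

lemma osc_nonstationary_curved:
  assumes "\<delta> > 0" "S > 0" "t \<noteq> 0" "b1 > 0" "b2 > 0"
    and b1: "\<And>y. y \<in> {S / 2..2 * S} \<Longrightarrow> \<bar>deriv g y\<bar> \<ge> b1"
    and b2: "\<And>y. y \<in> {S / 2..2 * S} \<Longrightarrow> \<bar>deriv (deriv g) y\<bar> \<ge> b2"
  shows "norm (osc_integral g s t \<delta> (\<lambda>y. P (y / S)) x)
    \<le> 3840 * pi * K * (S / \<delta>) powr (s + 1) / \<bar>t\<bar> * (1 / b1 + 1 / sqrt (b1 * b2 * S))"
proof -
  have R: "S / \<delta> / 2 \<le> 2 * (S / \<delta>)" using assms by (simp add: field_simps)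
  interpret radial_piece "S / \<delta> / 2" "2 * (S / \<delta>)" "S / \<delta>" "K * (S / \<delta>) powr (s + 1)" "\<lambda>r. t / \<delta> * g (\<delta> * r)"
     "\<lambda>r. t * deriv g (\<delta> * r)" "\<lambda>r. t * \<delta> * deriv (deriv g) (\<delta> * r)"
     "\<lambda>r. of_real (radial_amplitude P s (S / \<delta>) r)" "\<lambda>r. of_real (radial_amplitude' P s (S / \<delta>) r)" x
    by (rule radial_piece[OF assms(1,2) order_refl R order_refl])
  have im: "\<delta> * r \<in> {S / 2..2 * S}" if "r \<in> {S / \<delta> / 2..2 * (S / \<delta>)}" for r
    using that \<open>\<delta> > 0\<close> by (auto simp: field_simps)
  have "norm J \<le> 3840 * pi * (K * (S / \<delta>) powr (s + 1)) *
     (1 / (\<bar>t\<bar> * b1) + 1 / sqrt ((\<bar>t\<bar> * \<delta> * b2) * (\<bar>t\<bar> * b1) * (S / \<delta>)))"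
  proof (rule J_nonstationary_curved)
    show "\<bar>t\<bar> * b1 > 0" "\<bar>t\<bar> * \<delta> * b2 > 0" using assms by simp_all
    fix r assume r: "r \<in> {S / \<delta> / 2..2 * (S / \<delta>)}"
    show "\<bar>t\<bar> * b1 \<le> \<bar>t * deriv g (\<delta> * r)\<bar>"
      unfolding abs_mult using b1[OF im[OF r]] by (intro mult_left_mono) auto
    show "\<bar>t\<bar> * \<delta> * b2 \<le> \<bar>t * \<delta> * deriv (deriv g) (\<delta> * r)\<bar>"
      unfolding abs_mult using b2[OF im[OF r]] \<open>\<delta> > 0\<close> by (simp add: mult_left_mono)
  qed
  also have "(\<bar>t\<bar> * \<delta> * b2) * (\<bar>t\<bar> * b1) * (S / \<delta>) = \<bar>t\<bar>^2 * (b1 * b2 * S)"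
    using \<open>\<delta> > 0\<close> by (simp add: power2_eq_square)
  also have "sqrt (\<bar>t\<bar>^2 * (b1 * b2 * S)) = \<bar>t\<bar> * sqrt (b1 * b2 * S)"
    by (simp only: real_sqrt_mult real_sqrt_abs abs_idempotent)
  also have "3840 * pi * (K * (S / \<delta>) powr (s + 1)) * (1 / (\<bar>t\<bar> * b1) + 1 / (\<bar>t\<bar> * sqrt (b1 * b2 * S)))
    = 3840 * pi * K * (S / \<delta>) powr (s + 1) / \<bar>t\<bar> * (1 / b1 + 1 / sqrt (b1 * b2 * S))"
    by (simp add: distrib_left add_divide_distrib mult_ac)
  finally show ?thesis using osc_polar(2)[OF g P assms(1,2)] by simp
qed

end

section \<open>Littlewood--Paley sums\<close>

lemma two_powi_eq_exp: "(2::real) powi k = exp (of_int k * ln 2)"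
  using powr_real_of_int'[of 2 k] by (simp add: powr_def)

lemma sum_geometric_abs_le:
  fixes q :: real
  assumes "0 \<le> q" "q < 1" "finite F"
  shows "(\<Sum>j\<in>F. q ^ nat \<bar>j\<bar>) \<le> 2 / (1 - q)"
proof -
  have part: "(\<Sum>j\<in>G. q ^ nat \<bar>j\<bar>) \<le> 1 / (1 - q)" if "finite G" "inj_on (\<lambda>j. nat \<bar>j\<bar>) G" for G :: "int set"
  proof -
    have "(\<Sum>j\<in>G. q ^ nat \<bar>j\<bar>) = (\<Sum>n\<in>(\<lambda>j. nat \<bar>j\<bar>) ` G. q ^ n)"
      using that(2) by (simp add: sum.reindex)
    also have "\<dots> \<le> (\<Sum>n. q ^ n)"
      using assms that by (intro sum_le_suminf) (auto intro: summable_geometric)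
    also have "\<dots> = 1 / (1 - q)" using assms by (intro suminf_geometric) auto
    finally show ?thesis .
  qed
  have "(\<Sum>j\<in>F. q ^ nat \<bar>j\<bar>) = (\<Sum>j\<in>F \<inter> {0..}. q ^ nat \<bar>j\<bar>) + (\<Sum>j\<in>F - {0..}. q ^ nat \<bar>j\<bar>)"
    using assms(3) by (subst sum.Int_Diff[of F _ "{0..}"]) auto
  also have "\<dots> \<le> 1 / (1 - q) + 1 / (1 - q)"
    using assms(3) by (intro add_mono part) (auto simp: inj_on_def)
  finally show ?thesis by simp
qed

text \<open>In k the terms form a two-sided geometric progression of ratio exp (-|\<kappa>|) peaked
  at -v/\<kappa>. Moving the peak to the integer -m costs at most exp |\<kappa>|, so the bound is
  independent of v, which later carries t and \<delta>.\<close>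

lemma sum_exp_abs_affine_le:
  fixes \<kappa> :: real
  assumes "\<kappa> \<noteq> 0"
  obtains C where "C > 0" and "\<And>v F. finite F \<Longrightarrow> (\<Sum>k\<in>F. exp (- \<bar>v + \<kappa> * of_int k\<bar>)) \<le> C"
proof -
  define q where "q = exp (- \<bar>\<kappa>\<bar>)"
  have q: "0 \<le> q" "q < 1" using assms by (auto simp: q_def)
  show ?thesis
  proof (rule that[of "exp \<bar>\<kappa>\<bar> * (2 / (1 - q))"])
    show "0 < exp \<bar>\<kappa>\<bar> * (2 / (1 - q))" using q by simp
    fix v and F :: "int set" assume "finite F"
    define m where "m = round (v / \<kappa>)"
    have m: "\<bar>of_int m - v / \<kappa>\<bar> \<le> 1" unfolding m_def using of_int_round_abs_le[of "v / \<kappa>"] by linarith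
    have "exp (- \<bar>v + \<kappa> * of_int k\<bar>) \<le> exp \<bar>\<kappa>\<bar> * q ^ nat \<bar>m + k\<bar>" for k
    proof -
      have "v + \<kappa> * of_int k = \<kappa> * (v / \<kappa> + of_int k)" using assms by (simp add: field_simps)
      then have "\<bar>v + \<kappa> * of_int k\<bar> = \<bar>\<kappa>\<bar> * \<bar>v / \<kappa> + of_int k\<bar>" by (simp add: abs_mult)
      also have "\<dots> \<ge> \<bar>\<kappa>\<bar> * (\<bar>of_int (m + k)\<bar> - 1)"
        using m by (intro mult_left_mono) (simp, linarith)+
      finally have "- \<bar>v + \<kappa> * of_int k\<bar> \<le> \<bar>\<kappa>\<bar> + real (nat \<bar>m + k\<bar>) * (- \<bar>\<kappa>\<bar>)"
        by (simp add: algebra_simps)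
      then have "exp (- \<bar>v + \<kappa> * of_int k\<bar>) \<le> exp (\<bar>\<kappa>\<bar> + real (nat \<bar>m + k\<bar>) * (- \<bar>\<kappa>\<bar>))" by simp
      also have "\<dots> = exp \<bar>\<kappa>\<bar> * q ^ nat \<bar>m + k\<bar>"
        unfolding q_def exp_add exp_of_nat_mult by simp
      finally show ?thesis .
    qed
    then have "(\<Sum>k\<in>F. exp (- \<bar>v + \<kappa> * of_int k\<bar>)) \<le> (\<Sum>k\<in>F. exp \<bar>\<kappa>\<bar> * q ^ nat \<bar>m + k\<bar>)"
      by (intro sum_mono)
    also have "\<dots> = exp \<bar>\<kappa>\<bar> * (\<Sum>j\<in>(+) m ` F. q ^ nat \<bar>j\<bar>)"
      by (simp add: sum_distrib_left sum.reindex)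
    also have "\<dots> \<le> exp \<bar>\<kappa>\<bar> * (2 / (1 - q))"
      using \<open>finite F\<close> q by (intro mult_left_mono sum_geometric_abs_le) auto
    finally show "(\<Sum>k\<in>F. exp (- \<bar>v + \<kappa> * of_int k\<bar>)) \<le> exp \<bar>\<kappa>\<bar> * (2 / (1 - q))" .
  qed
qed

section \<open>Passing from dyadic bounds to infinite sums and Littlewood-Paley integrals\<close>

lemma sup_cmod_le: "(\<And>x. cmod (f x) \<le> M) \<Longrightarrow> sup_cmod f \<le> ennreal M"
  unfolding sup_cmod_def by (intro SUP_least ennreal_leI)

lemma infsum_ennreal_le:
  fixes f :: "'a \<Rightarrow> ennreal"
  assumes "\<And>k. k \<in> A \<Longrightarrow> f k \<le> ennreal (B k)" "\<And>k. B k \<ge> 0"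
    and "\<And>F. finite F \<Longrightarrow> F \<subseteq> A \<Longrightarrow> sum B F \<le> M"
  shows "(\<Sum>\<^sub>\<infinity>k\<in>A. f k) \<le> ennreal M"
proof -
  have "(\<Sum>\<^sub>\<infinity>k\<in>A. f k) = (SUP F\<in>{F. finite F \<and> F \<subseteq> A}. sum f F)"
    by (rule nonneg_infsum_complete) simp
  also have "\<dots> \<le> ennreal M"
  proof (rule SUP_least)
    fix F assume "F \<in> {F. finite F \<and> F \<subseteq> A}"
    then have F: "finite F" "F \<subseteq> A" by auto
    have "sum f F \<le> (\<Sum>k\<in>F. ennreal (B k))" using assms(1) F by (intro sum_mono) auto
    also have "\<dots> = ennreal (sum B F)" using assms(2) by (simp add: sum_ennreal)
    also have "\<dots> \<le> ennreal M" using assms(3)[OF F] by (rule ennreal_leI)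
    finally show "sum f F \<le> ennreal M" .
  qed
  finally show ?thesis .
qed

lemma finite_LP_Q_support:
  assumes "LP_cutoff \<phi>" "y \<ge> 0"
  shows "finite {k. LP_Q \<phi> k y \<noteq> 0}"
proof (cases "y = 0")
  case True
  then show ?thesis by (simp add: LP_Q_def)
next
  case False
  then have y: "y > 0" using assms by simp
  have "{k. LP_Q \<phi> k y \<noteq> 0} \<subseteq> {\<lfloor>ln (y / 2) / ln 2\<rfloor>..\<lceil>ln (2 * y) / ln 2\<rceil>}"
  proof
    fix k assume "k \<in> {k. LP_Q \<phi> k y \<noteq> 0}"
    then have nz: "LP_Q \<phi> 0 (y / 2 powi k) \<noteq> 0" using LP_Q_scale[of \<phi> k y] by simp
    have "y / 2 powi k \<in> {1/2..2}"
    proof (rule ccontr)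
      assume "y / 2 powi k \<notin> {1/2..2}"
      moreover have "y / 2 powi k \<ge> 0" using y by simp
      ultimately show False using nz LP_Q_C1_cutoff[OF assms(1)] unfolding C1_cutoff_def by blast
    qed
    then have "y / 2 \<le> exp (of_int k * ln 2)" "exp (of_int k * ln 2) \<le> 2 * y"
      by (auto simp: field_simps two_powi_eq_exp)
    then have "ln (y / 2) \<le> of_int k * ln 2" "of_int k * ln 2 \<le> ln (2 * y)"
      using y by (metis exp_ln_iff exp_le_cancel_iff half_gt_zero) (metis \<open>exp (of_int k * ln 2) \<le> 2 * y\<close> y exp_ln_iff exp_le_cancel_iff mult_pos_pos zero_less_numeral)
    then have "ln (y / 2) / ln 2 \<le> of_int k" "of_int k \<le> ln (2 * y) / ln 2"
      by (auto simp: field_simps)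
    then show "k \<in> {\<lfloor>ln (y / 2) / ln 2\<rfloor>..\<lceil>ln (2 * y) / ln 2\<rceil>}"
      by (auto simp: floor_le_iff le_ceiling_iff)
  qed
  then show ?thesis using finite_subset by blast
qed

text \<open>Only finitely many Q_k are nonzero at a given y, so the symmetric partial sums become
  stationary. They provide the sequence needed for dominated convergence.\<close>

lemma LP_sum_eventually:
  assumes "LP_cutoff \<phi>" "y \<ge> 0"
  shows "eventually (\<lambda>n. (\<Sum>k\<in>K \<inter> {- int n..int n}. LP_Q \<phi> k y) = LP_sum \<phi> K y) sequentially"
proof -
  define T where "T = K \<inter> {k. LP_Q \<phi> k y \<noteq> 0}"
  have T: "finite T" unfolding T_def using finite_LP_Q_support[OF assms] by blast
  have "LP_sum \<phi> K y = (\<Sum>\<^sub>\<infinity>k\<in>T. LP_Q \<phi> k y)"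
    unfolding LP_sum_def by (rule infsum_cong_neutral) (auto simp: T_def)
  then have eq: "LP_sum \<phi> K y = (\<Sum>k\<in>T. LP_Q \<phi> k y)" using T by simp
  obtain m where m: "\<And>k. k \<in> T \<Longrightarrow> nat \<bar>k\<bar> \<le> m"
    using finite_imageI[OF T, of "\<lambda>k. nat \<bar>k\<bar>"] by (auto simp: finite_nat_set_iff_bounded_le)
  show ?thesis unfolding eventually_sequentially
  proof (intro exI allI impI)
    fix n assume "m \<le> n"
    then have "T \<subseteq> K \<inter> {- int n..int n}" using m by (force simp: T_def)
    then show "(\<Sum>k\<in>K \<inter> {- int n..int n}. LP_Q \<phi> k y) = LP_sum \<phi> K y"
      unfolding eq by (intro sum.mono_neutral_right) (auto simp: T_def)
  qed
qed

text \<open>Bounded finite sums of \<open>B\<close> make the dyadic integrals absolutely summable,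
  which settles the reading as a sum over k. If the full integrand is integrable, its integral has
  to be recognised as the limit of partial sums of dyadic integrals; by positivity of the Q_k the
  full integrand dominates the partial sums.\<close>

lemma LP_integral_bound:
  assumes \<phi>: "LP_cutoff \<phi>" and g: "C2_on_pos g" and "\<delta> > 0"
    and B: "\<And>k. k \<in> K \<Longrightarrow> norm (osc_integral g s t \<delta> (\<lambda>y. LP_Q \<phi> 0 (y / 2 powi k)) x) \<le> B k"
    and M: "\<And>F. finite F \<Longrightarrow> F \<subseteq> K \<Longrightarrow> sum B F \<le> M"
  shows "LP_converges g \<phi> s t \<delta> K x" and "norm (LP_integral g \<phi> s t \<delta> K x) \<le> M"
proof -
  define I where "I k = osc_integral g s t \<delta> (LP_Q \<phi> k) x" for k
  have sc: "LP_Q \<phi> k = (\<lambda>y. LP_Q \<phi> 0 (y / 2 powi k))" for k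
    by (intro ext LP_Q_scale)
  have IB: "norm (I k) \<le> B k" if "k \<in> K" for k
    using B[OF that] unfolding I_def sc[of k] .
  have int: "integrable lborel (osc_integrand g s t \<delta> (LP_Q \<phi> k) x)" for k
    unfolding sc[of k] by (rule osc_polar(1)[OF g LP_Q_C1_cutoff[OF \<phi>] \<open>\<delta> > 0\<close>]) simp
  have fin: "(\<Sum>k\<in>F. norm (I k)) \<le> M" if "finite F" "F \<subseteq> K" for F
  proof -
    have "(\<Sum>k\<in>F. norm (I k)) \<le> sum B F" using IB that by (intro sum_mono) auto
    then show ?thesis using M[OF that] by simp
  qed
  have abs: "(\<lambda>k. norm (I k)) summable_on K"
    by (rule nonneg_bdd_above_summable_on) (use fin in \<open>auto intro!: bdd_aboveI2[where M = M]\<close>)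
  then show "LP_converges g \<phi> s t \<delta> K x"
    unfolding LP_converges_def I_def[symmetric] using abs_summable_summable by blast
  show "norm (LP_integral g \<phi> s t \<delta> K x) \<le> M"
  proof (cases "integrable lborel (osc_integrand g s t \<delta> (LP_sum \<phi> K) x)")
    case False
    have "norm (infsum I K) \<le> infsum (\<lambda>k. norm (I k)) K" by (rule norm_infsum_bound[OF abs])
    also have "\<dots> \<le> M" by (rule infsum_le_finite_sums[OF abs fin])
    finally show ?thesis using False by (simp add: LP_integral_def I_def[abs_def])
  next
    case True
    define Kn where "Kn n = K \<inter> {- int n..int n}" for n
    have Kn: "finite (Kn n)" "Kn n \<subseteq> K" for n by (auto simp: Kn_def)
    define f where "f n \<xi> = (\<Sum>k\<in>Kn n. osc_integrand g s t \<delta> (LP_Q \<phi> k) x \<xi>)" for n \<xi>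
    \<comment> \<open>Splitting off the unimodular factor leaves real, nonnegative multipliers, so
      that partial and full sums can be compared pointwise.\<close>
    define u where "u \<xi> = exp (\<i> * of_real (x \<bullet> \<xi>)) * exp (\<i> * of_real (t / \<delta> * g (\<delta> * norm \<xi>)))" for \<xi> :: "real^2"
    have nu: "norm (u \<xi>) = 1" for \<xi> by (simp add: u_def norm_mult)
    have osc_u: "osc_integrand g s t \<delta> m x \<xi> = u \<xi> * of_real (m (\<delta> * norm \<xi>) * norm \<xi> powr s)" for m \<xi>
      by (simp add: osc_integrand_def u_def)
    have f_eq: "f n \<xi> = u \<xi> * of_real ((\<Sum>k\<in>Kn n. LP_Q \<phi> k (\<delta> * norm \<xi>)) * norm \<xi> powr s)" for n \<xi>
      unfolding f_def osc_u by (simp add: sum_distrib_left sum_distrib_right)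
    have ev: "eventually (\<lambda>n. (\<Sum>k\<in>Kn n. LP_Q \<phi> k (\<delta> * norm \<xi>)) = LP_sum \<phi> K (\<delta> * norm \<xi>)) sequentially"
      for \<xi> :: "real^2"
      unfolding Kn_def using \<open>\<delta> > 0\<close> by (intro LP_sum_eventually[OF \<phi>]) simp
    have le: "(\<Sum>k\<in>Kn n. LP_Q \<phi> k (\<delta> * norm \<xi>)) \<le> LP_sum \<phi> K (\<delta> * norm \<xi>)" for n and \<xi> :: "real^2"
    proof -
      from ev[of \<xi>] obtain m where m: "\<And>j. j \<ge> m \<Longrightarrow> (\<Sum>k\<in>Kn j. LP_Q \<phi> k (\<delta> * norm \<xi>)) = LP_sum \<phi> K (\<delta> * norm \<xi>)"
        unfolding eventually_sequentially by blast
      have "(\<Sum>k\<in>Kn n. LP_Q \<phi> k (\<delta> * norm \<xi>)) \<le> (\<Sum>k\<in>Kn (max m n). LP_Q \<phi> k (\<delta> * norm \<xi>))"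
        using \<open>\<delta> > 0\<close> by (intro sum_mono2 Kn LP_Q_nonneg[OF \<phi>]) (auto simp: Kn_def)
      then show ?thesis using m[of "max m n"] by simp
    qed
    have nn: "(\<Sum>k\<in>Kn n. LP_Q \<phi> k (\<delta> * norm \<xi>)) \<ge> 0" for n and \<xi> :: "real^2"
      using \<open>\<delta> > 0\<close> by (intro sum_nonneg LP_Q_nonneg[OF \<phi>]) simp
    have intf: "integrable lborel (f n)" for n
      unfolding f_def by (intro Bochner_Integration.integrable_sum int)
    have "(\<lambda>n. integral\<^sup>L lborel (f n)) \<longlonglongrightarrow> integral\<^sup>L lborel (osc_integrand g s t \<delta> (LP_sum \<phi> K) x)"
    proof (rule integral_dominated_convergence)
      show "integrable lborel (\<lambda>\<xi>. norm (osc_integrand g s t \<delta> (LP_sum \<phi> K) x \<xi>))"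
        using True by (rule integrable_norm)
      show "AE \<xi> in lborel. (\<lambda>n. f n \<xi>) \<longlonglongrightarrow> osc_integrand g s t \<delta> (LP_sum \<phi> K) x \<xi>"
      proof (rule always_eventually, rule allI, rule tendsto_eventually)
        fix \<xi> :: "real^2"
        show "eventually (\<lambda>n. f n \<xi> = osc_integrand g s t \<delta> (LP_sum \<phi> K) x \<xi>) sequentially"
          using ev[of \<xi>] by eventually_elim (simp add: f_eq osc_u)
      qed
      show "AE \<xi> in lborel. norm (f n \<xi>) \<le> norm (osc_integrand g s t \<delta> (LP_sum \<phi> K) x \<xi>)" for n
      proof (intro always_eventually allI)
        fix \<xi> :: "real^2"
        have "\<bar>\<Sum>k\<in>Kn n. LP_Q \<phi> k (\<delta> * norm \<xi>)\<bar> \<le> \<bar>LP_sum \<phi> K (\<delta> * norm \<xi>)\<bar>"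
          using le[of \<xi> n] nn[of \<xi> n] by linarith
        then show "norm (f n \<xi>) \<le> norm (osc_integrand g s t \<delta> (LP_sum \<phi> K) x \<xi>)"
          unfolding f_eq osc_u norm_mult nu norm_of_real abs_mult by (intro mult_mono) auto
      qed
    qed (use True intf in auto)
    then have lim: "(\<lambda>n. integral\<^sup>L lborel (f n)) \<longlonglongrightarrow> LP_integral g \<phi> s t \<delta> K x"
      using True by (simp add: LP_integral_def osc_integral_def)
    show ?thesis
    proof (rule LIMSEQ_le_const2[OF tendsto_norm[OF lim]], intro exI allI impI)
      fix n :: nat
      have "integral\<^sup>L lborel (f n) = (\<Sum>k\<in>Kn n. I k)"
        unfolding f_def I_def osc_integral_def by (rule Bochner_Integration.integral_sum[OF int])
      then show "norm (integral\<^sup>L lborel (f n)) \<le> M"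
        using fin[OF Kn] norm_sum[of I "Kn n"] by (metis order_trans)
    qed
  qed
qed

context oscillatory begin

text \<open>The powers combine as R^(s+1) * sqrt R = R^(s+3/2) with R = S/\<delta>. The set
  \<open>Z\<close> may be larger than the set of zeros of g'' in the shell, so one \<open>Z\<close>
  can serve all dyadic S at once.\<close>

lemma low_frequency:
  assumes "b > 0" "S > 0" "\<delta> > 0" "t \<noteq> 0" "finite Z"
    and b: "\<And>y. y \<in> {S / 2..2 * S} \<Longrightarrow> \<bar>deriv g y\<bar> \<ge> b"
    and Z: "\<And>y. y \<in> {S / 2..2 * S} \<Longrightarrow> deriv (deriv g) y = 0 \<Longrightarrow> y \<in> Z"
  shows "norm (osc_integral g s t \<delta> (\<lambda>y. P (y / S)) x)
    \<le> 2 ^ card Z * 48 * pi * K / sqrt b * (S powr (s + 3/2) * \<delta> powr (- (s + 3/2)) / sqrt \<bar>t\<bar>)"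
proof -
  define R where "R = S / \<delta>"
  have R: "R > 0" using assms by (simp add: R_def)
  have "norm (osc_integral g s t \<delta> (\<lambda>y. P (y / S)) x)
    \<le> 2 ^ card Z * (48 * pi * (K * R powr (s + 1)) * sqrt (R / (\<bar>t\<bar> * b)))"
  proof (rule osc_integral_split[OF \<open>\<delta> > 0\<close> \<open>S > 0\<close> \<open>finite Z\<close>, folded R_def])
    fix p q assume pq: "R / 2 \<le> p" "p \<le> q" "q \<le> 2 * R" "Z \<inter> {\<delta> * p<..<\<delta> * q} = {}"
    have sub: "\<delta> * p \<ge> S / 2" "\<delta> * q \<le> 2 * S" using pq \<open>\<delta> > 0\<close> by (auto simp: R_def field_simps)
    show "norm (integral {p..q} (\<lambda>r. of_real (radial_amplitude P s R r) * cis (t / \<delta> * g (\<delta> * r)) * circle_moment x 0 r))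
       \<le> 48 * pi * (K * R powr (s + 1)) * sqrt (R / (\<bar>t\<bar> * b))"
      unfolding R_def
    proof (rule piece_nonstationary[OF \<open>\<delta> > 0\<close> \<open>S > 0\<close> pq(1-3)[unfolded R_def] \<open>t \<noteq> 0\<close> \<open>b > 0\<close>])
      show "b \<le> \<bar>deriv g y\<bar>" if "y \<in> {\<delta> * p..\<delta> * q}" for y using b that sub by auto
      show "deriv (deriv g) y \<noteq> 0" if "y \<in> {\<delta> * p<..<\<delta> * q}" for y
      proof
        assume "deriv (deriv g) y = 0"
        then have "y \<in> Z" using that sub by (intro Z) auto
        then show False using that pq(4) by auto
      qed
    qed
  qed
  also have "\<dots> = 2 ^ card Z * 48 * pi * K * (R powr (s + 1) * sqrt (R / (\<bar>t\<bar> * b)))" by simp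
  also have "R powr (s + 1) * sqrt (R / (\<bar>t\<bar> * b)) = S powr (s + 3/2) * \<delta> powr (- (s + 3/2)) / sqrt \<bar>t\<bar> / sqrt b"
  proof -
    have "R powr (s + 1) * R powr (1/2) = R powr (s + 3/2)"
    proof -
      have "s + 1 + 1/2 = s + 3/2" by simp
      then show ?thesis by (metis powr_add)
    qed
    moreover have "R powr (s + 3/2) = S powr (s + 3/2) * \<delta> powr (- (s + 3/2))"
    proof -
      have "R powr (s + 3/2) = S powr (s + 3/2) / \<delta> powr (s + 3/2)"
        unfolding R_def by (rule powr_divide)
      then show ?thesis by (simp only: powr_minus divide_inverse)
    qed
    moreover have "sqrt (R / (\<bar>t\<bar> * b)) = R powr (1/2) / sqrt \<bar>t\<bar> / sqrt b"
      using R by (simp add: real_sqrt_divide real_sqrt_mult powr_half_sqrt)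
    ultimately show ?thesis by (metis times_divide_eq_right)
  qed
  also have "2 ^ card Z * 48 * pi * K * (S powr (s + 3/2) * \<delta> powr (- (s + 3/2)) / sqrt \<bar>t\<bar> / sqrt b)
     = 2 ^ card Z * 48 * pi * K / sqrt b * (S powr (s + 3/2) * \<delta> powr (- (s + 3/2)) / sqrt \<bar>t\<bar>)"
    by simp
  finally show ?thesis .
qed

end

section \<open>Frequency regimes\<close>

text \<open>Used to cut a compact interval, by a fixed finite set, into pieces so short that
  continuous functions hardly vary on them.\<close>

lemma finite_grid:
  fixes a b d :: real
  assumes "d > 0"
  obtains Z where "finite Z" and "\<And>u v. \<lbrakk>a \<le> u; v \<le> b; Z \<inter> {u<..<v} = {}\<rbrakk> \<Longrightarrow> v - u \<le> d"
proof -
  define n where "n = nat \<lceil>(b - a) / d\<rceil>"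
  define Z where "Z = (\<lambda>j::nat. a + real j * d) ` {..n}"
  show ?thesis
  proof (rule that[of Z])
    show "finite Z" by (simp add: Z_def)
    fix u v assume uv: "a \<le> u" "v \<le> b" "Z \<inter> {u<..<v} = {}"
    show "v - u \<le> d"
    proof (rule ccontr)
      assume gt: "\<not> v - u \<le> d"
      define i where "i = \<lfloor>(u - a) / d\<rfloor> + 1"
      have i0: "i \<ge> 1" using uv(1) assms by (simp add: i_def)
      define j where "j = nat i"
      have rj: "real j = of_int i" using i0 by (simp add: j_def)
      have "(u - a) / d < of_int i" "of_int i \<le> (u - a) / d + 1" unfolding i_def by linarith+
      then have 1: "u < a + real j * d" "a + real j * d \<le> u + d"
        using assms by (auto simp: rj field_simps)
      then have 2: "a + real j * d < v" using gt by linarith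
      then have "real j \<le> (b - a) / d" using uv(2) assms by (simp add: field_simps)
      then have "real j \<le> of_int \<lceil>(b - a) / d\<rceil>" by linarith
      then have "j \<le> n" unfolding n_def by linarith
      then have "a + real j * d \<in> Z" unfolding Z_def by auto
      then show False using uv(3) 1 2 by auto
    qed
  qed
qed

lemma powr_quotient: "(S / \<delta>) powr e = S powr e * \<delta> powr (- e)" for S \<delta> e :: real
  by (simp add: powr_divide powr_minus_divide)

lemma powr_interval_le:
  fixes y :: real
  assumes "0 < a" "a \<le> y" "y \<le> b"
  shows "y powr e \<le> a powr e + b powr e"
proof (cases "e \<ge> 0")
  case True
  then have "y powr e \<le> b powr e" using assms by (intro powr_mono2) auto
  then show ?thesis by (simp add: add_increasing)
next
  case False
  then have "y powr e \<le> a powr e" using assms by (intro powr_mono2') auto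
  then show ?thesis by (simp add: add_increasing2)
qed

context oscillatory begin

text \<open>At each point |g'| or |g''| is at least lam/2 = 2e. By uniform continuity neither
  changes by more than e on pieces of length at most \<open>d\<close>, so the one that is large at
  the left end stays above e throughout the piece. Depending on which it is, the nonstationary or
  the curved estimate applies; adding the zeros of g'' to the grid provides the sign condition of
  the former.\<close>

lemma middle_frequency:
  assumes "lam > 0" "0 < y0"
    and lb: "\<And>y. y \<in> {y0/2..2*y1} \<Longrightarrow> \<bar>deriv g y\<bar> + \<bar>deriv (deriv g) y\<bar> \<ge> lam"
    and fin: "finite {y\<in>{y0/2..2*y1}. deriv (deriv g) y = 0}"
  obtains C where "C > 0" and
    "\<And>S t \<delta> x. \<lbrakk>y0 \<le> S; S \<le> y1; t \<noteq> 0; \<delta> > 0\<rbrakk> \<Longrightarrow>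
      norm (osc_integral g s t \<delta> (\<lambda>y. P (y / S)) x) \<le> C * (\<delta> powr (- (s + 3/2)) / sqrt \<bar>t\<bar>)"
proof -
  define I where "I = {y0/2..2*y1}"
  have "I \<subseteq> {0<..}" using assms by (auto simp: I_def)
  then have cI: "continuous_on I (deriv g)" "continuous_on I (deriv (deriv g))"
    using C2_on_pos_continuous[OF g] continuous_on_subset by blast+
  have "compact I" by (simp add: I_def)
  define e where "e = lam / 4"
  have e: "e > 0" using assms by (simp add: e_def)
  obtain d1 where d1: "d1 > 0" "\<And>u y. \<lbrakk>u \<in> I; y \<in> I; dist y u < d1\<rbrakk> \<Longrightarrow> dist (deriv g y) (deriv g u) < e"
    using compact_uniformly_continuous[OF cI(1) \<open>compact I\<close>] e unfolding uniformly_continuous_on_def by meson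
  obtain d2 where d2: "d2 > 0" "\<And>u y. \<lbrakk>u \<in> I; y \<in> I; dist y u < d2\<rbrakk> \<Longrightarrow> dist (deriv (deriv g) y) (deriv (deriv g) u) < e"
    using compact_uniformly_continuous[OF cI(2) \<open>compact I\<close>] e unfolding uniformly_continuous_on_def by meson
  define d where "d = min d1 d2 / 2"
  have d: "d > 0" "d < d1" "d < d2" using d1(1) d2(1) by (auto simp: d_def)
  obtain Z0 where Z0: "finite Z0" "\<And>u v. \<lbrakk>y0/2 \<le> u; v \<le> 2*y1; Z0 \<inter> {u<..<v} = {}\<rbrakk> \<Longrightarrow> v - u \<le> d"
    using finite_grid[OF d(1)] by blast
  define Z where "Z = Z0 \<union> {y\<in>I. deriv (deriv g) y = 0}"
  have Z: "finite Z" using Z0(1) fin by (simp add: Z_def I_def)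
  define c where "c = (48 * pi * K * (y0 powr (s + 3/2) + y1 powr (s + 3/2))
     + 80 * pi * K * (y0 powr (s + 1) + y1 powr (s + 1))) / sqrt e"
  have c: "c \<ge> 0" using K e by (simp add: c_def)
  show ?thesis
  proof (rule that[of "2 ^ card Z * c + 1"])
    show "2 ^ card Z * c + 1 > 0" using c by (simp add: add_nonneg_pos)
    fix S t \<delta> :: real and x assume S: "y0 \<le> S" "S \<le> y1" and t: "t \<noteq> 0" and \<delta>: "\<delta> > 0"
    have S0: "S > 0" using S assms by linarith
    define E where "E = \<delta> powr (- (s + 3/2)) / sqrt \<bar>t\<bar>"
    have E: "E \<ge> 0" by (simp add: E_def)
    \<comment> \<open>Both estimates yield the same power of \<delta>: R^(s+1) * R^(1/2) here and
      R^(s+1) * \<delta>^(-1/2) in \<open>N2\<close>. They differ in the power of S, which is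
      bounded on {y0..y1}.\<close>
    have N1: "48 * pi * (K * (S / \<delta>) powr (s + 1)) * sqrt (S / \<delta> / (\<bar>t\<bar> * e)) \<le> c * E"
    proof -
      have "(S / \<delta>) powr (s + 1) * sqrt (S / \<delta> / (\<bar>t\<bar> * e))
          = ((S / \<delta>) powr (s + 1) * (S / \<delta>) powr (1/2)) / sqrt \<bar>t\<bar> / sqrt e"
        using S0 \<delta> by (simp add: real_sqrt_divide real_sqrt_mult powr_half_sqrt)
      also have "(S / \<delta>) powr (s + 1) * (S / \<delta>) powr (1/2) = (S / \<delta>) powr (s + 3/2)"
      proof -
        have "s + 1 + 1/2 = s + 3/2" by simp
        then show ?thesis by (metis powr_add)
      qed
      finally have "48 * pi * (K * (S / \<delta>) powr (s + 1)) * sqrt (S / \<delta> / (\<bar>t\<bar> * e))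
         = 48 * pi * K * S powr (s + 3/2) / sqrt e * E"
        unfolding powr_quotient E_def by (simp add: mult.assoc)
      also have "\<dots> \<le> c * E"
      proof -
        have "48 * pi * K * S powr (s + 3/2) \<le> 48 * pi * K * (y0 powr (s + 3/2) + y1 powr (s + 3/2))"
          using powr_interval_le[OF assms(2) S] K by (intro mult_left_mono) auto
        moreover have "0 \<le> 80 * pi * K * (y0 powr (s + 1) + y1 powr (s + 1))" using K by simp
        ultimately show ?thesis
          unfolding c_def using E e
          by (intro mult_right_mono divide_right_mono real_sqrt_ge_zero) linarith+
      qed
      finally show ?thesis .
    qed
    have N2: "80 * pi * (K * (S / \<delta>) powr (s + 1)) / sqrt (\<bar>t\<bar> * \<delta> * e) \<le> c * E"
    proof -
      have "(S / \<delta>) powr (s + 1) / sqrt (\<bar>t\<bar> * \<delta> * e)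
          = S powr (s + 1) * (\<delta> powr (- (s + 1)) / \<delta> powr (1/2)) / sqrt \<bar>t\<bar> / sqrt e"
        unfolding powr_quotient using \<delta> by (simp add: real_sqrt_mult powr_half_sqrt)
      also have "\<delta> powr (- (s + 1)) / \<delta> powr (1/2) = \<delta> powr (- (s + 3/2))"
      proof -
        have "- (s + 1) - 1/2 = - (s + 3/2)" by simp
        then show ?thesis by (metis powr_diff)
      qed
      finally have "80 * pi * (K * (S / \<delta>) powr (s + 1)) / sqrt (\<bar>t\<bar> * \<delta> * e)
         = 80 * pi * K * S powr (s + 1) / sqrt e * E"
        unfolding E_def by (simp add: mult.assoc flip: times_divide_eq_right)
      also have "\<dots> \<le> c * E"
      proof -
        have "80 * pi * K * S powr (s + 1) \<le> 80 * pi * K * (y0 powr (s + 1) + y1 powr (s + 1))"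
          using powr_interval_le[OF assms(2) S] K by (intro mult_left_mono) auto
        moreover have "0 \<le> 48 * pi * K * (y0 powr (s + 3/2) + y1 powr (s + 3/2))" using K by simp
        ultimately show ?thesis
          unfolding c_def using E e
          by (intro mult_right_mono divide_right_mono real_sqrt_ge_zero) linarith+
      qed
      finally show ?thesis .
    qed
    have "norm (osc_integral g s t \<delta> (\<lambda>y. P (y / S)) x) \<le> 2 ^ card Z * (c * E)"
    proof (rule osc_integral_split[OF \<delta> S0 Z])
      fix p q assume pq: "S / \<delta> / 2 \<le> p" "p \<le> q" "q \<le> 2 * (S / \<delta>)" "Z \<inter> {\<delta> * p<..<\<delta> * q} = {}"
      have sub: "\<delta> * p \<ge> y0 / 2" "\<delta> * q \<le> 2 * y1" "\<delta> * p \<le> \<delta> * q"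
        using pq \<delta> S by (auto simp: field_simps intro: order_trans)
      have "\<delta> * q - \<delta> * p \<le> d" using sub pq(4) by (intro Z0(2)) (auto simp: Z_def)
      then have near: "\<bar>deriv g y - deriv g (\<delta> * p)\<bar> < e" "\<bar>deriv (deriv g) y - deriv (deriv g) (\<delta> * p)\<bar> < e"
        if "y \<in> {\<delta> * p..\<delta> * q}" for y
        using d1(2)[of "\<delta> * p" y] d2(2)[of "\<delta> * p" y] that sub d by (auto simp: I_def dist_real_def)
      have "\<bar>deriv g (\<delta> * p)\<bar> + \<bar>deriv (deriv g) (\<delta> * p)\<bar> \<ge> lam"
        using sub by (intro lb) auto
      then consider "\<bar>deriv g (\<delta> * p)\<bar> \<ge> 2 * e" | "\<bar>deriv (deriv g) (\<delta> * p)\<bar> \<ge> 2 * e"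
        unfolding e_def by linarith
      then show "norm (integral {p..q} (\<lambda>r. of_real (radial_amplitude P s (S / \<delta>) r) * cis (t / \<delta> * g (\<delta> * r)) * circle_moment x 0 r)) \<le> c * E"
      proof cases
        case 1
        have "norm (integral {p..q} (\<lambda>r. of_real (radial_amplitude P s (S / \<delta>) r) * cis (t / \<delta> * g (\<delta> * r)) * circle_moment x 0 r))
          \<le> 48 * pi * (K * (S / \<delta>) powr (s + 1)) * sqrt (S / \<delta> / (\<bar>t\<bar> * e))"
        proof (rule piece_nonstationary[OF \<delta> S0 pq(1-3) t e])
          show "e \<le> \<bar>deriv g y\<bar>" if "y \<in> {\<delta> * p..\<delta> * q}" for y
            using near(1)[OF that] 1 by linarith
          show "deriv (deriv g) y \<noteq> 0" if "y \<in> {\<delta> * p<..<\<delta> * q}" for y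
          proof
            assume "deriv (deriv g) y = 0"
            moreover have "y \<in> I" using that sub by (auto simp: I_def)
            ultimately have "y \<in> Z" by (simp add: Z_def)
            then show False using that pq(4) by blast
          qed
        qed
        then show ?thesis using N1 by linarith
      next
        case 2
        have "norm (integral {p..q} (\<lambda>r. of_real (radial_amplitude P s (S / \<delta>) r) * cis (t / \<delta> * g (\<delta> * r)) * circle_moment x 0 r))
          \<le> 80 * pi * (K * (S / \<delta>) powr (s + 1)) / sqrt (\<bar>t\<bar> * \<delta> * e)"
        proof (rule piece_curved[OF \<delta> S0 pq(1-3) t e])
          show "e \<le> \<bar>deriv (deriv g) y\<bar>" if "y \<in> {\<delta> * p..\<delta> * q}" for y
            using near(2)[OF that] 2 by linarith
        qed
        then show ?thesis using N2 by linarith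
      qed
    qed
    also have "\<dots> \<le> (2 ^ card Z * c + 1) * E" using E by (simp add: algebra_simps)
    finally show "norm (osc_integral g s t \<delta> (\<lambda>y. P (y / S)) x)
      \<le> (2 ^ card Z * c + 1) * (\<delta> powr (- (s + 3/2)) / sqrt \<bar>t\<bar>)" unfolding E_def .
  qed
qed

text \<open>
  With \<open>z = |t|/\<delta> 2\<^sup>k\<^sup>\<beta>\<close> the trivial bound and the stationary phase bound are multiples of
  \<open>z\<^sup>1\<^sup>/\<^sup>2\<close> and \<open>z\<^sup>-\<^sup>1\<^sup>/\<^sup>2\<close>, so that their minimum is summable over \<open>k\<close> uniformly in \<open>t\<close> and \<open>\<delta>\<close>.
\<close>

lemma high_frequency:
  assumes "lam > 0" "y1 > 0" "a \<ge> \<alpha> + 1" and s: "s = \<beta> / 2 - 2" and \<beta>: "\<beta> = (a + \<alpha> + 3) / 2" "\<beta> \<noteq> 0"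
    and lb1: "\<And>y. y \<ge> y1 \<Longrightarrow> \<bar>deriv g y\<bar> \<ge> lam * y powr a"
    and lb2: "\<And>y. y \<ge> y1 \<Longrightarrow> \<bar>deriv (deriv g) y\<bar> \<ge> lam * y powr \<alpha>"
  obtains C and B :: "real \<Rightarrow> real \<Rightarrow> int \<Rightarrow> real" where "C > 0" "\<And>t \<delta> k. B t \<delta> k \<ge> 0"
    and "\<And>t \<delta> k x. \<lbrakk>t \<noteq> 0; \<delta> > 0; 2 powi k \<ge> 2 * y1\<rbrakk> \<Longrightarrow>
      norm (osc_integral g s t \<delta> (\<lambda>y. P (y / 2 powi k)) x) \<le> B t \<delta> k"
    and "\<And>t \<delta> F. \<lbrakk>t \<noteq> 0; \<delta> > 0; finite F\<rbrakk> \<Longrightarrow> sum (B t \<delta>) F \<le> C * (\<delta> powr ((1 - \<beta>) / 2) / sqrt \<bar>t\<bar>)"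
proof -
  define \<kappa> where "\<kappa> = \<beta> * ln 2 / 2"
  have "\<kappa> \<noteq> 0" using \<beta> by (simp add: \<kappa>_def)
  then obtain G where G: "G > 0" "\<And>v F. finite F \<Longrightarrow> (\<Sum>k\<in>F. exp (- \<bar>v + \<kappa> * of_int k\<bar>)) \<le> G"
    using sum_exp_abs_affine_le by blast
  define c1 where "c1 = lam * 2 powr (- \<bar>a\<bar>)"
  define c2 where "c2 = lam * 2 powr (- \<bar>\<alpha>\<bar>)"
  have c: "c1 > 0" "c2 > 0" using assms by (auto simp: c1_def c2_def)
  \<comment> \<open>The term 1/b1 carries S^(-a), which is S^(1-\<beta>) times
    S^(-(a-\<alpha>-1)/2). As a >= \<alpha> + 1, the extra power is largest at the smallest scale S
    = 2 y1; this is its value there.\<close>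
  define c3 where "c3 = (2 * y1) powr (- (a - \<alpha> - 1) / 2)"
  define A1 where "A1 = 3840 * pi * K * (c3 / c1 + 1 / sqrt (c1 * c2))"
  define A where "A = 3 * pi * K + A1"
  have A: "A > 0" "3 * pi * K \<le> A" "A1 \<le> A"
    using K c by (auto simp: A_def A1_def c3_def add_pos_nonneg)
  define E where "E t \<delta> = \<delta> powr ((1 - \<beta>) / 2) / sqrt \<bar>t\<bar>" for t \<delta>
  have E: "E t \<delta> \<ge> 0" for t \<delta> by (simp add: E_def)
  \<comment> \<open>exp (v + \<kappa> k) is the square root of the quantity z = |t|/\<delta> * 2^(k
    \<beta>).\<close>
  define v where "v t \<delta> = (ln \<bar>t\<bar> - ln \<delta>) / 2" for t \<delta> :: real
  define B where "B t \<delta> k = A * E t \<delta> * exp (- \<bar>v t \<delta> + \<kappa> * of_int k\<bar>)" for t \<delta> and k :: int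
  show ?thesis
  proof (rule that[of "A * G" B])
    show "A * G > 0" using A G by simp
    show "B t \<delta> k \<ge> 0" for t \<delta> k using A E by (simp add: B_def)
    show "sum (B t \<delta>) F \<le> A * G * (\<delta> powr ((1 - \<beta>) / 2) / sqrt \<bar>t\<bar>)" if "finite F" for t \<delta> F
    proof -
      have "sum (B t \<delta>) F = A * E t \<delta> * (\<Sum>k\<in>F. exp (- \<bar>v t \<delta> + \<kappa> * of_int k\<bar>))"
        by (simp add: B_def sum_distrib_left)
      also have "\<dots> \<le> A * E t \<delta> * G" using A E G(2)[OF that] by (intro mult_left_mono) auto
      finally show ?thesis by (simp add: E_def mult_ac)
    qed
    fix t \<delta> :: real and k x assume t: "t \<noteq> 0" and \<delta>: "\<delta> > 0" and k: "2 powi k \<ge> 2 * y1"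
    define S where "S = (2::real) powi k"
    have S: "S > 0" "S \<ge> 2 * y1" using k by (auto simp: S_def)
    have Sexp: "S powr e = exp (e * (of_int k * ln 2))" for e
      unfolding S_def two_powi_eq_exp by (simp add: powr_def)
    have \<delta>exp: "\<delta> powr e = exp (e * ln \<delta>)" for e using \<delta> by (simp add: powr_def)
    have texp: "\<bar>t\<bar> = exp (ln \<bar>t\<bar>)" "sqrt \<bar>t\<bar> = exp (ln \<bar>t\<bar> / 2)"
      using t powr_half_sqrt[of "\<bar>t\<bar>"] by (auto simp: powr_def)
    define w where "w = v t \<delta> + \<kappa> * of_int k"
    have e1: "(S / \<delta>) powr (\<beta> / 2) = E t \<delta> * exp w"
      unfolding powr_quotient E_def Sexp \<delta>exp texp(2) exp_diff[symmetric] exp_add[symmetric] w_def v_def \<kappa>_def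
      by (simp add: field_simps)
    have e2: "(S / \<delta>) powr (\<beta> / 2 - 1) / \<bar>t\<bar> * S powr (1 - \<beta>) = E t \<delta> * exp (- w)"
    proof -
      have "(S / \<delta>) powr (\<beta> / 2 - 1) / exp (ln \<bar>t\<bar>) * S powr (1 - \<beta>) = E t \<delta> * exp (- w)"
        unfolding powr_quotient E_def Sexp \<delta>exp texp(2) exp_diff[symmetric] exp_add[symmetric] w_def v_def \<kappa>_def
        by (simp add: field_simps)
      then show ?thesis using texp(1) by simp
    qed
    let ?n = "norm (osc_integral g s t \<delta> (\<lambda>y. P (y / S)) x)"
    have "?n \<le> 3 * pi * K * (S / \<delta>) powr (s + 2)" by (rule osc_trivial[OF \<delta> S(1)])
    also have "(S / \<delta>) powr (s + 2) = E t \<delta> * exp w" using e1 by (simp add: s)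
    also have "3 * pi * K * (E t \<delta> * exp w) \<le> A * (E t \<delta> * exp w)"
      using A E by (intro mult_right_mono) auto
    finally have n1: "?n \<le> A * E t \<delta> * exp w" by simp
    have yS: "y \<ge> y1" "y powr e \<ge> 2 powr (- \<bar>e\<bar>) * S powr e" if "y \<in> {S / 2..2 * S}" for y e
      using that S powr_dyadic_bounds(2)[OF S(1) that] by auto
    have "?n \<le> 3840 * pi * K * (S / \<delta>) powr (s + 1) / \<bar>t\<bar> * (1 / (c1 * S powr a) + 1 / sqrt (c1 * S powr a * (c2 * S powr \<alpha>) * S))"
    proof (rule osc_nonstationary_curved[OF \<delta> S(1) t])
      show "c1 * S powr a > 0" "c2 * S powr \<alpha> > 0" using c S by auto
      fix y assume y: "y \<in> {S / 2..2 * S}"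
      have "c1 * S powr a \<le> lam * y powr a" "c2 * S powr \<alpha> \<le> lam * y powr \<alpha>"
        unfolding c1_def c2_def mult.assoc using yS(2)[OF y] assms(1) by (auto intro!: mult_left_mono)
      then show "c1 * S powr a \<le> \<bar>deriv g y\<bar>" "c2 * S powr \<alpha> \<le> \<bar>deriv (deriv g) y\<bar>"
        using lb1[OF yS(1)[OF y]] lb2[OF yS(1)[OF y]] by linarith+
    qed
    also have "\<dots> \<le> 3840 * pi * K * (S / \<delta>) powr (s + 1) / \<bar>t\<bar> * ((c3 / c1 + 1 / sqrt (c1 * c2)) * S powr (1 - \<beta>))"
    proof (rule mult_left_mono)
      have "S powr (- (a - \<alpha> - 1) / 2) \<le> c3"
        unfolding c3_def using S assms by (intro powr_mono2') auto
      then have "S powr (- (a - \<alpha> - 1) / 2) * S powr (1 - \<beta>) \<le> c3 * S powr (1 - \<beta>)"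
        by (intro mult_right_mono) auto
      moreover have "S powr (- (a - \<alpha> - 1) / 2) * S powr (1 - \<beta>) = S powr (- a)"
      proof -
        have "- (a - \<alpha> - 1) / 2 + (1 - \<beta>) = - a" unfolding \<beta>(1) by (simp add: field_simps)
        then show ?thesis by (simp only: powr_add[symmetric])
      qed
      ultimately have "S powr (- a) / c1 \<le> c3 * S powr (1 - \<beta>) / c1"
        using c by (intro divide_right_mono) auto
      then have "1 / (c1 * S powr a) \<le> c3 / c1 * S powr (1 - \<beta>)"
        by (simp only: powr_minus_divide divide_divide_eq_left mult.commute times_divide_eq_left)
      moreover have "1 / sqrt (c1 * S powr a * (c2 * S powr \<alpha>) * S) = 1 / sqrt (c1 * c2) * S powr (1 - \<beta>)"
      proof -
        have "S powr a * S powr \<alpha> * S = S powr (a + \<alpha> + 1)"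
          using S by (simp add: powr_add)
        then have eq: "c1 * S powr a * (c2 * S powr \<alpha>) * S = (c1 * c2) * S powr (a + \<alpha> + 1)"
          by (metis mult.assoc mult.left_commute)
        have "sqrt (c1 * S powr a * (c2 * S powr \<alpha>) * S) = sqrt (c1 * c2) * S powr ((a + \<alpha> + 1) / 2)"
        proof -
          have "sqrt (S powr m) = S powr (m / 2)" for m
            using powr_half_sqrt[of "S powr m"] by (simp add: powr_powr)
          then show ?thesis unfolding eq real_sqrt_mult[of "c1 * c2"] by simp
        qed
        moreover have "S powr (1 - \<beta>) = inverse (S powr ((a + \<alpha> + 1) / 2))"
        proof -
          have "1 - \<beta> = - ((a + \<alpha> + 1) / 2)" unfolding \<beta>(1) by (simp add: field_simps)
          then show ?thesis by (simp only: powr_minus)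
        qed
        ultimately show ?thesis by (simp only: divide_inverse inverse_mult_distrib mult_1_left)
      qed
      ultimately show "1 / (c1 * S powr a) + 1 / sqrt (c1 * S powr a * (c2 * S powr \<alpha>) * S)
          \<le> (c3 / c1 + 1 / sqrt (c1 * c2)) * S powr (1 - \<beta>)"
        by (simp add: distrib_right)
    qed (use K in auto)
    also have "\<dots> = A1 * ((S / \<delta>) powr (\<beta> / 2 - 1) / \<bar>t\<bar> * S powr (1 - \<beta>))"
      by (simp add: A1_def s)
    also have "\<dots> = A1 * (E t \<delta> * exp (- w))" unfolding e2 ..
    also have "\<dots> \<le> A * (E t \<delta> * exp (- w))" using A E by (intro mult_right_mono) auto
    finally have n2: "?n \<le> A * E t \<delta> * exp (- w)" by simp
    have "?n \<le> A * E t \<delta> * exp (- \<bar>w\<bar>)" using n1 n2 by (cases "w \<ge> 0") auto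
    then show "norm (osc_integral g s t \<delta> (\<lambda>y. P (y / 2 powi k)) x) \<le> B t \<delta> k"
      by (simp add: B_def w_def S_def)
  qed
qed

end

section \<open>Assembly of the four frequency regimes\<close>

lemma oscillatory_exists:
  assumes "C2_on_pos g" "C1_cutoff P"
  obtains K where "oscillatory g P s K"
  using radial_amplitude_bounds[OF assms(2), of s] assms unfolding oscillatory_def by metis

text \<open>The parameter \<open>a\<close> is the power in the lower bound for |g'|, so that (3) and
  (4) become two instances. The dyadic estimate is applied to P for the sum of suprema and to Q_0
  for the Littlewood-Paley integral.\<close>

lemma high_frequency_sums:
  assumes P: "C1_cutoff P" and \<phi>: "LP_cutoff \<phi>" and g: "C2_on_pos g" and "lam > 0" "y1 > 0"
    and "a \<ge> \<alpha> + 1" and s: "s = \<beta> / 2 - 2" and \<beta>: "\<beta> = (a + \<alpha> + 3) / 2" "\<beta> \<noteq> 0"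
    and lb1: "\<And>y. y \<ge> y1 \<Longrightarrow> \<bar>deriv g y\<bar> \<ge> lam * y powr a"
    and lb2: "\<And>y. y \<ge> y1 \<Longrightarrow> \<bar>deriv (deriv g) y\<bar> \<ge> lam * y powr \<alpha>"
    and e: "e = (1 - \<beta>) / 2"
  shows "\<exists>C>0. \<forall>t \<delta>. t \<noteq> 0 \<and> \<delta> > 0 \<longrightarrow>
         (\<Sum>\<^sub>\<infinity>k\<in>{k::int. 2 powi k \<ge> 2 * y1}. sup_cmod (\<lambda>x. osc_I g P s t \<delta> x k))
           \<le> ennreal (C * (\<delta> powr e / sqrt \<bar>t\<bar>)) \<and>
         (\<forall>x. LP_converges g \<phi> s t \<delta> {k. 2 powi k \<ge> 2 * y1} x) \<and>
         sup_cmod (LP_integral g \<phi> s t \<delta> {k. 2 powi k \<ge> 2 * y1})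
           \<le> ennreal (C * (\<delta> powr e / sqrt \<bar>t\<bar>))"
proof -
  obtain K where "oscillatory g P s K" by (rule oscillatory_exists[OF g P])
  from oscillatory.high_frequency[OF this assms(4-6) s \<beta> lb1 lb2]
  obtain C and B :: "real \<Rightarrow> real \<Rightarrow> int \<Rightarrow> real" where C: "C > 0" "\<And>t \<delta> k. B t \<delta> k \<ge> 0"
    "\<And>t \<delta> k x. \<lbrakk>t \<noteq> 0; \<delta> > 0; 2 powi k \<ge> 2 * y1\<rbrakk> \<Longrightarrow>
      norm (osc_integral g s t \<delta> (\<lambda>y. P (y / 2 powi k)) x) \<le> B t \<delta> k"
    "\<And>t \<delta> F. \<lbrakk>t \<noteq> 0; \<delta> > 0; finite F\<rbrakk> \<Longrightarrow> sum (B t \<delta>) F \<le> C * (\<delta> powr e / sqrt \<bar>t\<bar>)"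
    unfolding e by metis
  obtain K' where "oscillatory g (LP_Q \<phi> 0) s K'" by (rule oscillatory_exists[OF g LP_Q_C1_cutoff[OF \<phi>]])
  from oscillatory.high_frequency[OF this assms(4-6) s \<beta> lb1 lb2]
  obtain C' and B' :: "real \<Rightarrow> real \<Rightarrow> int \<Rightarrow> real" where C': "C' > 0"
    "\<And>t \<delta> k x. \<lbrakk>t \<noteq> 0; \<delta> > 0; 2 powi k \<ge> 2 * y1\<rbrakk> \<Longrightarrow>
      norm (osc_integral g s t \<delta> (\<lambda>y. LP_Q \<phi> 0 (y / 2 powi k)) x) \<le> B' t \<delta> k"
    "\<And>t \<delta> F. \<lbrakk>t \<noteq> 0; \<delta> > 0; finite F\<rbrakk> \<Longrightarrow> sum (B' t \<delta>) F \<le> C' * (\<delta> powr e / sqrt \<bar>t\<bar>)"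
    unfolding e by metis
  define D where "D = max C C'"
  show ?thesis
  proof (rule exI[of _ D], intro conjI allI impI; (elim conjE)?)
    show "D > 0" using C(1) by (simp add: D_def)
    fix t \<delta> :: real assume t: "t \<noteq> 0" "\<delta> > 0"
    have CD: "C * (\<delta> powr e / sqrt \<bar>t\<bar>) \<le> D * (\<delta> powr e / sqrt \<bar>t\<bar>)"
      "C' * (\<delta> powr e / sqrt \<bar>t\<bar>) \<le> D * (\<delta> powr e / sqrt \<bar>t\<bar>)"
      unfolding D_def by (intro mult_right_mono; simp)+
    show "(\<Sum>\<^sub>\<infinity>k\<in>{k::int. 2 powi k \<ge> 2 * y1}. sup_cmod (\<lambda>x. osc_I g P s t \<delta> x k))
           \<le> ennreal (D * (\<delta> powr e / sqrt \<bar>t\<bar>))"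
    proof (rule infsum_ennreal_le[where B = "B t \<delta>"])
      show "sup_cmod (\<lambda>x. osc_I g P s t \<delta> x k) \<le> ennreal (B t \<delta> k)" if "k \<in> {k. 2 powi k \<ge> 2 * y1}" for k
        using C(3)[OF t] that unfolding osc_I_def by (intro sup_cmod_le) simp
      show "sum (B t \<delta>) F \<le> D * (\<delta> powr e / sqrt \<bar>t\<bar>)" if "finite F" for F
        using C(4)[OF t that] CD(1) by linarith
    qed (rule C(2))
    have LP: "LP_converges g \<phi> s t \<delta> {k. 2 powi k \<ge> 2 * y1} x"
      "norm (LP_integral g \<phi> s t \<delta> {k. 2 powi k \<ge> 2 * y1} x) \<le> D * (\<delta> powr e / sqrt \<bar>t\<bar>)" for x
    proof -
      have B: "norm (osc_integral g s t \<delta> (\<lambda>y. LP_Q \<phi> 0 (y / 2 powi k)) x) \<le> B' t \<delta> k"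
        if "k \<in> {k. 2 powi k \<ge> 2 * y1}" for k
        using C'(2)[OF t] that by simp
      have M: "sum (B' t \<delta>) F \<le> D * (\<delta> powr e / sqrt \<bar>t\<bar>)" if "finite F" for F
        using C'(3)[OF t that] CD(2) by linarith
      show "LP_converges g \<phi> s t \<delta> {k. 2 powi k \<ge> 2 * y1} x"
        "norm (LP_integral g \<phi> s t \<delta> {k. 2 powi k \<ge> 2 * y1} x) \<le> D * (\<delta> powr e / sqrt \<bar>t\<bar>)"
        by (rule LP_integral_bound[OF \<phi> g t(2) B M]; assumption)+
    qed
    show "LP_converges g \<phi> s t \<delta> {k. 2 powi k \<ge> 2 * y1} x" for x by (rule LP(1))
    show "sup_cmod (LP_integral g \<phi> s t \<delta> {k. 2 powi k \<ge> 2 * y1}) \<le> ennreal (D * (\<delta> powr e / sqrt \<bar>t\<bar>))"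
      by (rule sup_cmod_le[OF LP(2)])
  qed
qed

text \<open>Only finitely many dyadic scales lie between y0 and y1, so the Littlewood-Paley integral
  costs the factor \<open>card J\<close>, which depends on y0 and y1 alone.\<close>

lemma middle_frequency_sums:
  assumes P: "C1_cutoff P" and \<phi>: "LP_cutoff \<phi>" and g: "C2_on_pos g" and "lam > 0" "y0 > 0"
    and lb: "\<And>y. y \<in> {y0/2..2*y1} \<Longrightarrow> \<bar>deriv g y\<bar> + \<bar>deriv (deriv g) y\<bar> \<ge> lam"
    and fin: "finite {y\<in>{y0/2..2*y1}. deriv (deriv g) y = 0}"
  shows "\<exists>C>0. \<forall>t \<delta>. t \<noteq> 0 \<and> \<delta> > 0 \<longrightarrow>
         (\<forall>k::int. y0 \<le> 2 powi k \<and> 2 powi k \<le> y1 \<longrightarrow>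
            sup_cmod (\<lambda>x. osc_I g P s t \<delta> x k)
              \<le> ennreal (C * (\<delta> powr (- (s + 3/2)) / sqrt \<bar>t\<bar>))) \<and>
         (\<forall>x. LP_converges g \<phi> s t \<delta> {k. y0 \<le> 2 powi k \<and> 2 powi k \<le> y1} x) \<and>
         sup_cmod (LP_integral g \<phi> s t \<delta> {k. y0 \<le> 2 powi k \<and> 2 powi k \<le> y1})
           \<le> ennreal (C * (\<delta> powr (- (s + 3/2)) / sqrt \<bar>t\<bar>))"
proof -
  define J where "J = {k::int. y0 \<le> 2 powi k \<and> 2 powi k \<le> y1}"
  have "finite J"
  proof (rule finite_subset)
    show "J \<subseteq> {\<lfloor>ln y0 / ln 2\<rfloor>..\<lceil>ln y1 / ln 2\<rceil>}"
    proof
      fix k assume "k \<in> J"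
      then have k: "y0 \<le> exp (of_int k * ln 2)" "exp (of_int k * ln 2) \<le> y1"
        by (auto simp: J_def two_powi_eq_exp)
      then have "y1 > 0" using \<open>y0 > 0\<close> by linarith
      then have "ln y0 \<le> of_int k * ln 2" "of_int k * ln 2 \<le> ln y1"
        using k \<open>y0 > 0\<close> by (simp_all add: ln_ge_iff flip: ln_ge_iff) (metis exp_gt_zero ln_exp ln_mono)+
      then have "ln y0 / ln 2 \<le> of_int k" "of_int k \<le> ln y1 / ln 2" by (auto simp: field_simps)
      then show "k \<in> {\<lfloor>ln y0 / ln 2\<rfloor>..\<lceil>ln y1 / ln 2\<rceil>}" by (auto simp: floor_le_iff le_ceiling_iff)
    qed
  qed auto
  obtain K where "oscillatory g P s K" by (rule oscillatory_exists[OF g P])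
  from oscillatory.middle_frequency[OF this assms(4,5) lb fin]
  obtain C where C: "C > 0"
    "\<And>S t \<delta> x. \<lbrakk>y0 \<le> S; S \<le> y1; t \<noteq> 0; \<delta> > 0\<rbrakk> \<Longrightarrow>
      norm (osc_integral g s t \<delta> (\<lambda>y. P (y / S)) x) \<le> C * (\<delta> powr (- (s + 3/2)) / sqrt \<bar>t\<bar>)"
    by metis
  obtain K' where "oscillatory g (LP_Q \<phi> 0) s K'" by (rule oscillatory_exists[OF g LP_Q_C1_cutoff[OF \<phi>]])
  from oscillatory.middle_frequency[OF this assms(4,5) lb fin]
  obtain C' where C': "C' > 0"
    "\<And>S t \<delta> x. \<lbrakk>y0 \<le> S; S \<le> y1; t \<noteq> 0; \<delta> > 0\<rbrakk> \<Longrightarrow>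
      norm (osc_integral g s t \<delta> (\<lambda>y. LP_Q \<phi> 0 (y / S)) x) \<le> C' * (\<delta> powr (- (s + 3/2)) / sqrt \<bar>t\<bar>)"
    by metis
  define D where "D = C + real (card J) * C'"
  show ?thesis unfolding J_def[symmetric]
  proof (rule exI[of _ D], intro conjI allI impI; (elim conjE)?)
    show "D > 0" using C(1) C'(1) by (simp add: D_def add_pos_nonneg)
    fix t \<delta> :: real assume t: "t \<noteq> 0" "\<delta> > 0"
    define E where "E = \<delta> powr (- (s + 3/2)) / sqrt \<bar>t\<bar>"
    have E: "E \<ge> 0" by (simp add: E_def)
    have CD: "C * E \<le> D * E" "real (card J) * (C' * E) \<le> D * E"
      unfolding D_def using C(1) C'(1) E by (simp_all add: algebra_simps)
    show "sup_cmod (\<lambda>x. osc_I g P s t \<delta> x k) \<le> ennreal (D * (\<delta> powr (- (s + 3/2)) / sqrt \<bar>t\<bar>))"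
      if "y0 \<le> 2 powi k" "2 powi k \<le> y1" for k :: int
    proof (rule sup_cmod_le)
      fix x
      show "norm (osc_I g P s t \<delta> x k) \<le> D * (\<delta> powr (- (s + 3/2)) / sqrt \<bar>t\<bar>)"
        using C(2)[OF that t, of x] CD(1) unfolding osc_I_def E_def by linarith
    qed
    have LP: "LP_converges g \<phi> s t \<delta> J x" "norm (LP_integral g \<phi> s t \<delta> J x) \<le> D * E" for x
    proof -
      have B: "norm (osc_integral g s t \<delta> (\<lambda>y. LP_Q \<phi> 0 (y / 2 powi k)) x) \<le> C' * E" if "k \<in> J" for k
        using C'(2)[OF _ _ t] that by (simp add: J_def E_def)
      have M: "sum (\<lambda>k. C' * E) F \<le> D * E" if "finite F" "F \<subseteq> J" for F
      proof -
        have "card F \<le> card J" using that \<open>finite J\<close> by (intro card_mono)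
        then have "sum (\<lambda>k. C' * E) F \<le> real (card J) * (C' * E)"
          using C'(1) E by (simp add: mult_right_mono)
        then show ?thesis using CD(2) by linarith
      qed
      show "LP_converges g \<phi> s t \<delta> J x" "norm (LP_integral g \<phi> s t \<delta> J x) \<le> D * E"
        by (rule LP_integral_bound[OF \<phi> g t(2) B M]; assumption)+
    qed
    show "LP_converges g \<phi> s t \<delta> J x" for x by (rule LP(1))
    show "sup_cmod (LP_integral g \<phi> s t \<delta> J) \<le> ennreal (D * (\<delta> powr (- (s + 3/2)) / sqrt \<bar>t\<bar>))"
      using sup_cmod_le[OF LP(2)] unfolding E_def .
  qed
qed

text \<open>The condition 2^k <= y0/2 places the whole shell between 2^k/2 and 2 * 2^k inside (0,
  y0], where the zeros of g'' form one finite set for all k.\<close>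

lemma low_frequency_bound:
  assumes P: "C1_cutoff P" and g: "C2_on_pos g" and "lam > 0"
    and lb: "\<And>y. y \<in> {0<..y0} \<Longrightarrow> \<bar>deriv g y\<bar> \<ge> lam"
    and fin: "finite {y\<in>{0<..y0}. deriv (deriv g) y = 0}"
  shows "\<exists>C>0. \<forall>t \<delta>. \<forall>k::int. t \<noteq> 0 \<and> \<delta> > 0 \<and> 2 powi k \<le> y0 / 2 \<longrightarrow>
         sup_cmod (\<lambda>x. osc_I g P s t \<delta> x k)
           \<le> ennreal (C * (2 powr ((s + 3/2) * of_int k) * \<delta> powr (- (s + 3/2)) / sqrt \<bar>t\<bar>))"
proof -
  obtain K where "oscillatory g P s K" by (rule oscillatory_exists[OF g P])
  then interpret oscillatory g P s K .
  define Z where "Z = {y\<in>{0<..y0}. deriv (deriv g) y = 0}"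
  show ?thesis
  proof (rule exI[of _ "2 ^ card Z * 48 * pi * K / sqrt lam"], intro conjI allI impI; (elim conjE)?)
    show "0 < 2 ^ card Z * 48 * pi * K / sqrt lam" using K \<open>lam > 0\<close> by simp
    fix t \<delta> :: real and k :: int assume t: "t \<noteq> 0" "\<delta> > 0" and k: "2 powi k \<le> y0 / 2"
    have S: "(2::real) powi k > 0" by simp
    have pw: "(2 powi k) powr (s + 3/2) = 2 powr ((s + 3/2) * of_int k)"
      by (simp add: two_powi_eq_exp powr_def)
    show "sup_cmod (\<lambda>x. osc_I g P s t \<delta> x k) \<le> ennreal (2 ^ card Z * 48 * pi * K / sqrt lam *
        (2 powr ((s + 3/2) * of_int k) * \<delta> powr (- (s + 3/2)) / sqrt \<bar>t\<bar>))"
      unfolding osc_I_def pw[symmetric]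
    proof (rule sup_cmod_le, rule low_frequency[OF \<open>lam > 0\<close> S t(2,1)])
      show "finite Z" using fin by (simp add: Z_def)
      fix y :: real assume "y \<in> {2 powi k / 2..2 * 2 powi k}"
      then have y: "y \<in> {0<..y0}" using k S by (auto intro: less_le_trans[of 0 "2 powi k / 2"])
      show "lam \<le> \<bar>deriv g y\<bar>" by (rule lb[OF y])
      show "y \<in> Z" if "deriv (deriv g) y = 0" using y that by (simp add: Z_def)
    qed
  qed
qed

theorem lemma2p19:
  fixes \<alpha> s lam y0 y1 :: real
    and g P \<phi>0 :: "real \<Rightarrow> real"
  assumes P: "annular_cutoff P"
    and \<phi>0: "LP_cutoff \<phi>0"
    and lam: "lam > 0"
    and y: "y1 \<ge> y0" "y0 > 0"
    and g: "C2_on_pos g"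
  shows
    "((\<forall>y\<in>{0<..y0}. \<bar>deriv g y\<bar> \<ge> lam) \<and>
      finite {y\<in>{0<..y0}. deriv (deriv g) y = 0} \<longrightarrow>
      (\<exists>C>0. \<forall>t \<delta>. \<forall>k::int. t \<noteq> 0 \<and> \<delta> > 0 \<and> 2 powi k \<le> y0 / 2 \<longrightarrow>
         sup_cmod (\<lambda>x. osc_I g P s t \<delta> x k)
           \<le> ennreal (C * (2 powr ((s + 3/2) * of_int k) * \<delta> powr (- (s + 3/2)) / sqrt \<bar>t\<bar>))))
     \<and>
     ((\<forall>y\<in>{y0/2..2*y1}. \<bar>deriv g y\<bar> + \<bar>deriv (deriv g) y\<bar> \<ge> lam) \<and>
      finite {y\<in>{y0/2..2*y1}. deriv (deriv g) y = 0} \<longrightarrow>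
      (\<exists>C>0. \<forall>t \<delta>. t \<noteq> 0 \<and> \<delta> > 0 \<longrightarrow>
         (\<forall>k::int. y0 \<le> 2 powi k \<and> 2 powi k \<le> y1 \<longrightarrow>
            sup_cmod (\<lambda>x. osc_I g P s t \<delta> x k)
              \<le> ennreal (C * (\<delta> powr (- (s + 3/2)) / sqrt \<bar>t\<bar>))) \<and>
         (\<forall>x. LP_converges g \<phi>0 s t \<delta> {k. y0 \<le> 2 powi k \<and> 2 powi k \<le> y1} x) \<and>
         sup_cmod (LP_integral g \<phi>0 s t \<delta> {k. y0 \<le> 2 powi k \<and> 2 powi k \<le> y1})
           \<le> ennreal (C * (\<delta> powr (- (s + 3/2)) / sqrt \<bar>t\<bar>))))
     \<and>
     ((\<forall>y\<ge>y1. \<bar>deriv g y\<bar> \<ge> lam * y powr (\<alpha> + 1) \<and>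
               \<bar>deriv (deriv g) y\<bar> \<ge> lam * y powr \<alpha>) \<and> \<alpha> \<noteq> -2 \<longrightarrow>
      (\<exists>C>0. \<forall>t \<delta>. t \<noteq> 0 \<and> \<delta> > 0 \<longrightarrow>
         (\<Sum>\<^sub>\<infinity>k\<in>{k::int. 2 powi k \<ge> 2 * y1}. sup_cmod (\<lambda>x. osc_I g P (\<alpha>/2 - 1) t \<delta> x k))
           \<le> ennreal (C * (\<delta> powr (- ((\<alpha> + 1) / 2)) / sqrt \<bar>t\<bar>)) \<and>
         (\<forall>x. LP_converges g \<phi>0 (\<alpha>/2 - 1) t \<delta> {k. 2 powi k \<ge> 2 * y1} x) \<and>
         sup_cmod (LP_integral g \<phi>0 (\<alpha>/2 - 1) t \<delta> {k. 2 powi k \<ge> 2 * y1})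
           \<le> ennreal (C * (\<delta> powr (- ((\<alpha> + 1) / 2)) / sqrt \<bar>t\<bar>))))
     \<and>
     ((\<forall>y\<ge>y1. \<bar>deriv g y\<bar> \<ge> lam \<and> \<bar>deriv (deriv g) y\<bar> \<ge> lam * y powr \<alpha>) \<and>
      \<alpha> < -1 \<and> \<alpha> \<noteq> -3 \<longrightarrow>
      (\<exists>C>0. \<forall>t \<delta>. t \<noteq> 0 \<and> \<delta> > 0 \<longrightarrow>
         (\<Sum>\<^sub>\<infinity>k\<in>{k::int. 2 powi k \<ge> 2 * y1}. sup_cmod (\<lambda>x. osc_I g P ((\<alpha> - 5) / 4) t \<delta> x k))
           \<le> ennreal (C * (\<delta> powr (- ((\<alpha> + 1) / 4)) / sqrt \<bar>t\<bar>)) \<and>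
         (\<forall>x. LP_converges g \<phi>0 ((\<alpha> - 5) / 4) t \<delta> {k. 2 powi k \<ge> 2 * y1} x) \<and>
         sup_cmod (LP_integral g \<phi>0 ((\<alpha> - 5) / 4) t \<delta> {k. 2 powi k \<ge> 2 * y1})
           \<le> ennreal (C * (\<delta> powr (- ((\<alpha> + 1) / 4)) / sqrt \<bar>t\<bar>))))"
proof -
  have P': "C1_cutoff P" by (rule annular_cutoff_C1[OF P])
  have y1: "y1 > 0" using y by linarith
  show ?thesis
  proof (intro conjI impI; elim conjE)
    assume "\<forall>y\<in>{0<..y0}. lam \<le> \<bar>deriv g y\<bar>" "finite {y\<in>{0<..y0}. deriv (deriv g) y = 0}"
    then show "\<exists>C>0. \<forall>t \<delta>. \<forall>k::int. t \<noteq> 0 \<and> \<delta> > 0 \<and> 2 powi k \<le> y0 / 2 \<longrightarrow>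
         sup_cmod (\<lambda>x. osc_I g P s t \<delta> x k)
           \<le> ennreal (C * (2 powr ((s + 3/2) * of_int k) * \<delta> powr (- (s + 3/2)) / sqrt \<bar>t\<bar>))"
      by (intro low_frequency_bound[OF P' g lam]) auto
  next
    assume *: "\<forall>y\<in>{y0/2..2*y1}. lam \<le> \<bar>deriv g y\<bar> + \<bar>deriv (deriv g) y\<bar>"
      "finite {y\<in>{y0/2..2*y1}. deriv (deriv g) y = 0}"
    show "\<exists>C>0. \<forall>t \<delta>. t \<noteq> 0 \<and> \<delta> > 0 \<longrightarrow>
         (\<forall>k::int. y0 \<le> 2 powi k \<and> 2 powi k \<le> y1 \<longrightarrow>
            sup_cmod (\<lambda>x. osc_I g P s t \<delta> x k)
              \<le> ennreal (C * (\<delta> powr (- (s + 3/2)) / sqrt \<bar>t\<bar>))) \<and>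
         (\<forall>x. LP_converges g \<phi>0 s t \<delta> {k. y0 \<le> 2 powi k \<and> 2 powi k \<le> y1} x) \<and>
         sup_cmod (LP_integral g \<phi>0 s t \<delta> {k. y0 \<le> 2 powi k \<and> 2 powi k \<le> y1})
           \<le> ennreal (C * (\<delta> powr (- (s + 3/2)) / sqrt \<bar>t\<bar>))"
      by (rule middle_frequency_sums[OF P' \<phi>0 g lam y(2) bspec[OF *(1)] *(2)])
  next
    assume *: "\<forall>y\<ge>y1. lam * y powr (\<alpha> + 1) \<le> \<bar>deriv g y\<bar> \<and> lam * y powr \<alpha> \<le> \<bar>deriv (deriv g) y\<bar>"
      and \<alpha>: "\<alpha> \<noteq> -2"
    \<comment> \<open>Here a = \<alpha> + 1 and \<beta> = \<alpha> + 2, so \<alpha> \<noteq> -2 is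
      the condition \<beta> \<noteq> 0.\<close>
    show "\<exists>C>0. \<forall>t \<delta>. t \<noteq> 0 \<and> \<delta> > 0 \<longrightarrow>
         (\<Sum>\<^sub>\<infinity>k\<in>{k::int. 2 powi k \<ge> 2 * y1}. sup_cmod (\<lambda>x. osc_I g P (\<alpha>/2 - 1) t \<delta> x k))
           \<le> ennreal (C * (\<delta> powr (- ((\<alpha> + 1) / 2)) / sqrt \<bar>t\<bar>)) \<and>
         (\<forall>x. LP_converges g \<phi>0 (\<alpha>/2 - 1) t \<delta> {k. 2 powi k \<ge> 2 * y1} x) \<and>
         sup_cmod (LP_integral g \<phi>0 (\<alpha>/2 - 1) t \<delta> {k. 2 powi k \<ge> 2 * y1})
           \<le> ennreal (C * (\<delta> powr (- ((\<alpha> + 1) / 2)) / sqrt \<bar>t\<bar>))"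
      by (rule high_frequency_sums[where \<beta> = "\<alpha> + 2" and a = "\<alpha> + 1" and \<alpha> = \<alpha>, OF P' \<phi>0 g lam y1])
        (use * \<alpha> in \<open>auto simp: field_simps\<close>)
  next
    assume *: "\<forall>y\<ge>y1. lam \<le> \<bar>deriv g y\<bar> \<and> lam * y powr \<alpha> \<le> \<bar>deriv (deriv g) y\<bar>"
      and \<alpha>: "\<alpha> < -1" "\<alpha> \<noteq> -3"
    \<comment> \<open>The constant lower bound for |g'| is the power a = 0; then \<alpha> < -1 gives
      a >= \<alpha> + 1, and \<alpha> \<noteq> -3 is \<beta> = (\<alpha> + 3)/2 \<noteq> 0.\<close>
    show "\<exists>C>0. \<forall>t \<delta>. t \<noteq> 0 \<and> \<delta> > 0 \<longrightarrow>
         (\<Sum>\<^sub>\<infinity>k\<in>{k::int. 2 powi k \<ge> 2 * y1}. sup_cmod (\<lambda>x. osc_I g P ((\<alpha> - 5) / 4) t \<delta> x k))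
           \<le> ennreal (C * (\<delta> powr (- ((\<alpha> + 1) / 4)) / sqrt \<bar>t\<bar>)) \<and>
         (\<forall>x. LP_converges g \<phi>0 ((\<alpha> - 5) / 4) t \<delta> {k. 2 powi k \<ge> 2 * y1} x) \<and>
         sup_cmod (LP_integral g \<phi>0 ((\<alpha> - 5) / 4) t \<delta> {k. 2 powi k \<ge> 2 * y1})
           \<le> ennreal (C * (\<delta> powr (- ((\<alpha> + 1) / 4)) / sqrt \<bar>t\<bar>))"
      by (rule high_frequency_sums[where \<beta> = "(\<alpha> + 3) / 2" and a = 0 and \<alpha> = \<alpha>, OF P' \<phi>0 g lam y1])
        (use * \<alpha> y1 in \<open>auto simp: field_simps\<close>)
  qed
qed

end
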